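(* Let $G$ be a finite simple graph on $[n]=\{1,\dots,n\}$ and let $J_G=J_{G_1}+J_{G_2}$ be the $s$-partition of $G$ for some $s\in[n]$. If $G$ is a triangle-free graph, then $J_G=J_{G_1}+J_{G_2}$ is a complete Betti splitting.
   Context: Let $k$ be a field and $R=k[x_1,\ldots,x_n,y_1,\ldots,y_n]$ with the standard $\mathbb{N}$-grading. For a graph $H$ with $V(H)\subseteq[n]$, its binomial edge ideal is $J_H=\langle x_iy_j-x_jy_i\mid\{i,j\}\in E(H)\rangle\subseteq R$. For $s\in V(G)$, the $s$-partition of $J_G$ is the splitting $J_G=J_{G_1}+J_{G_2}$, where $G_1$ is the subgraph of $G$ with $V(G_1)=N_G[s]=N_G(s)\cup\{s\}$ and $E(G_1)=\{\{s,t\}\mid t\in N_G(s)\}$, and $G_2=G\setminus\{s\}$ is the graph obtained from $G$ by deleting the vertex $s$. Here $N_G(s)$ is the set of neighbours of $s$. A graph is triangle-free if it has no $3$-cycle as an induced subgraph. Graded Betti numbers are $\beta_{i,j}(L)=\dim_k\mathrm{Tor}_i(k,L)_j$, with $\beta_{i,j}(L)=0$ if $i<0$. If $I=J+K$ are homogeneous ideals such that a minimal homogeneous generating set of $I$ is the disjoint union of minimal homogeneous generating sets of $J$ and $K$, then $I=J+K$ is a complete Betti splitting if $\beta_{i,j}(I)=\beta_{i,j}(J)+\beta_{i,j}(K)+\beta_{i-1,j}(J\cap K)$ for all $i,j\geq 0$. *)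

theory Defs
  imports Complex_Main "HOL-Library.Poly_Mapping" "HOL-Library.Function_Algebras"
begin

section \<open>The polynomial ring \<open>k[x\<^sub>1,\<dots>,x\<^sub>n,y\<^sub>1,\<dots>,y\<^sub>n]\<close>\<close>

datatype indet = Xvar nat | Yvar nat

text \<open>The linear order on the indeterminates only serves to fix the signs in the Koszul complex.\<close>

fun indet_rank :: "indet \<Rightarrow> nat" where
  "indet_rank (Xvar i) = 2 * i"
| "indet_rank (Yvar i) = Suc (2 * i)"

lemma indet_rank_inj: "indet_rank u = indet_rank v \<Longrightarrow> u = v"
  by (cases u; cases v; simp; presburger)

instantiation indet :: linorder
begin
definition "u \<le> v \<longleftrightarrow> indet_rank u \<le> indet_rank v"
definition "u < v \<longleftrightarrow> indet_rank u < indet_rank v"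
instance
  by standard (auto simp: less_eq_indet_def less_indet_def intro: indet_rank_inj)
end

type_synonym monomial = "indet \<Rightarrow>\<^sub>0 nat"
type_synonym 'k mpoly = "monomial \<Rightarrow>\<^sub>0 'k"

definition Var :: "indet \<Rightarrow> 'k::field mpoly" where
  "Var v = Poly_Mapping.single (Poly_Mapping.single v 1) 1"

definition Const :: "'k::field \<Rightarrow> 'k mpoly" where
  "Const c = Poly_Mapping.single 0 c"

definition indets :: "nat \<Rightarrow> indet set" where
  "indets n = Xvar ` {1..n} \<union> Yvar ` {1..n}"

text \<open>The type \<open>'k mpoly\<close> has infinitely many indeterminates; \<open>R\<close> is the following subring of it.\<close>

definition pring :: "nat \<Rightarrow> 'k::field mpoly set" where
  "pring n = {p. \<forall>m\<in>Poly_Mapping.keys p. Poly_Mapping.keys m \<subseteq> indets n}"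

definition mdeg :: "monomial \<Rightarrow> nat" where
  "mdeg m = (\<Sum>v\<in>Poly_Mapping.keys m. Poly_Mapping.lookup m v)"

definition homogeneous :: "nat \<Rightarrow> 'k::field mpoly \<Rightarrow> bool" where
  "homogeneous d p \<longleftrightarrow> (\<forall>m\<in>Poly_Mapping.keys p. mdeg m = d)"

definition ideal_gen :: "nat \<Rightarrow> 'k::field mpoly set \<Rightarrow> 'k mpoly set" where
  "ideal_gen n B = {\<Sum>g\<in>A. r g * g | A r. finite A \<and> A \<subseteq> B \<and> (\<forall>g\<in>A. r g \<in> pring n)}"

definition ideal_sum :: "'k::field mpoly set \<Rightarrow> 'k mpoly set \<Rightarrow> 'k mpoly set" where
  "ideal_sum J K = {p + q | p q. p \<in> J \<and> q \<in> K}"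

definition minimal_homogeneous_generators ::
    "nat \<Rightarrow> 'k::field mpoly set \<Rightarrow> 'k mpoly set \<Rightarrow> bool" where
  "minimal_homogeneous_generators n A I \<longleftrightarrow>
     A \<subseteq> pring n \<and> (\<forall>g\<in>A. \<exists>d. homogeneous d g) \<and>
     ideal_gen n A = I \<and> (\<forall>A'. A' \<subset> A \<longrightarrow> ideal_gen n A' \<noteq> I)"


section \<open>Graded complexes of free modules and Tor\<close>

text \<open>
  A complex \<open>F\<close> of graded free \<open>R\<close>-modules of finite rank, placed in homological degrees \<open>\<ge> 0\<close>,
  is given by bases of the \<open>F\<^sub>i\<close>, the degrees of the basis elements, and the matrices of the
  differentials: \<open>dmat F i b c\<close> is the coefficient at \<open>c \<in> basis F i\<close> of the image of
  \<open>b \<in> basis F (Suc i)\<close> under \<open>F\<^sub>i\<^sub>+\<^sub>1 \<rightarrow> F\<^sub>i\<close>.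
\<close>

record (overloaded) ('b, 'k::zero) graded_complex =
  basis :: "nat \<Rightarrow> 'b set"
  shift :: "nat \<Rightarrow> 'b \<Rightarrow> nat"
  dmat :: "nat \<Rightarrow> 'b \<Rightarrow> 'b \<Rightarrow> 'k mpoly"

text \<open>
  For an ideal \<open>M\<close> of \<open>R\<close>, the module \<open>F\<^sub>i \<otimes>\<^sub>R M\<close> is the direct sum of copies of \<open>M\<close> indexed by the
  basis of \<open>F\<^sub>i\<close>; its elements are represented as functions vanishing outside the basis.
\<close>

definition chains ::
    "('b, 'k::field) graded_complex \<Rightarrow> 'k mpoly set \<Rightarrow> nat \<Rightarrow> ('b \<Rightarrow> 'k mpoly) set" where
  "chains F M i = {f. (\<forall>b\<in>basis F i. f b \<in> M) \<and> (\<forall>b. b \<notin> basis F i \<longrightarrow> f b = 0)}"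

definition bdry ::
    "('b, 'k::field) graded_complex \<Rightarrow> nat \<Rightarrow> ('b \<Rightarrow> 'k mpoly) \<Rightarrow> ('b \<Rightarrow> 'k mpoly)" where
  "bdry F i f = (\<lambda>c. if c \<in> basis F i then \<Sum>b\<in>basis F (Suc i). f b * dmat F i b c else 0)"

fun cycles ::
    "('b, 'k::field) graded_complex \<Rightarrow> 'k mpoly set \<Rightarrow> nat \<Rightarrow> ('b \<Rightarrow> 'k mpoly) set" where
  "cycles F M 0 = chains F M 0"
| "cycles F M (Suc i) = {f \<in> chains F M (Suc i). bdry F i f = 0}"

text \<open>The component of degree \<open>j\<close> of the graded module \<open>F\<^sub>i \<otimes>\<^sub>R M\<close>.\<close>

definition strand ::
    "('b, 'k::field) graded_complex \<Rightarrow> 'k mpoly set \<Rightarrow> nat \<Rightarrow> nat \<Rightarrow> ('b \<Rightarrow> 'k mpoly) set" where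
  "strand F M i j =
     {f \<in> chains F M i. \<forall>b\<in>basis F i. \<forall>m\<in>Poly_Mapping.keys (f b). mdeg m + shift F i b = j}"

definition kscale :: "'k::field \<Rightarrow> ('b \<Rightarrow> 'k mpoly) \<Rightarrow> ('b \<Rightarrow> 'k mpoly)" where
  "kscale c f = (\<lambda>b. Const c * f b)"

interpretation chain_space: vector_space kscale
  by standard
     (auto simp: kscale_def Const_def fun_eq_iff single_add algebra_simps mult_single
        mult.assoc[symmetric])

text \<open>
  \<open>dim\<^sub>k H\<^sub>i(F \<otimes>\<^sub>R M)\<^sub>j\<close>, as the dimension of the cycles of degree \<open>j\<close> modulo the subspace of boundaries
  of degree \<open>j\<close>. Both spaces are finite-dimensional when \<open>M \<subseteq> pring n\<close>, so the subtraction computes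
  the dimension of the quotient.
\<close>

definition homology_dim ::
    "('b, 'k::field) graded_complex \<Rightarrow> 'k mpoly set \<Rightarrow> nat \<Rightarrow> nat \<Rightarrow> nat" where
  "homology_dim F M i j =
     chain_space.dim (cycles F M i \<inter> strand F M i j)
     - chain_space.dim (bdry F i ` strand F M (Suc i) j)"

text \<open>
  \<open>F\<close> is a graded free resolution of \<open>k = R/\<langle>x\<^sub>1,\<dots>,y\<^sub>n\<rangle>\<close>: the differentials are homogeneous of degree
  \<open>0\<close>, \<open>F\<close> is exact in positive homological degrees, and \<open>F\<^sub>1 \<rightarrow> F\<^sub>0 \<rightarrow> k \<rightarrow> 0\<close> is exact for some graded
  augmentation \<open>F\<^sub>0 \<rightarrow> k\<close>. An \<open>R\<close>-linear map \<open>F\<^sub>0 \<rightarrow> k\<close> sends \<open>f\<close> to the sum of the products of the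
  value at the basis element \<open>c\<close> with the constant coefficient of \<open>f c\<close>.
\<close>

definition free_resolution_of_residue_field ::
    "nat \<Rightarrow> ('b, 'k::field) graded_complex \<Rightarrow> bool" where
  "free_resolution_of_residue_field n F \<longleftrightarrow>
     (\<forall>i. finite (basis F i)) \<and>
     (\<forall>i. \<forall>b\<in>basis F (Suc i). \<forall>c\<in>basis F i. dmat F i b c \<in> pring n \<and>
        (\<forall>m\<in>Poly_Mapping.keys (dmat F i b c). mdeg m + shift F i c = shift F (Suc i) b)) \<and>
     (\<forall>i. cycles F (pring n) (Suc i) = bdry F (Suc i) ` chains F (pring n) (Suc (Suc i))) \<and>
     (\<exists>\<epsilon>. (\<forall>c\<in>basis F 0. \<epsilon> c \<noteq> 0 \<longrightarrow> shift F 0 c = 0) \<and> (\<exists>c\<in>basis F 0. \<epsilon> c \<noteq> 0) \<and>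
        bdry F 0 ` chains F (pring n) 1 =
          {f \<in> chains F (pring n) 0. (\<Sum>c\<in>basis F 0. \<epsilon> c * Poly_Mapping.lookup (f c) 0) = 0})"

text \<open>
  The Koszul complex on the indeterminates. The basis element \<open>e\<^sub>T\<close>, for a set \<open>T\<close> of indeterminates,
  has degree \<open>card T\<close>, and \<open>e\<^sub>S \<mapsto> \<Sum>v\<in>S. \<plusminus> v \<cdot> e\<^sub>S\<^sub>-\<^sub>v\<close>.
\<close>

definition koszul :: "nat \<Rightarrow> (indet set, 'k::field) graded_complex" where
  "koszul n =
     \<lparr>basis = (\<lambda>i. {T. T \<subseteq> indets n \<and> card T = i}),
      shift = (\<lambda>i T. card T),
      dmat = (\<lambda>i S T. \<Sum>v\<in>S. if T = S - {v} then (- 1) ^ card {w\<in>S. w < v} * Var v else 0)\<rparr>"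

text \<open>
  \<open>Tor\<^sub>i(k, L)\<close> is the homology of \<open>P \<otimes>\<^sub>R L\<close> for a graded free resolution \<open>P\<close> of \<open>k\<close>. We take \<open>P\<close> to be
  the Koszul complex; that it is such a resolution is proved below (\<open>koszul_resolution\<close>).
\<close>

definition tor_dim :: "nat \<Rightarrow> nat \<Rightarrow> nat \<Rightarrow> 'k::field mpoly set \<Rightarrow> nat" where
  "tor_dim n i j L = homology_dim (koszul n) L i j"

definition graded_betti :: "nat \<Rightarrow> int \<Rightarrow> nat \<Rightarrow> 'k::field mpoly set \<Rightarrow> nat" where
  "graded_betti n i j L = (if i < 0 then 0 else tor_dim n (nat i) j L)"

definition complete_betti_splitting ::
    "nat \<Rightarrow> 'k::field mpoly set \<Rightarrow> 'k mpoly set \<Rightarrow> 'k mpoly set \<Rightarrow> bool" where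
  "complete_betti_splitting n I J K \<longleftrightarrow>
     I = ideal_sum J K \<and>
     (\<exists>A B. minimal_homogeneous_generators n A J \<and> minimal_homogeneous_generators n B K \<and>
        A \<inter> B = {} \<and> minimal_homogeneous_generators n (A \<union> B) I) \<and>
     (\<forall>i\<ge>0. \<forall>j. graded_betti n i j I =
        graded_betti n i j J + graded_betti n i j K + graded_betti n (i - 1) j (J \<inter> K))"


subsection \<open>The Koszul complex is a resolution\<close>

lemma finite_indets [simp]: "finite (indets n)"
  by (simp add: indets_def)

lemma finite_subset_indets: "T \<subseteq> indets n \<Longrightarrow> finite T"
  by (rule finite_subset[OF _ finite_indets])

abbreviation ksgn :: "indet set \<Rightarrow> indet \<Rightarrow> 'a::ring_1" where
  "ksgn T v \<equiv> (- 1) ^ card {w\<in>T. w < v}"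

lemma koszul_simps [simp]:
  "basis (koszul n) i = {T. T \<subseteq> indets n \<and> card T = i}"
  "shift (koszul n) i T = card T"
  by (simp_all add: koszul_def)

lemma finite_koszul_basis: "finite {T. T \<subseteq> indets n \<and> card T = i}"
  by (rule finite_subset[of _ "Pow (indets n)"]) auto

lemma koszul_dmat_insert:
  assumes "finite T" "v \<notin> T"
  shows "dmat (koszul n :: (_, 'k::field) graded_complex) i (insert v T) T = ksgn T v * Var v"
proof -
  have "dmat (koszul n :: (_, 'k) graded_complex) i (insert v T) T =
      (\<Sum>u\<in>insert v T. if u = v then ksgn (insert v T) u * Var u else 0)"
    proof -
    have "T = insert v T - {u} \<longleftrightarrow> u = v" if "u \<in> insert v T" for u
      using that assms(2) by auto
    then show ?thesis
      unfolding koszul_def graded_complex.simps by (intro sum.cong refl) simp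
  qed
  also have "\<dots> = ksgn (insert v T) v * Var v"
    using assms by (simp add: sum.delta)
  also have "{w \<in> insert v T. w < v} = {w \<in> T. w < v}" by auto
  finally show ?thesis .
qed

lemma koszul_dmat_eq_0:
  assumes "\<And>v. v \<in> S \<Longrightarrow> T \<noteq> S - {v}"
  shows "dmat (koszul n :: (_, 'k::field) graded_complex) i S T = 0"
  unfolding koszul_def using assms by (auto intro!: sum.neutral)

lemma koszul_bdry:
  fixes f :: "indet set \<Rightarrow> 'k::field mpoly"
  assumes "T \<subseteq> indets n" "card T = i"
  shows "bdry (koszul n) i f T = (\<Sum>v\<in>indets n - T. ksgn T v * Var v * f (insert v T))"
proof -
  have fT: "finite T" using assms(1) by (rule finite_subset_indets)
  let ?B = "{S. S \<subseteq> indets n \<and> card S = Suc i}"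
  let ?C = "(\<lambda>v. insert v T) ` (indets n - T)"
  have inj: "inj_on (\<lambda>v. insert v T) (indets n - T)"
    by (auto simp: inj_on_def)
  have "bdry (koszul n) i f T = (\<Sum>S\<in>?B. f S * dmat (koszul n) i S T)"
    using assms by (simp add: bdry_def)
  also have "\<dots> = (\<Sum>S\<in>?C. f S * dmat (koszul n) i S T)"
  proof (rule sum.mono_neutral_right)
    show "finite ?B" by (rule finite_koszul_basis)
    show "?C \<subseteq> ?B" using assms fT by auto
    show "\<forall>S\<in>?B - ?C. f S * dmat (koszul n) i S T = 0"
    proof
      fix S assume S: "S \<in> ?B - ?C"
      have "T \<noteq> S - {v}" if "v \<in> S" for v
        using S that by (auto simp: insert_absorb image_iff)
      then show "f S * dmat (koszul n) i S T = 0"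
        by (simp add: koszul_dmat_eq_0)
    qed
  qed
  also have "\<dots> = (\<Sum>v\<in>indets n - T. f (insert v T) * dmat (koszul n) i (insert v T) T)"
    by (simp add: sum.reindex[OF inj])
  also have "\<dots> = (\<Sum>v\<in>indets n - T. ksgn T v * Var v * f (insert v T))"
    by (rule sum.cong) (auto simp: koszul_dmat_insert fT mult_ac)
  finally show ?thesis .
qed

lemma lookup_monom_mult:
  fixes p :: "'k::field mpoly"
  shows "Poly_Mapping.lookup (Poly_Mapping.single a 1 * p) m =
    (if \<exists>b. m = a + b then Poly_Mapping.lookup p (m - a) else 0)"
proof -
  have "Poly_Mapping.lookup (Poly_Mapping.single a 1 * p) m =
      (\<Sum>l. Poly_Mapping.lookup (Poly_Mapping.single a (1::'k)) l * (\<Sum>q. Poly_Mapping.lookup p q when m = l + q))"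
    by (rule lookup_mult)
  also have "\<dots> = (\<Sum>l. (\<Sum>q. Poly_Mapping.lookup p q when m = a + q) when l = a)"
    by (rule arg_cong[where f = Sum_any]) (auto simp: lookup_single fun_eq_iff when_def)
  also have "\<dots> = (\<Sum>q. Poly_Mapping.lookup p q when m = a + q)"
    by simp
  also have "\<dots> = (if \<exists>b. m = a + b then Poly_Mapping.lookup p (m - a) else 0)"
  proof (cases "\<exists>b. m = a + b")
    case True
    then obtain b where b: "m = a + b" by blast
    then have "(\<Sum>q. Poly_Mapping.lookup p q when m = a + q) = (\<Sum>q. Poly_Mapping.lookup p q when q = b)"
      by (intro arg_cong[where f = Sum_any]) (auto simp: fun_eq_iff when_def)
    then show ?thesis using b by auto
  next
    case False
    then show ?thesis by simp
  qed
  finally show ?thesis .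
qed

lemma monom_factor:
  fixes m :: monomial
  assumes "v \<in> Poly_Mapping.keys m"
  shows "m - Poly_Mapping.single v 1 + Poly_Mapping.single v 1 = m"
  using assms
  by (auto intro!: poly_mapping_eqI simp: lookup_add lookup_minus lookup_single when_def in_keys_iff)

lemma lookup_Var_mult:
  fixes p :: "'k::field mpoly"
  shows "Poly_Mapping.lookup (Var v * p) m =
    (if v \<in> Poly_Mapping.keys m then Poly_Mapping.lookup p (m - Poly_Mapping.single v 1) else 0)"
proof -
  have "(\<exists>b. m = Poly_Mapping.single v 1 + b) \<longleftrightarrow> v \<in> Poly_Mapping.keys m"
    by (metis monom_factor add.commute in_keys_iff lookup_add lookup_single_eq add_is_0 one_neq_zero)
  then show ?thesis
    unfolding Var_def lookup_monom_mult by simp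
qed

lemma lookup_sgn_mult:
  fixes p :: "'k::field mpoly"
  shows "Poly_Mapping.lookup ((- 1) ^ a * p) m = (- 1) ^ a * Poly_Mapping.lookup p m"
  by (cases "even a") simp_all

lemma lookup_koszul_bdry:
  fixes f :: "indet set \<Rightarrow> 'k::field mpoly"
  assumes "T \<subseteq> indets n" "card T = i"
  shows "Poly_Mapping.lookup (bdry (koszul n) i f T) m =
    (\<Sum>v\<in>(indets n - T) \<inter> Poly_Mapping.keys m.
       ksgn T v * Poly_Mapping.lookup (f (insert v T)) (m - Poly_Mapping.single v 1))"
  unfolding koszul_bdry[OF assms] lookup_sum mult.assoc lookup_sgn_mult lookup_Var_mult
  by (simp add: sum.inter_restrict if_distrib cong: if_cong)

lemma pring_add: "p \<in> pring n \<Longrightarrow> q \<in> pring n \<Longrightarrow> p + q \<in> pring n"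
  unfolding pring_def using keys_add[of p q] by blast

lemma keys_nat_add: "Poly_Mapping.keys (a + b :: monomial) = Poly_Mapping.keys a \<union> Poly_Mapping.keys b"
  by (auto simp: in_keys_iff lookup_add)

lemma pring_mult: "p \<in> pring n \<Longrightarrow> q \<in> pring n \<Longrightarrow> p * q \<in> pring n"
  unfolding pring_def using keys_mult[of p q] keys_nat_add by blast

lemma pring_0: "0 \<in> pring n" by (simp add: pring_def)

lemma pring_sum: "(\<And>a. a \<in> A \<Longrightarrow> g a \<in> pring n) \<Longrightarrow> sum g A \<in> pring n"
  by (induction A rule: infinite_finite_induct) (auto simp: pring_0 pring_add)

lemma pring_Var: "v \<in> indets n \<Longrightarrow> Var v \<in> pring n"
  by (simp add: pring_def Var_def)

lemma pring_sgn: "(- 1) ^ a \<in> pring n"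
  by (cases "even a") (simp_all add: pring_def)

lemma koszul_bdry_chains:
  assumes "f \<in> chains (koszul n) (pring n) (Suc i)"
  shows "bdry (koszul n) i f \<in> chains (koszul n) (pring n) i"
proof -
  have "bdry (koszul n) i f T \<in> pring n" if T: "T \<subseteq> indets n" "card T = i" for T
  proof -
    have "finite T" using T(1) by (rule finite_subset_indets)
    then have "f (insert v T) \<in> pring n" if "v \<in> indets n - T" for v
      using assms that T by (auto simp: chains_def)
    then show ?thesis
      unfolding koszul_bdry[OF T] by (intro pring_sum pring_mult pring_sgn pring_Var) auto
  qed
  then show ?thesis by (auto simp: chains_def bdry_def)
qed

lemma ksgn_insert:
  assumes "finite T" "u \<notin> T"
  shows "ksgn (insert u T) v = (if u < v then - ksgn T v else (ksgn T v :: 'a::ring_1))"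
proof (cases "u < v")
  case True
  then have "{w \<in> insert u T. w < v} = insert u {w \<in> T. w < v}" by auto
  then show ?thesis using True assms by simp
next
  case False
  then have "{w \<in> insert u T. w < v} = {w \<in> T. w < v}" by auto
  then show ?thesis using False by (simp del: mem_Collect_eq)
qed

lemma koszul_bdry_bdry:
  fixes f :: "indet set \<Rightarrow> 'k::field mpoly"
  shows "bdry (koszul n) i (bdry (koszul n) (Suc i) f) = 0"
proof
  fix T
  show "bdry (koszul n) i (bdry (koszul n) (Suc i) f) T = 0 T"
  proof (cases "T \<subseteq> indets n \<and> card T = i")
    case False
    then have "T \<notin> basis (koszul n :: (_, 'k) graded_complex) i" by simp
    then show ?thesis unfolding bdry_def by (simp only: if_False zero_fun_apply)
  next
    case True
    then have T: "T \<subseteq> indets n" "card T = i" "finite T"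
      using finite_subset_indets by auto
    define D where "D = indets n - T"
    have fD: "finite D" by (simp add: D_def)
    define h where "h v w = ksgn T v * Var v * (ksgn (insert v T) w * Var w * f (insert w (insert v T)))"
      for v w
    have anti: "h v w = - h w v" if "v \<in> D" "w \<in> D" "v < w" for v w
    proof -
      have "v \<notin> T" "w \<notin> T" "\<not> w < v" using that by (auto simp: D_def)
      then have "ksgn (insert v T) w = (- ksgn T w :: 'k mpoly)" "ksgn (insert w T) v = (ksgn T v :: 'k mpoly)"
        using that(3) ksgn_insert[of T v w, where 'a = "'k mpoly"]
          ksgn_insert[of T w v, where 'a = "'k mpoly"] T(3) by presburger+
      then show ?thesis
        unfolding h_def by (simp only: insert_commute[of w v]) (simp add: mult_ac)
    qed
    have "bdry (koszul n) i (bdry (koszul n) (Suc i) f) T =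
        (\<Sum>v\<in>D. ksgn T v * Var v * bdry (koszul n) (Suc i) f (insert v T))"
      by (simp add: koszul_bdry T D_def)
    also have "\<dots> = (\<Sum>v\<in>D. \<Sum>w\<in>D - {v}. h v w)"
    proof (rule sum.cong[OF refl])
      fix v assume v: "v \<in> D"
      have "bdry (koszul n) (Suc i) f (insert v T) =
          (\<Sum>w\<in>indets n - insert v T. ksgn (insert v T) w * Var w * f (insert w (insert v T)))"
        by (rule koszul_bdry) (use v T in \<open>auto simp: D_def\<close>)
      moreover have "indets n - insert v T = D - {v}" by (auto simp: D_def)
      ultimately show "ksgn T v * Var v * bdry (koszul n) (Suc i) f (insert v T) = (\<Sum>w\<in>D - {v}. h v w)"
        by (simp add: h_def sum_distrib_left)
    qed
    also have "\<dots> = (\<Sum>v\<in>D. (\<Sum>w\<in>D. if v < w then h v w else 0) + (\<Sum>w\<in>D. if w < v then h v w else 0))"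
    proof (rule sum.cong[OF refl])
      fix v assume v: "v \<in> D"
      have "(\<Sum>w\<in>D - {v}. h v w) = (\<Sum>w\<in>D. if w \<noteq> v then h v w else 0)"
        using fD by (intro sum.mono_neutral_cong_left) auto
      also have "\<dots> = (\<Sum>w\<in>D. (if v < w then h v w else 0) + (if w < v then h v w else 0))"
        by (intro sum.cong) auto
      finally show "(\<Sum>w\<in>D - {v}. h v w) =
          (\<Sum>w\<in>D. if v < w then h v w else 0) + (\<Sum>w\<in>D. if w < v then h v w else 0)"
        by (simp add: sum.distrib)
    qed
    also have "\<dots> = (\<Sum>v\<in>D. \<Sum>w\<in>D. if v < w then h v w else 0) + (\<Sum>v\<in>D. \<Sum>w\<in>D. if w < v then h v w else 0)"
      by (simp add: sum.distrib)
    also have "(\<Sum>v\<in>D. \<Sum>w\<in>D. if w < v then h v w else 0) = (\<Sum>w\<in>D. \<Sum>v\<in>D. if w < v then h v w else 0)"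
      by (rule sum.swap)
    also have "\<dots> = (\<Sum>w\<in>D. \<Sum>v\<in>D. - (if w < v then h w v else 0))"
    proof (intro sum.cong refl)
      fix w v assume "w \<in> D" "v \<in> D"
      then show "(if w < v then h v w else 0) = - (if w < v then h w v else 0)"
        using anti[of w v] by simp
    qed
    finally show ?thesis by (simp add: sum_negf)
  qed
qed

text \<open>
  A \<open>k\<close>-linear contracting homotopy, valid in every characteristic: with \<open>u\<close> the least indeterminate
  occurring in \<open>m\<close> or in \<open>T\<close>, it sends \<open>m \<cdot> e\<^sub>T\<close> to \<open>(m / u) \<cdot> e\<^sub>T\<^sub>+\<^sub>u\<close> if \<open>u \<notin> T\<close>, and to \<open>0\<close> otherwise.
\<close>

definition hcoeff :: "(indet set \<Rightarrow> 'k::field mpoly) \<Rightarrow> indet set \<Rightarrow> monomial \<Rightarrow> 'k" where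
  "hcoeff f T m = (let u = Min (Poly_Mapping.keys m \<union> T) in
     if u \<in> T then Poly_Mapping.lookup (f (T - {u})) (m + Poly_Mapping.single u 1) else 0)"

definition hmap :: "(indet set \<Rightarrow> 'k::field mpoly) \<Rightarrow> indet set \<Rightarrow> 'k mpoly" where
  "hmap f T = (if finite T then Abs_poly_mapping (hcoeff f T) else 0)"

lemma lookup_hmap:
  assumes "finite T"
  shows "Poly_Mapping.lookup (hmap f T) m = hcoeff f T m"
proof -
  have "{m. hcoeff f T m \<noteq> 0} \<subseteq>
      (\<Union>u\<in>T. (\<lambda>m. m - Poly_Mapping.single u 1) ` Poly_Mapping.keys (f (T - {u})))"
  proof
    fix m assume "m \<in> {m. hcoeff f T m \<noteq> 0}"
    then obtain u where u: "u \<in> T"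
        "m + Poly_Mapping.single u 1 \<in> Poly_Mapping.keys (f (T - {u}))"
      by (auto simp: hcoeff_def Let_def in_keys_iff split: if_splits)
    have "m = (m + Poly_Mapping.single u 1) - Poly_Mapping.single u 1" by simp
    with u show "m \<in> (\<Union>u\<in>T. (\<lambda>m. m - Poly_Mapping.single u 1) ` Poly_Mapping.keys (f (T - {u})))"
      by blast
  qed
  then have "finite {m. hcoeff f T m \<noteq> 0}"
    by (rule finite_subset) (use assms in auto)
  then show ?thesis using assms by (simp add: hmap_def)
qed

lemma hmap_chains:
  fixes f :: "indet set \<Rightarrow> 'a::field mpoly"
  assumes f: "f \<in> chains (koszul n) (pring n) i"
  shows "hmap f \<in> chains (koszul n) (pring n) (Suc i)"
proof -
  have key: "T \<subseteq> indets n \<and> card T = Suc i \<and> Poly_Mapping.keys m \<subseteq> indets n"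
    if "finite T" "hcoeff f T m \<noteq> 0" for T m
  proof -
    from that(2) obtain u where u: "u \<in> T"
        "m + Poly_Mapping.single u 1 \<in> Poly_Mapping.keys (f (T - {u}))"
      by (auto simp: hcoeff_def Let_def in_keys_iff split: if_splits)
    then have ne: "f (T - {u}) \<noteq> 0" by auto
    have "T - {u} \<in> basis (koszul n :: (_, 'a) graded_complex) i"
      using f ne unfolding chains_def by blast
    moreover from this have "f (T - {u}) \<in> pring n"
      using f unfolding chains_def by blast
    ultimately have B: "T - {u} \<subseteq> indets n" "card (T - {u}) = i" "f (T - {u}) \<in> pring n"
      by simp_all
    with u(2) have "Poly_Mapping.keys (m + Poly_Mapping.single u 1) \<subseteq> indets n"
      by (auto simp: pring_def)
    then have "Poly_Mapping.keys m \<subseteq> indets n" "u \<in> indets n"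
      by (auto simp: keys_nat_add)
    moreover have "card T = Suc i" using B(2) u(1) that(1) by (metis card.remove)
    ultimately show ?thesis using B(1) by auto
  qed
  have "hmap f T \<in> pring n" for T
  proof (cases "finite T")
    case True
    show ?thesis unfolding pring_def
    proof (intro CollectI ballI)
      fix m assume "m \<in> Poly_Mapping.keys (hmap f T)"
      then have "hcoeff f T m \<noteq> 0" by (simp add: in_keys_iff lookup_hmap True)
      then show "Poly_Mapping.keys m \<subseteq> indets n" using key[OF True] by blast
    qed
  qed (simp add: hmap_def pring_0)
  moreover have "hmap f T = 0" if "\<not> (T \<subseteq> indets n \<and> card T = Suc i)" for T
  proof (cases "finite T")
    case True
    show ?thesis using key[OF True] that
      by (intro poly_mapping_eqI) (auto simp: lookup_hmap True)
  qed (simp add: hmap_def)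
  ultimately show ?thesis by (auto simp: chains_def)
qed

lemma koszul_homotopy:
  fixes f :: "indet set \<Rightarrow> 'k::field mpoly"
  assumes f: "f \<in> chains (koszul n) (pring n) i"
    and cyc: "\<And>l. i = Suc l \<Longrightarrow> bdry (koszul n) l f = 0"
    and base: "i = 0 \<Longrightarrow> Poly_Mapping.lookup (f {}) 0 = 0"
  shows "bdry (koszul n) i (hmap f) = f"
proof
  fix T
  show "bdry (koszul n) i (hmap f) T = f T"
  proof (cases "T \<subseteq> indets n \<and> card T = i")
    case False
    then show ?thesis using f by (auto simp: chains_def bdry_def)
  next
    case True
    then have T: "T \<subseteq> indets n" "card T = i" and fT: "finite T"
      using finite_subset_indets by auto
    have fTR: "f T \<in> pring n" using f T by (simp add: chains_def)
    show ?thesis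
    proof (rule poly_mapping_eqI)
      fix m :: monomial
      let ?s = "\<lambda>v. Poly_Mapping.single v (1::nat)"
      let ?N = "(indets n - T) \<inter> Poly_Mapping.keys m"
      define U where "U = Poly_Mapping.keys m \<union> T"
      have fU: "finite U" using fT by (simp add: U_def)
      have L: "Poly_Mapping.lookup (bdry (koszul n) i (hmap f) T) m =
          (\<Sum>v\<in>?N. ksgn T v * hcoeff f (insert v T) (m - ?s v))"
        by (simp add: lookup_koszul_bdry[OF T] lookup_hmap fT)
      show "Poly_Mapping.lookup (bdry (koszul n) i (hmap f) T) m = Poly_Mapping.lookup (f T) m"
      proof (cases "U = {}")
        case True
        then have "m = 0" "T = {}" by (auto simp: U_def)
        then show ?thesis using L base T by simp
      next
        case False
        define u where "u = Min U"
        have uU: "u \<in> U" and umin: "\<And>v. v \<in> U \<Longrightarrow> u \<le> v"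
          using False fU by (auto simp: u_def)
        have Uv: "Poly_Mapping.keys (m - ?s v) \<union> insert v T = U" if "v \<in> ?N" for v
        proof -
          have "Poly_Mapping.keys m = Poly_Mapping.keys (m - ?s v) \<union> {v}"
            using monom_factor[of v m] that keys_nat_add[of "m - ?s v" "?s v"] by simp
          then show ?thesis by (auto simp: U_def)
        qed
        have hc: "hcoeff f (insert v T) (m - ?s v) =
            (if u \<in> insert v T then Poly_Mapping.lookup (f (insert v T - {u})) (m - ?s v + ?s u) else 0)"
          if "v \<in> ?N" for v
          using Uv[OF that] by (simp add: hcoeff_def Let_def u_def)
        show ?thesis
        proof (cases "u \<in> T")
          case False
          then have um: "u \<in> Poly_Mapping.keys m" using uU by (auto simp: U_def)
          have sg: "ksgn T u = (1 :: 'k)"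
          proof -
            have "{w \<in> T. w < u} = {}" using umin by (force simp: U_def)
            then show ?thesis by (simp only: card.empty power_0)
          qed
          have "(\<Sum>v\<in>?N. ksgn T v * hcoeff f (insert v T) (m - ?s v)) =
              (\<Sum>v\<in>?N. if v = u then Poly_Mapping.lookup (f T) m else 0)"
          proof (rule sum.cong[OF refl])
            fix v assume v: "v \<in> ?N"
            show "ksgn T v * hcoeff f (insert v T) (m - ?s v) =
                (if v = u then Poly_Mapping.lookup (f T) m else 0)"
            proof (cases "v = u")
              case True
              then have "hcoeff f (insert v T) (m - ?s v) = Poly_Mapping.lookup (f T) m"
                using hc[OF v] False monom_factor[OF um] by simp
              then show ?thesis using True sg by simp
            next
              case neq: False
              then show ?thesis using hc[OF v] False by simp
            qed
          qed
          also have "\<dots> = (if u \<in> ?N then Poly_Mapping.lookup (f T) m else 0)"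
            by (simp add: sum.delta')
          also have "\<dots> = Poly_Mapping.lookup (f T) m"
          proof (cases "u \<in> indets n")
            case True
            then show ?thesis using um False by simp
          next
            case notin: False
            then have "m \<notin> Poly_Mapping.keys (f T)" using um fTR by (auto simp: pring_def)
            then show ?thesis using notin by (simp add: in_keys_iff)
          qed
          finally show ?thesis using L by simp
        next
          case True
          then have u_in: "u \<in> indets n" using T by auto
          define T' where "T' = T - {u}"
          have T': "T' \<subseteq> indets n" "finite T'" "u \<notin> T'" "insert u T' = T"
            using T fT True by (auto simp: T'_def)
          obtain l where l: "i = Suc l" using True T(2) fT by (metis card_gt_0_iff empty_iff gr0_implies_Suc)
          have cT': "card T' = l" using T' T(2) l by (metis card_insert_disjoint diff_Suc_1)
          let ?m = "m + ?s u"
          have NN: "(indets n - T') \<inter> Poly_Mapping.keys ?m = insert u ?N"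
            using T' u_in by (auto simp: keys_nat_add)
          have "0 = Poly_Mapping.lookup (bdry (koszul n) l f T') ?m"
            by (simp add: cyc[OF l])
          also have "\<dots> = (\<Sum>v\<in>insert u ?N. ksgn T' v * Poly_Mapping.lookup (f (insert v T')) (?m - ?s v))"
            unfolding lookup_koszul_bdry[OF T'(1) cT'] NN ..
          also have "\<dots> = ksgn T' u * Poly_Mapping.lookup (f (insert u T')) (?m - ?s u)
              + (\<Sum>v\<in>?N. ksgn T' v * Poly_Mapping.lookup (f (insert v T')) (?m - ?s v))"
            by (rule sum.insert) (use True in auto)
          also have "ksgn T' u = (1 :: 'k)"
          proof -
            have "{w \<in> T'. w < u} = {}" using umin by (force simp: U_def T'_def)
            then show ?thesis by (simp only: card.empty power_0)
          qed
          also have "(\<Sum>v\<in>?N. ksgn T' v * Poly_Mapping.lookup (f (insert v T')) (?m - ?s v)) =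
              (\<Sum>v\<in>?N. - (ksgn T v * hcoeff f (insert v T) (m - ?s v)))"
          proof (rule sum.cong[OF refl])
            fix v assume v: "v \<in> ?N"
            then have uv: "u < v" using umin[of v] True by (auto simp: U_def less_le)
            have "ksgn T v = - (ksgn T' v :: 'k)"
              using ksgn_insert[of T' u v, where 'a = 'k] T' uv by simp
            moreover have "insert v T - {u} = insert v T'"
              using uv v T' by (auto simp: T'_def)
            moreover have "?m - ?s v = m - ?s v + ?s u"
            proof -
              have "?m = (m - ?s v + ?s u) + ?s v"
                using monom_factor[of v m] v by (simp add: ac_simps)
              then show ?thesis by simp
            qed
            ultimately show "ksgn T' v * Poly_Mapping.lookup (f (insert v T')) (?m - ?s v) =
                - (ksgn T v * hcoeff f (insert v T) (m - ?s v))"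
              using hc[OF v] True by simp
          qed
          finally show ?thesis using L T'(4) by (simp add: sum_negf)
        qed
      qed
    qed
  qed
qed

lemma koszul_dmat_homogeneous:
  fixes S T :: "indet set"
  assumes S: "S \<subseteq> indets n" "card S = Suc i" and T: "T \<subseteq> indets n" "card T = i"
  shows "dmat (koszul n :: (_, 'k::field) graded_complex) i S T \<in> pring n \<and>
    (\<forall>m\<in>Poly_Mapping.keys (dmat (koszul n :: (_, 'k) graded_complex) i S T).
       mdeg m + card T = card S)"
proof (cases "\<exists>v\<in>S. T = S - {v}")
  case False
  then show ?thesis by (simp add: koszul_dmat_eq_0 pring_0)
next
  case True
  then obtain v where v: "v \<in> S" "T = S - {v}" by blast
  have "finite T" using T(1) by (rule finite_subset_indets)
  then have eq: "dmat (koszul n :: (_, 'k) graded_complex) i S T = ksgn T v * Var v"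
    using koszul_dmat_insert[of T v n i] v by (simp add: insert_absorb)
  have "Poly_Mapping.keys (ksgn T v * Var v :: 'k mpoly) \<subseteq> {Poly_Mapping.single v 1}"
    by (cases "even (card {w\<in>T. w < v})") (simp_all add: Var_def)
  moreover have "mdeg (Poly_Mapping.single v 1) = 1" by (simp add: mdeg_def)
  moreover have "ksgn T v * Var v \<in> (pring n :: 'k mpoly set)"
    using v S by (intro pring_mult pring_sgn pring_Var) auto
  ultimately show ?thesis unfolding eq using S T by force
qed

theorem koszul_resolution:
  "free_resolution_of_residue_field n (koszul n :: (indet set, 'k::field) graded_complex)"
proof -
  let ?K = "koszul n :: (indet set, 'k) graded_complex"
  let ?R = "pring n :: 'k mpoly set"
  have exact: "cycles ?K ?R (Suc i) = bdry ?K (Suc i) ` chains ?K ?R (Suc (Suc i))" for i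
  proof (intro equalityI subsetI)
    fix f assume "f \<in> cycles ?K ?R (Suc i)"
    then have f: "f \<in> chains ?K ?R (Suc i)" "bdry ?K i f = 0" by auto
    then have "bdry ?K (Suc i) (hmap f) = f" by (intro koszul_homotopy) auto
    with hmap_chains[OF f(1)] show "f \<in> bdry ?K (Suc i) ` chains ?K ?R (Suc (Suc i))"
      by (metis imageI)
  next
    fix f assume "f \<in> bdry ?K (Suc i) ` chains ?K ?R (Suc (Suc i))"
    then show "f \<in> cycles ?K ?R (Suc i)"
      using koszul_bdry_chains koszul_bdry_bdry by auto
  qed
  have B0: "{T. T \<subseteq> indets n \<and> card T = 0} = {{}}"
    using finite_subset_indets card_0_eq by auto
  have aug: "bdry ?K 0 ` chains ?K ?R 1 = {f \<in> chains ?K ?R 0. Poly_Mapping.lookup (f {}) 0 = 0}"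
  proof (intro equalityI subsetI)
    fix f assume "f \<in> bdry ?K 0 ` chains ?K ?R 1"
    then show "f \<in> {f \<in> chains ?K ?R 0. Poly_Mapping.lookup (f {}) 0 = 0}"
      using koszul_bdry_chains[of _ n 0] by (auto simp: lookup_koszul_bdry)
  next
    fix f assume "f \<in> {f \<in> chains ?K ?R 0. Poly_Mapping.lookup (f {}) 0 = 0}"
    then have f: "f \<in> chains ?K ?R 0" "Poly_Mapping.lookup (f {}) 0 = 0" by auto
    then have "bdry ?K 0 (hmap f) = f" by (intro koszul_homotopy) auto
    with hmap_chains[OF f(1)] show "f \<in> bdry ?K 0 ` chains ?K ?R 1"
      by (metis One_nat_def imageI)
  qed
  show ?thesis
    unfolding free_resolution_of_residue_field_def
  proof (intro conjI allI ballI exI[of _ "\<lambda>_. 1 :: 'k"])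
    show "finite (basis ?K i)" for i using finite_koszul_basis by simp
  qed (use koszul_dmat_homogeneous[where 'k = 'k] exact aug B0 in auto)
qed


section \<open>Graphs and binomial edge ideals\<close>

record sgraph =
  verts :: "nat set"
  edges :: "nat set set"

definition simple_graph :: "sgraph \<Rightarrow> bool" where
  "simple_graph G \<longleftrightarrow> finite (verts G) \<and> (\<forall>e\<in>edges G. e \<subseteq> verts G \<and> card e = 2)"

definition nbrs :: "sgraph \<Rightarrow> nat \<Rightarrow> nat set" where
  "nbrs G s = {t. {s, t} \<in> edges G}"

definition star_at :: "sgraph \<Rightarrow> nat \<Rightarrow> sgraph" where
  "star_at G s = \<lparr>verts = nbrs G s \<union> {s}, edges = {{s, t} | t. t \<in> nbrs G s}\<rparr>"

definition delete_vertex :: "sgraph \<Rightarrow> nat \<Rightarrow> sgraph" where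
  "delete_vertex G s = \<lparr>verts = verts G - {s}, edges = {e \<in> edges G. s \<notin> e}\<rparr>"

definition induced_subgraph :: "sgraph \<Rightarrow> nat set \<Rightarrow> sgraph" where
  "induced_subgraph G W = \<lparr>verts = W, edges = {e \<in> edges G. e \<subseteq> W}\<rparr>"

definition is_3_cycle :: "sgraph \<Rightarrow> bool" where
  "is_3_cycle H \<longleftrightarrow> (\<exists>a b c. a \<noteq> b \<and> b \<noteq> c \<and> a \<noteq> c \<and>
     verts H = {a, b, c} \<and> edges H = {{a, b}, {b, c}, {a, c}})"

definition triangle_free :: "sgraph \<Rightarrow> bool" where
  "triangle_free G \<longleftrightarrow> (\<nexists>W. W \<subseteq> verts G \<and> is_3_cycle (induced_subgraph G W))"

definition binomial_edge_ideal :: "nat \<Rightarrow> sgraph \<Rightarrow> 'k::field mpoly set" where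
  "binomial_edge_ideal n H = ideal_gen n
     {Var (Xvar i) * Var (Yvar j) - Var (Xvar j) * Var (Yvar i) | i j. {i, j} \<in> edges H}"

end

theory Submission
  imports Defs
begin

text \<open>
  Write \<open>J\<close> and \<open>K\<close> for the edge ideals of the star and of \<open>G - s\<close>. The Betti numbers add up as required
  as soon as the maps from \<open>Tor\<^sub>i(k, J \<inter> K)\<close> to \<open>Tor\<^sub>i(k, J)\<close> and \<open>Tor\<^sub>i(k, K)\<close> vanish. The second one
  vanishes because \<open>J\<close> lies in \<open>\<langle>x\<^sub>s, y\<^sub>s\<rangle>\<close>, while \<open>K\<close> does not involve these two variables. For the first
  one, triangle-freeness implies that \<open>J \<inter> K\<close> is zero in degrees at most three, so that \<open>Tor\<^sub>i(k, J \<inter> K)\<close>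
  lives in degrees at least \<open>i + 4\<close>; but \<open>Tor\<^sub>i(k, J)\<close> lives in degrees at most \<open>i + 3\<close>, since \<open>R/J\<close> has
  regularity at most two. This bound is proved by adding the leaves \<open>m\<close> of the star one at a time: \<open>x\<^sub>m\<close> is a
  nonzerodivisor modulo the new ideal, and modulo \<open>x\<^sub>m\<close> the new generator becomes \<open>x\<^sub>s y\<^sub>m\<close>, so that
  taking the colon by \<open>y\<^sub>m\<close> and adding \<open>y\<^sub>m\<close> both lead to ideals whose regularity is known.
\<close>


section \<open>Decompositions of polynomials\<close>

text \<open>The numbers four and three meet through \<open>Tor_i(k, J) = Tor_{i+1}(k, R/J)\<close>:
  regularity two of \<open>R/J\<close> confines \<open>Tor_i(k, J)\<close> to degrees at most
  \<open>i + 1 + 2\<close>. A triangle \<open>s, t, u\<close> would destroy the gap: with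
  \<open>f_{ab} = x_a y_b - x_b y_a\<close>, the identity
  \<open>x_s f_{tu} = x_t f_{su} - x_u f_{st}\<close> gives an element of degree three in both
  \<open>J\<close> and \<open>K\<close>. The bound two does not grow with the number of leaves. The
  colon by \<open>y_m\<close> adjoins \<open>x_s\<close>, which reduces every remaining
  \<open>f_{st}\<close> to \<open>- x_t y_s\<close>; what is left are variables and products of
  \<open>y_s\<close> with variables, of regularity at most one, and the colon costs one more.
  Adjoining \<open>y_m\<close> leads back to a smaller star together with some variables, so the
  induction has to admit extra variables. Vanishing of a map on Tor is always expressed on chains: a
  cycle over \<open>J \<inter> K\<close> is the boundary of a chain over \<open>J\<close>, or over
  \<open>K\<close>. Two homotopies of the Koszul complex carry the argument: exterior multiplication
  by a variable \<open>v\<close>, which makes multiplication by \<open>v\<close> null-homotopic, and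
  the same map preceded by division by \<open>v\<close>, which contracts onto the complex without
  \<open>v\<close>.\<close>

definition part :: "(monomial \<Rightarrow> bool) \<Rightarrow> 'k::field mpoly \<Rightarrow> 'k mpoly" where
  "part P p = Abs_poly_mapping (\<lambda>m. if P m then Poly_Mapping.lookup p m else 0)"

text \<open>Homogeneous components and substitution of 0 for a variable are both filters on
  monomials, so additivity and membership in \<open>pring\<close> are proved once, for
  \<open>part\<close>.\<close>

abbreviation hcomp :: "nat \<Rightarrow> 'k::field mpoly \<Rightarrow> 'k mpoly" where
  "hcomp d \<equiv> part (\<lambda>m. mdeg m = d)"

abbreviation at_zero :: "indet \<Rightarrow> 'k::field mpoly \<Rightarrow> 'k mpoly" where
  "at_zero v \<equiv> part (\<lambda>m. v \<notin> Poly_Mapping.keys m)"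

text \<open>The quotient on division by the variable \<open>v\<close>, with remainder
  \<open>at_zero v p\<close>. Monomials not divisible by \<open>v\<close> contribute
  nothing.\<close>

definition quot :: "indet \<Rightarrow> 'k::field mpoly \<Rightarrow> 'k mpoly" where
  "quot v p = Abs_poly_mapping (\<lambda>m. Poly_Mapping.lookup p (m + Poly_Mapping.single v 1))"

definition free_of :: "indet \<Rightarrow> 'k::field mpoly \<Rightarrow> bool" where
  "free_of v p \<longleftrightarrow> (\<forall>m\<in>Poly_Mapping.keys p. v \<notin> Poly_Mapping.keys m)"

lemma lookup_part:
  "Poly_Mapping.lookup (part P p) m = (if P m then Poly_Mapping.lookup p m else 0)"
proof -
  have "finite {m. (if P m then Poly_Mapping.lookup p m else 0) \<noteq> 0}"
    by (rule finite_subset[OF _ finite_keys[of p]]) (auto simp: in_keys_iff)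
  then show ?thesis by (simp add: part_def)
qed

lemma keys_part: "Poly_Mapping.keys (part P p) = {m \<in> Poly_Mapping.keys p. P m}"
  by (auto simp: in_keys_iff lookup_part split: if_splits)

lemma part_0 [simp]: "part P 0 = 0"
  by (intro poly_mapping_eqI) (simp add: lookup_part)

lemma part_add: "part P (p + q) = part P p + part P q"
  by (intro poly_mapping_eqI) (simp add: lookup_part lookup_add)

lemma part_diff: "part P (p - q) = part P p - part P q"
  by (intro poly_mapping_eqI) (simp add: lookup_part lookup_minus)

lemma part_sum: "part P (sum f A) = (\<Sum>a\<in>A. part P (f a))"
  by (induction A rule: infinite_finite_induct) (simp_all add: part_add)

lemma part_sgn_mult:
  fixes p :: "'k::field mpoly"
  shows "part P ((- 1) ^ a * p) = (- 1) ^ a * part P p"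
  by (intro poly_mapping_eqI) (simp add: lookup_part lookup_sgn_mult)

lemma part_ident: "(\<And>m. m \<in> Poly_Mapping.keys p \<Longrightarrow> P m) \<Longrightarrow> part P p = p"
  by (intro poly_mapping_eqI) (auto simp: lookup_part in_keys_iff)

lemma part_eq_0: "(\<And>m. m \<in> Poly_Mapping.keys p \<Longrightarrow> \<not> P m) \<Longrightarrow> part P p = 0"
  by (intro poly_mapping_eqI) (auto simp: lookup_part in_keys_iff)

lemma part_pring: "p \<in> pring n \<Longrightarrow> part P p \<in> pring n"
  by (auto simp: pring_def keys_part)

lemma pring_uminus: "p \<in> pring n \<Longrightarrow> - p \<in> pring n"
  by (simp add: pring_def)

lemma pring_diff: "p \<in> pring n \<Longrightarrow> q \<in> pring n \<Longrightarrow> p - q \<in> pring n"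
  using pring_add[of p n "- q"] pring_uminus[of q n] by simp

lemma pring_1: "1 \<in> pring n"
  by (simp add: pring_def)

section \<open>Degrees and homogeneous components\<close>

lemma mdeg_eq_sum: "finite A \<Longrightarrow> Poly_Mapping.keys m \<subseteq> A \<Longrightarrow> mdeg m = (\<Sum>v\<in>A. Poly_Mapping.lookup m v)"
  unfolding mdeg_def by (rule sum.mono_neutral_left) (auto simp: in_keys_iff)

lemma mdeg_add: "mdeg (a + b) = mdeg a + mdeg b"
proof -
  let ?A = "Poly_Mapping.keys a \<union> Poly_Mapping.keys b"
  have "mdeg (a + b) = (\<Sum>v\<in>?A. Poly_Mapping.lookup (a + b) v)"
    by (rule mdeg_eq_sum) (auto simp: keys_nat_add)
  also have "\<dots> = mdeg a + mdeg b"
    by (simp add: lookup_add sum.distrib mdeg_eq_sum[of ?A])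
  finally show ?thesis .
qed

lemma mdeg_single [simp]: "mdeg (Poly_Mapping.single v k) = k"
  by (cases "k = 0") (simp_all add: mdeg_def)

lemma keys_Var [simp]: "Poly_Mapping.keys (Var v :: 'k::field mpoly) = {Poly_Mapping.single v 1}"
  by (simp add: Var_def)

lemma mem_keys_multE:
  assumes "m \<in> Poly_Mapping.keys (p * q)"
  obtains a b where "m = a + b" "a \<in> Poly_Mapping.keys p" "b \<in> Poly_Mapping.keys q"
  using assms keys_mult[of p q] by auto

lemma homogeneous_0 [simp]: "homogeneous d 0"
  by (simp add: homogeneous_def)

lemma homogeneous_add: "homogeneous d p \<Longrightarrow> homogeneous d q \<Longrightarrow> homogeneous d (p + q)"
  unfolding homogeneous_def using keys_add[of p q] by blast

lemma homogeneous_diff: "homogeneous d p \<Longrightarrow> homogeneous d q \<Longrightarrow> homogeneous d (p - q)"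
  unfolding homogeneous_def using keys_diff[of p q] by blast

lemma homogeneous_sum: "(\<And>a. a \<in> A \<Longrightarrow> homogeneous d (f a)) \<Longrightarrow> homogeneous d (sum f A)"
  by (induction A rule: infinite_finite_induct) (auto intro: homogeneous_add)

lemma homogeneous_mult: "homogeneous d p \<Longrightarrow> homogeneous e q \<Longrightarrow> homogeneous (d + e) (p * q)"
  unfolding homogeneous_def by (auto elim!: mem_keys_multE simp: mdeg_add)

lemma homogeneous_Var: "homogeneous 1 (Var v)"
  by (simp add: homogeneous_def)

lemma homogeneous_sgn_mult: "homogeneous d p \<Longrightarrow> homogeneous d ((- 1) ^ a * p)"
  by (cases "even a") (simp_all add: homogeneous_def)

lemma homogeneous_hcomp: "homogeneous d (hcomp d p)"
  by (simp add: homogeneous_def keys_part)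

lemma hcomp_homogeneous: "homogeneous d p \<Longrightarrow> hcomp d p = p"
  by (rule part_ident) (simp add: homogeneous_def)

text \<open>Multiplication by a form of degree \<open>e\<close> shifts degrees by \<open>e\<close>,
  so the other components of \<open>p\<close> cannot reach degree \<open>d\<close>. The case
  \<open>e \<le> d\<close> is separated because \<open>d - e\<close> is truncated.\<close>

lemma hcomp_mult:
  fixes p g :: "'k::field mpoly"
  assumes "homogeneous e g"
  shows "hcomp d (p * g) = (if e \<le> d then hcomp (d - e) p * g else 0)"
proof (cases "e \<le> d")
  case True
  have "p * g = hcomp (d - e) p * g + (p - hcomp (d - e) p) * g"
    by (simp add: algebra_simps)
  moreover have "hcomp d (hcomp (d - e) p * g) = hcomp (d - e) p * g"
    using homogeneous_mult[OF homogeneous_hcomp[of "d - e" p] assms] True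
    by (intro hcomp_homogeneous) simp
  moreover have "hcomp d ((p - hcomp (d - e) p) * g) = 0"
  proof (rule part_eq_0)
    fix m assume "m \<in> Poly_Mapping.keys ((p - hcomp (d - e) p) * g)"
    then obtain a b where "m = a + b" "a \<in> Poly_Mapping.keys (p - hcomp (d - e) p)"
      "b \<in> Poly_Mapping.keys g" by (rule mem_keys_multE)
    then show "mdeg m \<noteq> d"
      using assms True by (auto simp: in_keys_iff lookup_minus lookup_part homogeneous_def mdeg_add
        split: if_splits)
  qed
  ultimately show ?thesis using True by (simp add: part_add)
next
  case False
  have "hcomp d (p * g) = 0"
    using assms False by (intro part_eq_0) (auto elim!: mem_keys_multE simp: homogeneous_def mdeg_add)
  then show ?thesis using False by simp
qed

lemma hcomp_Var_mult: "hcomp (Suc d) (Var v * p) = Var v * hcomp d p"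
  using hcomp_mult[OF homogeneous_Var, of "Suc d" p v] by (simp add: mult.commute)

section \<open>Division with remainder by a variable\<close>

lemma lookup_quot:
  "Poly_Mapping.lookup (quot v p) m = Poly_Mapping.lookup p (m + Poly_Mapping.single v 1)"
proof -
  have "{m. Poly_Mapping.lookup p (m + Poly_Mapping.single v 1) \<noteq> 0}
      \<subseteq> (\<lambda>m. m - Poly_Mapping.single v 1) ` Poly_Mapping.keys p"
    by (force simp: in_keys_iff image_iff)
  then have "finite {m. Poly_Mapping.lookup p (m + Poly_Mapping.single v 1) \<noteq> 0}"
    by (rule finite_subset) auto
  then show ?thesis by (simp add: quot_def)
qed

lemma at_zero_quot: "p = at_zero v p + Var v * quot v p"
  by (rule poly_mapping_eqI)
     (simp add: lookup_add lookup_part lookup_Var_mult lookup_quot monom_factor[unfolded One_nat_def])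

lemma free_of_0 [simp]: "free_of v 0"
  by (simp add: free_of_def)

lemma free_of_diff: "free_of v p \<Longrightarrow> free_of v q \<Longrightarrow> free_of v (p - q)"
  unfolding free_of_def using keys_diff[of p q] by blast

lemma free_of_mult: "free_of v p \<Longrightarrow> free_of v q \<Longrightarrow> free_of v (p * q)"
  unfolding free_of_def by (auto elim!: mem_keys_multE simp: keys_nat_add)

lemma free_of_Var [simp]: "free_of v (Var w) \<longleftrightarrow> v \<noteq> w"
  by (auto simp: free_of_def)

lemma free_of_at_zero: "free_of v (at_zero v p)"
  by (simp add: free_of_def keys_part)

text \<open>The monomials of \<open>a\<close> avoid \<open>v\<close> and those of
  \<open>Var v * b\<close> contain it. This uniqueness computes \<open>at_zero\<close> and
  \<open>quot\<close> of explicit polynomials and of products.\<close>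

lemma decomposition_unique:
  assumes "free_of v a"
  shows "at_zero v (a + Var v * b) = a" "quot v (a + Var v * b) = b"
proof -
  have *: "Poly_Mapping.lookup a m = 0" if "v \<in> Poly_Mapping.keys m" for m
    using assms that unfolding free_of_def by (metis in_keys_iff)
  show "at_zero v (a + Var v * b) = a"
    by (rule poly_mapping_eqI) (simp add: lookup_add lookup_part lookup_Var_mult *)
  have "v \<in> Poly_Mapping.keys (m + Poly_Mapping.single v 1)" for m :: monomial
    by (simp add: keys_nat_add)
  then show "quot v (a + Var v * b) = b"
    by (intro poly_mapping_eqI) (simp add: lookup_add lookup_quot lookup_Var_mult *)
qed

lemma free_of_decomposition:
  assumes "free_of v a"
  shows "at_zero v a = a" "quot v a = 0"
  using decomposition_unique[OF assms, of 0] by simp_all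

lemma quot_Var_mult [simp]: "quot v (Var v * p) = p"
  and at_zero_Var_mult [simp]: "at_zero v (Var v * p) = 0"
  using decomposition_unique[of v 0 p] by simp_all

lemma quot_0 [simp]: "quot v 0 = 0"
  using free_of_decomposition(2)[OF free_of_0] .

lemma quot_add: "quot v (p + q) = quot v p + quot v q"
  by (intro poly_mapping_eqI) (simp add: lookup_quot lookup_add)

lemma quot_sum: "quot v (sum f A) = (\<Sum>a\<in>A. quot v (f a))"
  by (induction A rule: infinite_finite_induct) (simp_all add: quot_add)

lemma quot_sgn_mult:
  fixes p :: "'k::field mpoly"
  shows "quot v ((- 1) ^ a * p) = (- 1) ^ a * quot v p"
  by (intro poly_mapping_eqI) (simp add: lookup_quot lookup_sgn_mult)

lemma quot_pring:
  assumes "p \<in> pring n"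
  shows "quot v p \<in> pring n"
  unfolding pring_def
proof (intro CollectI ballI)
  fix m assume "m \<in> Poly_Mapping.keys (quot v p)"
  then have "m + Poly_Mapping.single v 1 \<in> Poly_Mapping.keys p"
    by (simp add: in_keys_iff lookup_quot)
  then have "Poly_Mapping.keys (m + Poly_Mapping.single v 1) \<subseteq> indets n"
    using assms by (auto simp: pring_def)
  then show "Poly_Mapping.keys m \<subseteq> indets n" by (simp add: keys_nat_add)
qed

text \<open>Substitution of 0 is a ring homomorphism, and division by \<open>v\<close> obeys a
  twisted Leibniz rule, in which one factor is evaluated at \<open>v = 0\<close>.\<close>

lemma at_zero_mult: "at_zero v (p * q) = at_zero v p * at_zero v q"
  and quot_mult: "quot v (p * q) = at_zero v p * quot v q + quot v p * q"
proof -
  have "p * q = at_zero v p * at_zero v q + Var v * (at_zero v p * quot v q + quot v p * q)"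
  proof -
    have "p * q = (at_zero v p + Var v * quot v p) * q"
      using at_zero_quot[of p v] by simp
    also have "\<dots> = at_zero v p * (at_zero v q + Var v * quot v q) + Var v * (quot v p * q)"
      using at_zero_quot[of q v] by (simp add: algebra_simps)
    finally show ?thesis by (simp add: algebra_simps)
  qed
  moreover have "free_of v (at_zero v p * at_zero v q)"
    by (intro free_of_mult free_of_at_zero)
  ultimately show "at_zero v (p * q) = at_zero v p * at_zero v q"
    "quot v (p * q) = at_zero v p * quot v q + quot v p * q"
    using decomposition_unique by metis+
qed

lemma Var_mult_eq_0_iff: "Var v * p = 0 \<longleftrightarrow> p = 0"
  using quot_Var_mult[of v p] by (metis mult_zero_right quot_0)


section \<open>Ideals\<close>

lemma ideal_gen_0: "0 \<in> ideal_gen n B"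
  unfolding ideal_gen_def by (intro CollectI exI[of _ "{}"] exI[of _ "\<lambda>_. 0"]) auto

lemma ideal_gen_add_multiple:
  assumes p: "p \<in> ideal_gen n B" and r: "r \<in> pring n" and g: "g \<in> B"
  shows "p + r * g \<in> ideal_gen n B"
proof -
  from p obtain A c where A: "p = (\<Sum>g\<in>A. c g * g)" "finite A" "A \<subseteq> B" "\<forall>g\<in>A. c g \<in> pring n"
    by (auto simp: ideal_gen_def)
  \<comment> \<open>The generator \<open>g\<close> may already occur in \<open>A\<close>; then its
    two coefficients have to be added.\<close>
  define d where "d = (\<lambda>h. (if h \<in> A then c h else 0) + (if h = g then r else 0))"
  have "(\<Sum>h\<in>insert g A. d h * h) =
      (\<Sum>h\<in>insert g A. if h \<in> A then c h * h else 0) + (\<Sum>h\<in>insert g A. if h = g then r * h else 0)"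
    unfolding d_def sum.distrib[symmetric] by (rule sum.cong) (auto simp: algebra_simps)
  also have "(\<Sum>h\<in>insert g A. if h \<in> A then c h * h else 0) = p"
    unfolding A(1) using A(2) by (intro sum.mono_neutral_cong_right) auto
  also have "(\<Sum>h\<in>insert g A. if h = g then r * h else 0) = r * g"
    using A(2) by (simp add: sum.delta)
  finally have "p + r * g = (\<Sum>h\<in>insert g A. d h * h)" ..
  moreover have "\<forall>h\<in>insert g A. d h \<in> pring n"
    using A(4) r by (auto simp: d_def pring_0 pring_add)
  ultimately show ?thesis
    unfolding ideal_gen_def using A g by (intro CollectI exI[of _ "insert g A"] exI[of _ d]) auto
qed

text \<open>Closure and invariance properties of an ideal then have to be checked only for adding
  one multiple \<open>r * g\<close> of a generator.\<close>

lemma ideal_gen_induct [consumes 1, case_names zero add]: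
  assumes "p \<in> ideal_gen n B" and "P 0"
    and step: "\<And>p r g. p \<in> ideal_gen n B \<Longrightarrow> P p \<Longrightarrow> r \<in> pring n \<Longrightarrow> g \<in> B \<Longrightarrow> P (p + r * g)"
  shows "P p"
proof -
  from assms(1) obtain A c where A: "p = (\<Sum>g\<in>A. c g * g)" "finite A" "A \<subseteq> B" "\<forall>g\<in>A. c g \<in> pring n"
    by (auto simp: ideal_gen_def)
  from A(2-) have "(\<Sum>g\<in>A. c g * g) \<in> ideal_gen n B \<and> P (\<Sum>g\<in>A. c g * g)"
  proof (induction A)
    case empty
    then show ?case using assms(2) by (simp add: ideal_gen_0)
  next
    case (insert g A)
    then have "(\<Sum>g\<in>A. c g * g) + c g * g \<in> ideal_gen n B" "P ((\<Sum>g\<in>A. c g * g) + c g * g)"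
      by (auto intro: step ideal_gen_add_multiple)
    then show ?case using insert by (simp add: add.commute)
  qed
  then show ?thesis using A(1) by simp
qed

lemma ideal_gen_base: "g \<in> B \<Longrightarrow> g \<in> ideal_gen n B"
  using ideal_gen_add_multiple[OF ideal_gen_0 pring_1, of g B n] by simp

lemma ideal_gen_add:
  assumes "p \<in> ideal_gen n B" "q \<in> ideal_gen n B"
  shows "p + q \<in> ideal_gen n B"
  using assms(2)
proof (induction q rule: ideal_gen_induct)
  case (add q r g)
  then show ?case using ideal_gen_add_multiple[of "p + q" n B r g] by (simp add: add.assoc)
qed (use assms(1) in simp)

lemma ideal_gen_mult:
  assumes "p \<in> ideal_gen n B" and c: "c \<in> pring n"
  shows "c * p \<in> ideal_gen n B"
  using assms(1)
proof (induction p rule: ideal_gen_induct)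
  case (add q r g)
  then show ?case
    using ideal_gen_add_multiple[of "c * q" n B "c * r" g] pring_mult[OF c, of r]
    by (simp add: algebra_simps)
qed (simp add: ideal_gen_0)

lemma ideal_gen_uminus: "p \<in> ideal_gen n B \<Longrightarrow> - p \<in> ideal_gen n B"
  using ideal_gen_mult[of p n B "- 1"] pring_uminus[OF pring_1, of n] by simp

lemma ideal_gen_diff: "p \<in> ideal_gen n B \<Longrightarrow> q \<in> ideal_gen n B \<Longrightarrow> p - q \<in> ideal_gen n B"
  using ideal_gen_add[of p n B "- q"] ideal_gen_uminus[of q n B] by simp

lemma ideal_gen_sum:
  "(\<And>a. a \<in> A \<Longrightarrow> f a \<in> ideal_gen n B) \<Longrightarrow> sum f A \<in> ideal_gen n B"
  by (induction A rule: infinite_finite_induct) (auto simp: ideal_gen_0 ideal_gen_add)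

lemma ideal_gen_sgn_mult: "p \<in> ideal_gen n B \<Longrightarrow> (- 1) ^ a * p \<in> ideal_gen n B"
  by (intro ideal_gen_mult pring_sgn)

lemma ideal_gen_subset:
  assumes "B \<subseteq> ideal_gen n C"
  shows "ideal_gen n B \<subseteq> ideal_gen n C"
proof
  fix p assume "p \<in> ideal_gen n B"
  then show "p \<in> ideal_gen n C"
    by (induction p rule: ideal_gen_induct)
       (use assms in \<open>auto intro!: ideal_gen_0 ideal_gen_add ideal_gen_mult\<close>)
qed

lemma ideal_gen_mono: "B \<subseteq> C \<Longrightarrow> ideal_gen n B \<subseteq> ideal_gen n C"
  by (intro ideal_gen_subset) (auto intro: ideal_gen_base)

lemma ideal_gen_pring:
  assumes "B \<subseteq> pring n"
  shows "ideal_gen n B \<subseteq> pring n"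
proof
  fix p assume "p \<in> ideal_gen n B"
  then show "p \<in> pring n"
    by (induction p rule: ideal_gen_induct)
       (use assms in \<open>auto intro!: pring_0 pring_add pring_mult\<close>)
qed

lemma ideal_gen_UnE:
  assumes "p \<in> ideal_gen n (B \<union> C)"
  obtains a b where "a \<in> ideal_gen n B" "b \<in> ideal_gen n C" "p = a + b"
proof -
  from assms have "\<exists>a\<in>ideal_gen n B. \<exists>b\<in>ideal_gen n C. p = a + b"
  proof (induction p rule: ideal_gen_induct)
    case zero
    then show ?case using ideal_gen_0 by (metis add.right_neutral)
  next
    case (add p r g)
    then obtain a b where ab: "a \<in> ideal_gen n B" "b \<in> ideal_gen n C" "p = a + b" by blast
    from add.hyps(3) show ?case
    proof
      assume "g \<in> B"
      then have "a + r * g \<in> ideal_gen n B" using ab(1) add by (intro ideal_gen_add_multiple)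
      moreover have "p + r * g = (a + r * g) + b" using ab(3) by (simp add: ac_simps)
      ultimately show ?thesis using ab(2) by blast
    next
      assume "g \<in> C"
      then have "b + r * g \<in> ideal_gen n C" using ab(2) add by (intro ideal_gen_add_multiple)
      moreover have "p + r * g = a + (b + r * g)" using ab(3) by (simp add: ac_simps)
      ultimately show ?thesis using ab(1) by blast
    qed
  qed
  then show ?thesis using that by blast
qed

lemma ideal_gen_Un: "ideal_gen n (B \<union> C) = ideal_sum (ideal_gen n B) (ideal_gen n C)"
proof
  show "ideal_gen n (B \<union> C) \<subseteq> ideal_sum (ideal_gen n B) (ideal_gen n C)"
    by (auto simp: ideal_sum_def elim!: ideal_gen_UnE)
  show "ideal_sum (ideal_gen n B) (ideal_gen n C) \<subseteq> ideal_gen n (B \<union> C)"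
    using ideal_gen_mono[of B "B \<union> C" n] ideal_gen_mono[of C "B \<union> C" n]
    by (auto simp: ideal_sum_def intro: ideal_gen_add)
qed

lemma ideal_gen_insertE:
  assumes "p \<in> ideal_gen n (insert g B)"
  obtains a r where "a \<in> ideal_gen n B" "r \<in> pring n" "p = a + r * g"
proof -
  from assms have "\<exists>a\<in>ideal_gen n B. \<exists>r\<in>pring n. p = a + r * g"
  proof (induction p rule: ideal_gen_induct)
    case zero
    then show ?case using ideal_gen_0 pring_0 by (metis add_0 mult_zero_left)
  next
    case (add p c h)
    then obtain a r where ar: "a \<in> ideal_gen n B" "r \<in> pring n" "p = a + r * g" by blast
    show ?case
    proof (cases "h = g")
      case True
      then have "p + c * h = a + (r + c) * g" using ar by (simp add: algebra_simps)
      then show ?thesis using ar add pring_add by blast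
    next
      case False
      then have "a + c * h \<in> ideal_gen n B" using ar add by (intro ideal_gen_add_multiple) auto
      moreover have "p + c * h = (a + c * h) + r * g" using ar by (simp add: algebra_simps)
      ultimately show ?thesis using ar by blast
    qed
  qed
  then show ?thesis using that by blast
qed

section \<open>Homogeneous ideals and ideals extended from fewer variables\<close>

lemma ideal_gen_hcomp:
  assumes "\<And>g. g \<in> B \<Longrightarrow> \<exists>d. homogeneous d g" and "p \<in> ideal_gen n B"
  shows "hcomp d p \<in> ideal_gen n B"
  using assms(2)
proof (induction p rule: ideal_gen_induct)
  case (add p r g)
  then obtain e where "homogeneous e g" using assms(1) by blast
  then have "hcomp d (p + r * g) = hcomp d p + (if e \<le> d then hcomp (d - e) r else 0) * g"
    by (simp add: part_add hcomp_mult)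
  then show ?case using add part_pring by (auto intro: ideal_gen_add_multiple)
qed (simp add: ideal_gen_0)

text \<open>Such an ideal is extended from the ring without \<open>v\<close>, so it contains every
  coefficient of its elements with respect to powers of \<open>v\<close>. In particular
  \<open>v\<close> is a nonzerodivisor modulo it.\<close>

lemma ideal_gen_free_of:
  assumes "\<And>g. g \<in> B \<Longrightarrow> free_of v g" and "p \<in> ideal_gen n B"
  shows "at_zero v p \<in> ideal_gen n B" "quot v p \<in> ideal_gen n B"
proof -
  from assms(2) have "at_zero v p \<in> ideal_gen n B \<and> quot v p \<in> ideal_gen n B"
  proof (induction p rule: ideal_gen_induct)
    case (add p r g)
    have "at_zero v (p + r * g) = at_zero v p + at_zero v r * g"
      "quot v (p + r * g) = quot v p + quot v r * g"
      using free_of_decomposition[of v g] assms(1) add.hyps(3)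
      by (simp_all add: part_add at_zero_mult quot_add quot_mult)
    then show ?case
      using add by (simp add: ideal_gen_add_multiple part_pring quot_pring)
  qed (simp add: ideal_gen_0)
  then show "at_zero v p \<in> ideal_gen n B" "quot v p \<in> ideal_gen n B" by auto
qed

text \<open>The colon of \<open>B + v C\<close> by \<open>v\<close> is \<open>B + C\<close>:
  dividing a representation by \<open>v\<close> leaves multiples of elements of \<open>B\<close> and
  turns \<open>v h\<close> into \<open>h\<close>.\<close>

lemma ideal_gen_colon_Var:
  assumes "\<And>g. g \<in> B \<union> C \<Longrightarrow> free_of v g"
    and "Var v * p \<in> ideal_gen n (B \<union> (\<lambda>g. Var v * g) ` C)"
  shows "p \<in> ideal_gen n (B \<union> C)"
proof -
  have "quot v q \<in> ideal_gen n (B \<union> C)"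
    if "q \<in> ideal_gen n (B \<union> (\<lambda>g. Var v * g) ` C)" for q
    using that
  proof (induction q rule: ideal_gen_induct)
    case (add q r g)
    have "\<exists>c\<in>pring n. \<exists>h\<in>B \<union> C. quot v (r * g) = c * h"
    proof (cases "g \<in> B")
      case True
      then have "quot v (r * g) = quot v r * g"
        using free_of_decomposition[of v g] assms(1) by (simp add: quot_mult)
      then show ?thesis using True quot_pring[OF add.hyps(2)] by (intro bexI) auto
    next
      case False
      then obtain h where h: "h \<in> C" "g = Var v * h" using add.hyps(3) by blast
      have "quot v (r * g) = r * h"
        using quot_Var_mult[of v "r * h"] by (simp add: h(2) mult.left_commute)
      then show ?thesis using h add.hyps(2) by blast
    qed
    then show ?case using add.IH by (auto simp: quot_add intro: ideal_gen_add_multiple)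
  qed (simp add: ideal_gen_0)
  from this[OF assms(2)] show ?thesis by simp
qed


section \<open>The total Koszul complex\<close>

text \<open>Chains of all homological degrees together, as families of coefficients over all sets
  \<open>T\<close>. The homotopy identities then need no degree index.\<close>

definition kchains :: "nat \<Rightarrow> 'k::field mpoly set \<Rightarrow> (indet set \<Rightarrow> 'k mpoly) set" where
  "kchains n M = {f. (\<forall>T. f T \<in> M) \<and> (\<forall>T. \<not> T \<subseteq> indets n \<longrightarrow> f T = 0)}"

definition kdiff :: "nat \<Rightarrow> (indet set \<Rightarrow> 'k::field mpoly) \<Rightarrow> indet set \<Rightarrow> 'k mpoly" where
  "kdiff n f T = (if T \<subseteq> indets n then \<Sum>v\<in>indets n - T. ksgn T v * Var v * f (insert v T) else 0)"

text \<open>Exterior multiplication by the basis element of \<open>v\<close>; the sign moves it to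
  its place in the ordered product indexed by \<open>T\<close>.\<close>

definition cone :: "indet \<Rightarrow> (indet set \<Rightarrow> 'k::field mpoly) \<Rightarrow> indet set \<Rightarrow> 'k mpoly" where
  "cone v f T = (if v \<in> T then ksgn T v * f (T - {v}) else 0)"

lemma kchainsD: "f \<in> kchains n M \<Longrightarrow> f T \<in> M"
  and kchains_outside: "f \<in> kchains n M \<Longrightarrow> \<not> T \<subseteq> indets n \<Longrightarrow> f T = 0"
  by (auto simp: kchains_def)

lemma bdry_koszul_eq: "T \<subseteq> indets n \<Longrightarrow> card T = i \<Longrightarrow> bdry (koszul n) i f T = kdiff n f T"
  by (simp add: koszul_bdry kdiff_def)

lemma kdiff_add: "kdiff n (f + g) = kdiff n f + kdiff n g"
  by (simp add: fun_eq_iff kdiff_def algebra_simps sum.distrib)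

lemma kdiff_diff: "kdiff n (f - g) = kdiff n f - kdiff n g"
  by (simp add: fun_eq_iff kdiff_def algebra_simps sum_subtractf)

lemma kdiff_mult: "kdiff n (\<lambda>T. c * f T) = (\<lambda>T. c * kdiff n f T)"
  by (simp add: fun_eq_iff kdiff_def sum_distrib_left mult_ac)

lemma kdiff_hcomp: "kdiff n (\<lambda>T. hcomp d (f T)) T = hcomp (Suc d) (kdiff n f T)"
  by (simp add: kdiff_def part_sum mult.assoc part_sgn_mult hcomp_Var_mult)

text \<open>At a fixed \<open>T\<close> only sets with one or two more elements matter, so this
  reduces to the identity for the graded boundary maps.\<close>

lemma kdiff_kdiff: "kdiff n (kdiff n f) = 0"
proof
  fix T
  show "kdiff n (kdiff n f) T = 0 T"
  proof (cases "T \<subseteq> indets n")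
    case True
    then have fT: "finite T" by (rule finite_subset_indets)
    have "kdiff n (kdiff n f) T = kdiff n (bdry (koszul n) (Suc (card T)) f) T"
      using True fT unfolding kdiff_def[of n _ T]
      by (auto intro!: sum.cong simp: bdry_koszul_eq simp del: mult_eq_0_iff)
    also have "\<dots> = bdry (koszul n) (card T) (bdry (koszul n) (Suc (card T)) f) T"
      using True by (simp add: bdry_koszul_eq)
    finally show ?thesis by (simp add: koszul_bdry_bdry)
  qed (simp add: kdiff_def)
qed

lemma kdiff_ideal_gen:
  "(\<And>T. f T \<in> ideal_gen n B) \<Longrightarrow> kdiff n f T \<in> ideal_gen n B"
  unfolding kdiff_def
  by (auto intro!: ideal_gen_0 ideal_gen_sum ideal_gen_mult pring_mult pring_sgn pring_Var)

lemma kdiff_kchains: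
  assumes "f \<in> kchains n (pring n)"
  shows "kdiff n f \<in> kchains n (pring n)"
  using assms unfolding kchains_def kdiff_def
  by (auto intro!: pring_0 pring_sum pring_mult pring_sgn pring_Var)

section \<open>Signs and homotopies of the Koszul complex\<close>

lemma ksgn_square: "ksgn T v * (ksgn T v * p) = (p :: 'k::field mpoly)"
  by (simp add: mult.assoc[symmetric] power_add[symmetric] mult_2[symmetric])

lemma ksgn_insert_same: "ksgn (insert v T) v = (ksgn T v :: 'a::ring_1)"
proof -
  have "{w \<in> insert v T. w < v} = {w \<in> T. w < v}" by auto
  then show ?thesis by simp
qed

text \<open>The rule \<open>e_v e_w = - e_w e_v\<close> in terms of signs: exactly one of the two
  insertions shifts the position of the other variable.\<close>

lemma ksgn_anticommute:
  assumes "finite T" "v \<notin> T" "w \<notin> T" "v \<noteq> w"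
  shows "ksgn (insert v T) w * ksgn (insert w T) v = - (ksgn T v * ksgn T w :: 'a::comm_ring_1)"
proof (cases "v < w")
  case True
  then have "\<not> w < v" by simp
  then show ?thesis
    using True ksgn_insert[OF assms(1,2), of w, where 'a = 'a] ksgn_insert[OF assms(1,3), of v, where 'a = 'a]
    by (simp only: if_True if_False) (simp add: mult.commute)
next
  case False
  then have "w < v" using assms(4) by simp
  then show ?thesis
    using False ksgn_insert[OF assms(1,2), of w, where 'a = 'a] ksgn_insert[OF assms(1,3), of v, where 'a = 'a]
    by (simp only: if_True if_False) (simp add: mult.commute)
qed

lemma cone_kchains:
  assumes v: "v \<in> indets n" and f: "f \<in> kchains n M"
    and M: "0 \<in> M" "\<And>a p. p \<in> M \<Longrightarrow> (- 1) ^ a * p \<in> M"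
  shows "cone v f \<in> kchains n M"
proof -
  have "f (T - {v}) = 0" if "\<not> T \<subseteq> indets n" for T
    using f v that by (intro kchains_outside[of f n M]) auto
  then show ?thesis
    using f M by (auto simp: kchains_def cone_def)
qed

text \<open>If \<open>v\<close> is not in \<open>T\<close>, only the term adjoining \<open>v\<close>
  survives. If it is, that term comes from the second summand, and all others cancel between the two
  summands by anticommutativity.\<close>

lemma cone_homotopy:
  assumes v: "v \<in> indets n" and f: "\<And>T. \<not> T \<subseteq> indets n \<Longrightarrow> f T = 0"
  shows "kdiff n (cone v f) T + cone v (kdiff n f) T = Var v * f T"
proof (cases "T \<subseteq> indets n")
  case False
  then have "\<not> T - {v} \<subseteq> indets n" using v by auto
  then show ?thesis using False f by (simp add: kdiff_def cone_def)
next
  case True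
  then have fT: "finite T" by (rule finite_subset_indets)
  show ?thesis
  proof (cases "v \<in> T")
    case False
    have "kdiff n (cone v f) T = (\<Sum>w\<in>indets n - T. if w = v then Var v * f T else 0)"
      unfolding kdiff_def if_P[OF True]
    proof (rule sum.cong[OF refl])
      fix w assume "w \<in> indets n - T"
      have "ksgn T v * Var v * (ksgn (insert v T) v * f T) = Var v * f T"
        using ksgn_square[of T v "Var v * f T"] by (simp only: ksgn_insert_same mult_ac)
      then show "ksgn T w * Var w * cone v f (insert w T) = (if w = v then Var v * f T else 0)"
        using False by (simp add: cone_def)
    qed
    also have "\<dots> = Var v * f T" using v False by (simp add: sum.delta)
    finally show ?thesis using False by (simp add: cone_def)
  next
    case vT: True
    define T' where "T' = T - {v}"
    have T': "T = insert v T'" "v \<notin> T'" "finite T'" "T' \<subseteq> indets n"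
      using vT fT True by (auto simp: T'_def)
    have ind: "indets n - T' = insert v (indets n - T)"
      using T' v by auto
    have "cone v (kdiff n f) T = ksgn T v * (\<Sum>w\<in>indets n - T'. ksgn T' w * Var w * f (insert w T'))"
      using vT T'(4) by (simp add: cone_def T'_def[symmetric] kdiff_def)
    also have "\<dots> = ksgn T v * (ksgn T' v * Var v * f T)
        + ksgn T v * (\<Sum>w\<in>indets n - T. ksgn T' w * Var w * f (insert w T'))"
      unfolding ind using T'(1,2) by (subst sum.insert) (auto simp: distrib_left)
    also have "ksgn T v * (ksgn T' v * Var v * f T) = Var v * f T"
      using ksgn_square[of T' v "Var v * f T"] unfolding T'(1) ksgn_insert_same by (simp only: mult_ac)
    also have "ksgn T v * (\<Sum>w\<in>indets n - T. ksgn T' w * Var w * f (insert w T'))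
        = - kdiff n (cone v f) T"
      unfolding kdiff_def if_P[OF True] sum_distrib_left sum_negf[symmetric]
    proof (rule sum.cong[OF refl])
      fix w assume w: "w \<in> indets n - T"
      have "insert w T - {v} = insert w T'" using w vT by (auto simp: T'_def)
      then have c: "cone v f (insert w T) = ksgn (insert w T) v * f (insert w T')"
        using vT by (simp add: cone_def)
      have "ksgn (insert w T) v = (ksgn (insert w T') v :: 'a mpoly)"
        unfolding T'(1) by (simp only: insert_commute[of w v] ksgn_insert_same)
      moreover have "ksgn (insert v T') w * ksgn (insert w T') v = - (ksgn T' v * ksgn T' w :: 'a mpoly)"
        by (rule ksgn_anticommute) (use T' w in blast)+
      ultimately have "ksgn T w * ksgn (insert w T) v = - (ksgn T v * ksgn T' w :: 'a mpoly)"
        by (simp only: T'(1) ksgn_insert_same)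
      then have "(ksgn T v * ksgn T' w) * (Var w * f (insert w T'))
          = - (ksgn T w * ksgn (insert w T) v) * (Var w * f (insert w T'))"
        by (simp only: minus_minus)
      then show "ksgn T v * (ksgn T' w * Var w * f (insert w T'))
          = - (ksgn T w * Var w * cone v f (insert w T))"
        unfolding c by (simp only: mult_ac mult_minus_left mult_minus_right)
    qed
    finally show ?thesis by simp
  qed
qed

text \<open>Dividing by \<open>v\<close> first replaces multiplication by \<open>v\<close> with the
  identity, up to the projection onto the part without \<open>v\<close> in coefficients and basis
  elements. That part is the Koszul complex in one variable fewer.\<close>

lemma cone_quot_homotopy:
  fixes f :: "indet set \<Rightarrow> 'k::field mpoly"
  assumes v: "v \<in> indets n" and f: "\<And>T. \<not> T \<subseteq> indets n \<Longrightarrow> f T = 0"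
  shows "kdiff n (cone v (\<lambda>T. quot v (f T))) T + cone v (\<lambda>T. quot v (kdiff n f T)) T
    = f T - (if v \<in> T then 0 else at_zero v (f T))"
proof -
  let ?q = "\<lambda>T. quot v (f T)"
  have hom: "kdiff n (cone v ?q) T + cone v (kdiff n ?q) T = f T - at_zero v (f T)"
    using cone_homotopy[OF v, of ?q T] f at_zero_quot[of "f T" v] by (simp add: algebra_simps)
  \<comment> \<open>Division by \<open>v\<close> fails to commute with the differential only in the
    term of \<open>v\<close> itself: \<open>quot v (Var v * p)\<close> is \<open>p\<close>, whereas
    \<open>Var v * quot v p\<close> is \<open>p - at_zero v p\<close>.\<close>
  have "cone v (\<lambda>T. quot v (kdiff n f T)) T = cone v (kdiff n ?q) T + (if v \<in> T then at_zero v (f T) else 0)"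
  proof (cases "v \<in> T \<and> T \<subseteq> indets n")
    case False
    moreover have "\<not> T - {v} \<subseteq> indets n" if "\<not> T \<subseteq> indets n" using v that by auto
    ultimately show ?thesis using f by (auto simp: cone_def kdiff_def)
  next
    case True
    let ?T = "T - {v}"
    have T: "?T \<subseteq> indets n" "insert v ?T = T" using True by auto
    have "quot v (kdiff n f ?T) = (\<Sum>w\<in>indets n - ?T. ksgn ?T w * Var w * ?q (insert w ?T)
        + (if w = v then ksgn ?T v * at_zero v (f T) else 0))"
      unfolding kdiff_def if_P[OF T(1)] quot_sum
    proof (rule sum.cong[OF refl])
      fix w assume "w \<in> indets n - ?T"
      have "f T = Var v * ?q T + at_zero v (f T)"
        using at_zero_quot[of "f T" v] by (simp add: add.commute)
      then have "ksgn ?T v * f T = ksgn ?T v * (Var v * ?q T) + ksgn ?T v * at_zero v (f T)"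
        by (simp only: distrib_left[symmetric])
      moreover have "quot v (Var w * p) = Var w * quot v p" if "w \<noteq> v" for p :: "'k mpoly"
        using that free_of_decomposition[of v "Var w :: 'k mpoly"] by (auto simp: quot_mult)
      ultimately show "quot v (ksgn ?T w * Var w * f (insert w ?T)) = ksgn ?T w * Var w * ?q (insert w ?T)
          + (if w = v then ksgn ?T v * at_zero v (f T) else 0)"
        using T(2) by (cases "w = v") (simp_all only: simp_thms mult.assoc quot_sgn_mult quot_Var_mult if_True if_False add_0_right)
    qed
    also have "\<dots> = kdiff n ?q ?T + ksgn ?T v * at_zero v (f T)"
      using v T(1) by (simp add: sum.distrib sum.delta kdiff_def)
    finally have "cone v (\<lambda>T. quot v (kdiff n f T)) T
        = cone v (kdiff n ?q) T + ksgn T v * (ksgn ?T v * at_zero v (f T))"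
      using True by (simp add: cone_def distrib_left)
    moreover have "ksgn T v = (ksgn ?T v :: 'k mpoly)"
      using ksgn_insert_same[of v ?T, where 'a = "'k mpoly", unfolded T(2)] .
    ultimately show ?thesis using True by (simp add: ksgn_square del: mult_minus1)
  qed
  then show ?thesis using hom by (auto simp: algebra_simps)
qed


section \<open>Castelnuovo--Mumford regularity\<close>

text \<open>
  The condition says that \<open>Tor\<^sub>i(k, R/I)\<close> vanishes in all degrees above \<open>i + r\<close>. All homological degrees are
  treated at once: a chain of degree \<open>i + d\<close> in homological degree \<open>i\<close> has coefficients of degree \<open>d\<close>, and
  only this number \<open>d\<close> matters.
\<close>

definition reg_le :: "nat \<Rightarrow> nat \<Rightarrow> 'k::field mpoly set \<Rightarrow> bool" where
  "reg_le n r I \<longleftrightarrow> (\<forall>d f. r < d \<longrightarrow> f \<in> kchains n (pring n) \<longrightarrow> (\<forall>T. homogeneous d (f T)) \<longrightarrow>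
     (\<forall>T. kdiff n f T \<in> I) \<longrightarrow> (\<exists>g\<in>kchains n (pring n). \<forall>T. f T - kdiff n g T \<in> I))"

lemma reg_le_mono: "reg_le n r I \<Longrightarrow> r \<le> r' \<Longrightarrow> reg_le n r' I"
  unfolding reg_le_def by (meson le_less_trans)

lemma kchains_zero: "0 \<in> M \<Longrightarrow> 0 \<in> kchains n M"
  by (simp add: kchains_def)

lemma kchains_add_ring:
  "f \<in> kchains n (pring n) \<Longrightarrow> g \<in> kchains n (pring n) \<Longrightarrow> f + g \<in> kchains n (pring n)"
  by (auto simp: kchains_def intro: pring_add)

lemma kdiff_zero [simp]: "kdiff n 0 = 0"
  by (simp add: fun_eq_iff kdiff_def)

text \<open>Polynomials of positive degree already lie in the ideal, so the zero chain serves as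
  \<open>g\<close>.\<close>

lemma reg_le_maximal_ideal: "reg_le n 0 (ideal_gen n (Var ` indets n) :: 'k::field mpoly set)"
proof -
  have mono: "p \<in> ideal_gen n (Var ` indets n)"
    if p: "p \<in> pring n" "homogeneous d p" "0 < d" for p :: "'k mpoly" and d
  proof -
    \<comment> \<open>Stated for an arbitrary selection \<open>Q\<close> of monomials, so that those
      divisible by one variable can be split off and the rest left to the induction.\<close>
    have "part Q p \<in> ideal_gen n (Var ` indets n)"
      if "finite U" "\<And>m. Q m \<Longrightarrow> m \<in> Poly_Mapping.keys p \<Longrightarrow> Poly_Mapping.keys m \<inter> U \<noteq> {}" "U \<subseteq> indets n"
      for Q U
      using that
    proof (induction U arbitrary: Q)
      case empty
      then have "part Q p = 0" by (intro part_eq_0) auto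
      then show ?case by (simp add: ideal_gen_0)
    next
      case (insert u U)
      let ?q = "part Q p"
      have "at_zero u ?q = part (\<lambda>m. Q m \<and> u \<notin> Poly_Mapping.keys m) p"
        by (intro poly_mapping_eqI) (simp add: lookup_part)
      also have "\<dots> \<in> ideal_gen n (Var ` indets n)"
        using insert.prems by (intro insert.IH) auto
      finally have 1: "at_zero u ?q \<in> ideal_gen n (Var ` indets n)" .
      have "quot u ?q * Var u \<in> ideal_gen n (Var ` indets n)"
        using insert.prems p by (intro ideal_gen_mult ideal_gen_base quot_pring part_pring) auto
      then have "at_zero u ?q + Var u * quot u ?q \<in> ideal_gen n (Var ` indets n)"
        using 1 by (intro ideal_gen_add) (simp_all add: mult.commute)
      then show ?case using at_zero_quot[of ?q u] by simp
    qed
    from this[of "indets n" "\<lambda>_. True"] have "part (\<lambda>_. True) p \<in> ideal_gen n (Var ` indets n)"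
    proof
      fix m assume m: "m \<in> Poly_Mapping.keys p"
      then have "mdeg m \<noteq> 0" using p by (auto simp: homogeneous_def)
      then have "Poly_Mapping.keys m \<noteq> {}" by (auto simp: mdeg_def)
      moreover have "Poly_Mapping.keys m \<subseteq> indets n" using p m by (auto simp: pring_def)
      ultimately show "Poly_Mapping.keys m \<inter> indets n \<noteq> {}" by blast
    qed auto
    then show ?thesis by (simp add: part_ident)
  qed
  show ?thesis unfolding reg_le_def
  proof (intro allI impI)
    fix d :: nat and f :: "indet set \<Rightarrow> 'k mpoly"
    assume "0 < d" "f \<in> kchains n (pring n)" "\<forall>T. homogeneous d (f T)"
    then have "\<forall>T. f T - kdiff n 0 T \<in> ideal_gen n (Var ` indets n)"
      using mono[of _ d] by (metis diff_zero kchainsD kdiff_zero zero_fun_apply)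
    then show "\<exists>g\<in>kchains n (pring n). \<forall>T. f T - kdiff n g T \<in> ideal_gen n (Var ` indets n)"
      using kchains_zero pring_0 by blast
  qed
qed

text \<open>Multiplication by \<open>v\<close> is null-homotopic, so it is zero on \<open>Tor(k, R/I)\<close>.\<close>

lemma reg_le_nonzerodivisor:
  fixes B :: "'k::field mpoly set"
  assumes v: "v \<in> indets n"
    and nzd: "\<And>p. p \<in> pring n \<Longrightarrow> Var v * p \<in> ideal_gen n B \<Longrightarrow> p \<in> ideal_gen n B"
    and reg: "reg_le n r (ideal_gen n (insert (Var v) B))"
  shows "reg_le n r (ideal_gen n B)"
  unfolding reg_le_def
proof (intro allI impI)
  fix d and f :: "indet set \<Rightarrow> 'k mpoly"
  assume d: "r < d" and f: "f \<in> kchains n (pring n)" and hom: "\<forall>T. homogeneous d (f T)"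
    and df: "\<forall>T. kdiff n f T \<in> ideal_gen n B"
  have "\<forall>T. kdiff n f T \<in> ideal_gen n (insert (Var v) B)"
    using df ideal_gen_mono[of B "insert (Var v) B" n] by auto
  then obtain g where g: "g \<in> kchains n (pring n)"
    "\<And>T. f T - kdiff n g T \<in> ideal_gen n (insert (Var v) B)"
    using reg d f hom unfolding reg_le_def by meson
  have "\<exists>a b. a \<in> ideal_gen n B \<and> b \<in> pring n \<and> f T - kdiff n g T = a + Var v * b
      \<and> (\<not> T \<subseteq> indets n \<longrightarrow> b = 0)" for T
  proof (cases "T \<subseteq> indets n")
    case True
    then show ?thesis using g(2)[of T] by (elim ideal_gen_insertE) (auto simp: mult.commute)
  next
    case False
    then have "f T - kdiff n g T = 0 + Var v * 0"
      using f by (simp add: kdiff_def kchains_outside)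
    then show ?thesis using ideal_gen_0 pring_0 by blast
  qed
  then obtain a b where ab: "\<And>T. a T \<in> ideal_gen n B" "\<And>T. b T \<in> pring n"
    "\<And>T. f T - kdiff n g T = a T + Var v * b T" "\<And>T. \<not> T \<subseteq> indets n \<Longrightarrow> b T = 0"
    by metis
  have "f - kdiff n g = a + (\<lambda>T. Var v * b T)"
    using ab(3) by (simp add: fun_eq_iff)
  then have "kdiff n (f - kdiff n g) = kdiff n (a + (\<lambda>T. Var v * b T))" by simp
  then have "kdiff n f = kdiff n a + (\<lambda>T. Var v * kdiff n b T)"
    by (simp add: kdiff_diff kdiff_kdiff kdiff_add kdiff_mult)
  then have "Var v * kdiff n b T = kdiff n f T - kdiff n a T" for T
    by simp
  then have "Var v * kdiff n b T \<in> ideal_gen n B" for T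
    using df ideal_gen_diff[OF _ kdiff_ideal_gen[where f = a, OF ab(1)]] by presburger
  moreover have b: "b \<in> kchains n (pring n)" using ab(2,4) by (simp add: kchains_def)
  ultimately have db: "kdiff n b T \<in> ideal_gen n B" for T
    using nzd kdiff_kchains kchainsD by blast
  \<comment> \<open>\<open>b\<close> is a cycle modulo the ideal because \<open>v\<close> is a
    nonzerodivisor. Hence its cone bounds \<open>v b\<close> up to
    \<open>cone v (kdiff n b)\<close>, whose coefficients lie in the ideal.\<close>
  let ?g = "g + cone v b"
  have "cone v b \<in> kchains n (pring n)"
    by (intro cone_kchains v b pring_0 pring_mult pring_sgn)
  then have "?g \<in> kchains n (pring n)" using g(1) by (rule kchains_add_ring[rotated])
  moreover have "f T - kdiff n ?g T \<in> ideal_gen n B" for T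
  proof -
    have "f T - kdiff n ?g T = a T + cone v (kdiff n b) T"
      using ab(3)[of T] cone_homotopy[OF v ab(4), where T = T] by (simp add: kdiff_add algebra_simps)
    moreover have "cone v (kdiff n b) T \<in> ideal_gen n B"
      using db by (simp add: cone_def ideal_gen_0 ideal_gen_sgn_mult)
    ultimately show ?thesis using ab(1) by (simp add: ideal_gen_add)
  qed
  ultimately show "\<exists>g\<in>kchains n (pring n). \<forall>T. f T - kdiff n g T \<in> ideal_gen n B" by blast
qed

text \<open>Chain-level form of the sequence
  \<open>0 -> R/(J : v)(-1) -> R/J -> R/(J + v) -> 0\<close>, where \<open>J\<close> is generated by
  \<open>B\<close> and \<open>I\<close> is the colon ideal. The twist by -1 accounts for
  \<open>Suc r\<close>.\<close>

lemma reg_le_colon: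
  fixes B :: "'k::field mpoly set"
  assumes B: "B \<subseteq> pring n" "\<And>g. g \<in> B \<Longrightarrow> \<exists>d. homogeneous d g" and v: "v \<in> indets n"
    and colon: "\<And>p. p \<in> pring n \<Longrightarrow> Var v * p \<in> ideal_gen n B \<longleftrightarrow> p \<in> I"
    and I: "reg_le n r I" "I \<subseteq> pring n"
    and reg: "reg_le n (Suc r) (ideal_gen n (insert (Var v) B))"
  shows "reg_le n (Suc r) (ideal_gen n B)"
  unfolding reg_le_def
proof (intro allI impI)
  fix e and f :: "indet set \<Rightarrow> 'k mpoly"
  assume e: "Suc r < e" and f: "f \<in> kchains n (pring n)" and hom: "\<forall>T. homogeneous e (f T)"
    and df: "\<forall>T. kdiff n f T \<in> ideal_gen n B"
  obtain d where d: "e = Suc d" "r < d" using e by (cases e) auto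
  have "\<forall>T. kdiff n f T \<in> ideal_gen n (insert (Var v) B)"
    using df ideal_gen_mono[of B "insert (Var v) B" n] by auto
  then obtain g where g: "g \<in> kchains n (pring n)"
    "\<And>T. f T - kdiff n g T \<in> ideal_gen n (insert (Var v) B)"
    using reg e f hom unfolding reg_le_def by meson
  \<comment> \<open>Passing to the component of degree \<open>d\<close> allows the quotient
    \<open>b\<close> to be chosen homogeneous of degree \<open>d = e - 1\<close>, as the regularity
    of \<open>I\<close> requires.\<close>
  define g' where "g' = (\<lambda>T. hcomp d (g T))"
  have g': "g' \<in> kchains n (pring n)"
    using g(1) by (auto simp: kchains_def g'_def part_pring)
  have "\<exists>a b. a \<in> ideal_gen n B \<and> b \<in> pring n \<and> homogeneous d b \<and> f T - kdiff n g' T = a + Var v * b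
      \<and> (\<not> T \<subseteq> indets n \<longrightarrow> b = 0)" for T
  proof (cases "T \<subseteq> indets n")
    case True
    obtain a b where "a \<in> ideal_gen n B" "b \<in> pring n" "f T - kdiff n g T = a + b * Var v"
      using g(2)[of T] by (rule ideal_gen_insertE)
    moreover from this(3) have "hcomp e (f T - kdiff n g T) = hcomp e (a + Var v * b)"
      by (simp add: mult.commute)
    then have "f T - kdiff n g' T = hcomp e a + Var v * hcomp d b"
      using hom by (simp add: part_diff part_add d(1) hcomp_Var_mult g'_def kdiff_hcomp hcomp_homogeneous)
    ultimately show ?thesis
      using True ideal_gen_hcomp[OF B(2), where p = a and d = e and n = n] part_pring[of b n] homogeneous_hcomp[of d b]
      by (intro exI[of _ "hcomp e a"] exI[of _ "hcomp d b"]) simp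
  next
    case False
    then have "f T - kdiff n g' T = 0 + Var v * 0"
      using f by (simp add: kdiff_def kchains_outside)
    then show ?thesis using ideal_gen_0 pring_0 homogeneous_0 by blast
  qed
  then obtain a b where ab: "\<And>T. a T \<in> ideal_gen n B" "\<And>T. b T \<in> pring n" "\<And>T. homogeneous d (b T)"
    "\<And>T. f T - kdiff n g' T = a T + Var v * b T" "\<And>T. \<not> T \<subseteq> indets n \<Longrightarrow> b T = 0"
    by metis
  have "f - kdiff n g' = a + (\<lambda>T. Var v * b T)"
    using ab(4) by (simp add: fun_eq_iff)
  then have "kdiff n (f - kdiff n g') = kdiff n (a + (\<lambda>T. Var v * b T))" by simp
  then have "kdiff n f = kdiff n a + (\<lambda>T. Var v * kdiff n b T)"
    by (simp add: kdiff_diff kdiff_kdiff kdiff_add kdiff_mult)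
  then have "Var v * kdiff n b T = kdiff n f T - kdiff n a T" for T
    by simp
  then have "Var v * kdiff n b T \<in> ideal_gen n B" for T
    using df ideal_gen_diff[OF _ kdiff_ideal_gen[where f = a, OF ab(1)]] by presburger
  moreover have b: "b \<in> kchains n (pring n)" using ab(2,5) by (simp add: kchains_def)
  ultimately have "kdiff n b T \<in> I" for T
    using colon kdiff_kchains kchainsD by blast
  then obtain h where h: "h \<in> kchains n (pring n)" "\<And>T. b T - kdiff n h T \<in> I"
    using I(1) d(2) b ab(3) unfolding reg_le_def by meson
  \<comment> \<open>\<open>b - kdiff n h\<close> has coefficients in the colon ideal, so
    multiplication by \<open>v\<close> brings it into the ideal generated by
    \<open>B\<close>.\<close>
  let ?g = "g' + (\<lambda>T. Var v * h T)"
  have "(\<lambda>T. Var v * h T) \<in> kchains n (pring n)"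
    using h(1) v by (auto simp: kchains_def intro: pring_mult pring_Var)
  then have "?g \<in> kchains n (pring n)" using g' by (rule kchains_add_ring[rotated])
  moreover have "f T - kdiff n ?g T \<in> ideal_gen n B" for T
  proof -
    have "f T - kdiff n ?g T = a T + Var v * (b T - kdiff n h T)"
      using ab(4)[of T] by (simp add: kdiff_add kdiff_mult algebra_simps)
    moreover have "Var v * (b T - kdiff n h T) \<in> ideal_gen n B"
      using colon h(2) I(2) by blast
    ultimately show ?thesis using ab(1) by (simp add: ideal_gen_add)
  qed
  ultimately show "\<exists>g\<in>kchains n (pring n). \<forall>T. f T - kdiff n g T \<in> ideal_gen n B" by blast
qed


section \<open>The edge ideal of a star\<close>

definition edge_binomial :: "nat \<Rightarrow> nat \<Rightarrow> 'k::field mpoly" where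
  "edge_binomial i j = Var (Xvar i) * Var (Yvar j) - Var (Xvar j) * Var (Yvar i)"

lemma homogeneous_edge_binomial: "homogeneous 2 (edge_binomial i j)"
  using homogeneous_mult[OF homogeneous_Var homogeneous_Var]
  unfolding edge_binomial_def by (intro homogeneous_diff) (simp_all add: numeral_2_eq_2)

lemma edge_binomial_pring: "i \<in> {1..n} \<Longrightarrow> j \<in> {1..n} \<Longrightarrow> edge_binomial i j \<in> pring n"
  unfolding edge_binomial_def by (intro pring_diff pring_mult pring_Var) (auto simp: indets_def)

lemma free_of_edge_binomial:
  "v \<notin> {Xvar i, Xvar j, Yvar i, Yvar j} \<Longrightarrow> free_of v (edge_binomial i j)"
  unfolding edge_binomial_def by (intro free_of_diff free_of_mult) auto

lemma ideal_gen_eqI: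
  "B \<subseteq> ideal_gen n C \<Longrightarrow> C \<subseteq> ideal_gen n B \<Longrightarrow> ideal_gen n B = ideal_gen n C"
  by (intro equalityI ideal_gen_subset)

lemma ideal_gen_Var_nzd:
  assumes "\<And>g. g \<in> B \<Longrightarrow> free_of v g" "Var v * p \<in> ideal_gen n B"
  shows "p \<in> ideal_gen n B"
  using ideal_gen_free_of(2)[OF assms] by simp

lemma ideal_gen_Var_times:
  assumes v: "v \<in> indets n" and "p \<in> ideal_gen n (B \<union> C)"
  shows "Var v * p \<in> ideal_gen n (B \<union> (\<lambda>g. Var v * g) ` C)"
  using assms(2)
proof (induction p rule: ideal_gen_induct)
  case zero
  then show ?case by (simp add: ideal_gen_0)
next
  case (add p r g)
  have "Var v * g \<in> ideal_gen n (B \<union> (\<lambda>g. Var v * g) ` C)"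
  proof (cases "g \<in> B")
    case True
    then show ?thesis using v by (intro ideal_gen_mult ideal_gen_base pring_Var) auto
  next
    case False
    then show ?thesis using add.hyps(3) by (intro ideal_gen_base) auto
  qed
  then have "Var v * p + r * (Var v * g) \<in> ideal_gen n (B \<union> (\<lambda>g. Var v * g) ` C)"
    by (rule ideal_gen_add[OF add.IH ideal_gen_mult[OF _ add.hyps(2)]])
  then show ?case by (simp only: distrib_left mult.left_commute)
qed

lemma reg_le_variables:
  assumes "W \<subseteq> indets n"
  shows "reg_le n 0 (ideal_gen n (Var ` W) :: 'k::field mpoly set)"
proof -
  \<comment> \<open>Variables are removed from the maximal ideal one at a time; each is a
    nonzerodivisor modulo those that remain.\<close>
  have "reg_le n 0 (ideal_gen n (Var ` (indets n - U)) :: 'k mpoly set)" if "finite U" "U \<subseteq> indets n" for U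
    using that
  proof (induction U)
    case empty
    show ?case using reg_le_maximal_ideal by simp
  next
    case (insert v U)
    let ?W = "indets n - insert v U"
    have "insert v ?W = indets n - U" using insert by auto
    then have eq: "insert (Var v) (Var ` ?W) = (Var ` (indets n - U) :: 'k mpoly set)"
      by (metis image_insert)
    show ?case
    proof (rule reg_le_nonzerodivisor)
      show "p \<in> ideal_gen n (Var ` ?W)" if "Var v * p \<in> ideal_gen n (Var ` ?W)" for p :: "'k mpoly"
        using that by (rule ideal_gen_Var_nzd[rotated]) auto
    qed (use insert eq in \<open>auto intro: pring_Var\<close>)
  qed
  from this[of "indets n - W"] show ?thesis
    using assms by (simp add: double_diff)
qed

text \<open>
  The ideal \<open>I\<close> of a star satisfies \<open>I : x\<^sub>s \<subseteq> I : y\<^sub>s\<close>. This property is inherited when a leaf \<open>m\<close> is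
  added, and it makes \<open>x\<^sub>m\<close> a nonzerodivisor modulo the new ideal.
\<close>

lemma colon_exchange_insert:
  fixes B :: "'k::field mpoly set"
  assumes free: "\<And>g. g \<in> B \<Longrightarrow> free_of (Xvar m) g" "\<And>g. g \<in> B \<Longrightarrow> free_of (Yvar m) g"
    and m: "m \<in> {1..n}" "s \<in> {1..n}" "m \<noteq> s"
    and exch: "\<And>b. b \<in> pring n \<Longrightarrow> Var (Xvar s) * b \<in> ideal_gen n B \<Longrightarrow> Var (Yvar s) * b \<in> ideal_gen n B"
    and b: "b \<in> pring n" "Var (Xvar s) * b \<in> ideal_gen n (insert (edge_binomial s m) B)"
  shows "Var (Yvar s) * b \<in> ideal_gen n (insert (edge_binomial s m) B)"
proof -
  let ?xs = "Var (Xvar s) :: 'k mpoly" and ?ys = "Var (Yvar s) :: 'k mpoly"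
  let ?xm = "Var (Xvar m) :: 'k mpoly" and ?ym = "Var (Yvar m) :: 'k mpoly"
  let ?f = "edge_binomial s m :: 'k mpoly"
  let ?I = "ideal_gen n (insert ?f B)"
  have vars: "?xs \<in> pring n" "?ys \<in> pring n" "?xm \<in> pring n" "?ym \<in> pring n"
    using m by (auto intro!: pring_Var simp: indets_def)
  have sub: "p \<in> ideal_gen n B \<Longrightarrow> p \<in> ?I" for p
    using ideal_gen_mono[of B "insert ?f B" n] by auto
  from b(2) obtain a c where ac: "a \<in> ideal_gen n B" "c \<in> pring n" "?xs * b = a + c * ?f"
    by (rule ideal_gen_insertE)
  define b0 b1 where "b0 = at_zero (Xvar m) b" and "b1 = quot (Xvar m) b"
  define c0 c1 where "c0 = at_zero (Xvar m) c" and "c1 = quot (Xvar m) c"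
  define a0 a1 where "a0 = at_zero (Xvar m) a" and "a1 = quot (Xvar m) a"
  have b01: "b = b0 + ?xm * b1" unfolding b0_def b1_def by (rule at_zero_quot)
  have a01: "a0 \<in> ideal_gen n B" "a1 \<in> ideal_gen n B"
    using ideal_gen_free_of[OF free(1) ac(1)] by (simp_all add: a0_def a1_def)
  have in_pring: "b0 \<in> pring n" "b1 \<in> pring n" "c0 \<in> pring n" "c1 \<in> pring n"
    using b(1) ac(2) by (simp_all add: b0_def b1_def c0_def c1_def part_pring quot_pring)
  have free_xs: "at_zero (Xvar m) ?xs = ?xs" "quot (Xvar m) ?xs = 0"
    using free_of_decomposition[of "Xvar m" ?xs] m(3) by auto
  have f: "?f = ?xs * ?ym + ?xm * (- ?ys)" by (simp add: edge_binomial_def algebra_simps)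
  have f01: "at_zero (Xvar m) ?f = ?xs * ?ym" "quot (Xvar m) ?f = - ?ys"
    unfolding f by (intro decomposition_unique free_of_mult; use m(3) in simp)+
  have "at_zero (Xvar m) (?xs * b) = at_zero (Xvar m) (a + c * ?f)" using ac(3) by simp
  then have "?xs * b0 = a0 + c0 * (?xs * ?ym)"
    by (simp add: part_add at_zero_mult free_xs f01 b0_def a0_def c0_def)
  \<comment> \<open>The part without \<open>x_m\<close> is a relation over the old generators, to
    which \<open>exch\<close> applies.\<close>
  then have "?xs * (b0 - c0 * ?ym) = a0" by (simp add: algebra_simps)
  then have 1: "?ys * (b0 - c0 * ?ym) \<in> ideal_gen n B"
    using a01 in_pring vars by (intro exch pring_diff pring_mult) auto
  have "quot (Xvar m) (?xs * b) = quot (Xvar m) (a + c * ?f)" using ac(3) by simp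
  then have 2: "?xs * b1 = a1 + (c0 * (- ?ys) + c1 * ?f)"
    by (simp add: quot_add quot_mult free_xs f01 b1_def a1_def c0_def c1_def)
  have "?ys * b = ?ys * (b0 - c0 * ?ym) + (?ym * (c0 * ?ys) + ?xm * ?ys * b1)"
    by (simp add: b01 algebra_simps)
  \<comment> \<open>The quotient by \<open>x_m\<close> of the same relation supplies
    \<open>c0 * ?ys\<close>. The leftover \<open>x_m y_s b1 - y_m x_s b1\<close> is
    \<open>- b1\<close> times the new binomial.\<close>
  also have "c0 * ?ys = a1 + c1 * ?f - ?xs * b1" using 2 by (simp add: algebra_simps)
  finally have "?ys * b = ?ys * (b0 - c0 * ?ym) + ?ym * a1 + (?ym * c1 - b1) * ?f"
    by (simp add: edge_binomial_def algebra_simps)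
  moreover have "?ys * (b0 - c0 * ?ym) + ?ym * a1 \<in> ?I"
    by (intro ideal_gen_add sub[OF 1] ideal_gen_mult sub[OF a01(2)] vars)
  moreover have "(?ym * c1 - b1) * ?f \<in> ?I"
    using in_pring vars by (intro ideal_gen_mult ideal_gen_base pring_diff pring_mult) auto
  ultimately show ?thesis by (simp add: ideal_gen_add)
qed

text \<open>Put \<open>x_m = 0\<close> in \<open>x_m p = a + c f\<close>. As \<open>y_m\<close> can
  be cancelled modulo \<open>B\<close>, the value \<open>c0\<close> of \<open>c\<close> satisfies
  \<open>x_s c0\<close> in the old ideal, hence also \<open>y_s c0\<close> by the exchange property.
  So \<open>c0 f\<close> is in the old ideal, where \<open>x_m\<close> can be cancelled.\<close>

lemma leaf_nonzerodivisor:
  fixes B :: "'k::field mpoly set"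
  assumes free: "\<And>g. g \<in> B \<Longrightarrow> free_of (Xvar m) g" "\<And>g. g \<in> B \<Longrightarrow> free_of (Yvar m) g"
    and m: "m \<in> {1..n}" "s \<in> {1..n}" "m \<noteq> s"
    and exch: "\<And>b. b \<in> pring n \<Longrightarrow> Var (Xvar s) * b \<in> ideal_gen n B \<Longrightarrow> Var (Yvar s) * b \<in> ideal_gen n B"
    and p: "p \<in> pring n" "Var (Xvar m) * p \<in> ideal_gen n (insert (edge_binomial s m) B)"
  shows "p \<in> ideal_gen n (insert (edge_binomial s m) B)"
proof -
  let ?xs = "Var (Xvar s) :: 'k mpoly" and ?ys = "Var (Yvar s) :: 'k mpoly"
  let ?xm = "Var (Xvar m) :: 'k mpoly" and ?ym = "Var (Yvar m) :: 'k mpoly"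
  let ?f = "edge_binomial s m :: 'k mpoly"
  let ?I = "ideal_gen n (insert ?f B)"
  have sub: "q \<in> ideal_gen n B \<Longrightarrow> q \<in> ?I" for q
    using ideal_gen_mono[of B "insert ?f B" n] by auto
  from p(2) obtain a c where ac: "a \<in> ideal_gen n B" "c \<in> pring n" "?xm * p = a + c * ?f"
    by (rule ideal_gen_insertE)
  define c0 c1 where "c0 = at_zero (Xvar m) c" and "c1 = quot (Xvar m) c"
  have in_pring: "c0 \<in> pring n" "c1 \<in> pring n"
    using ac(2) by (simp_all add: c0_def c1_def part_pring quot_pring)
  have c: "c = c0 + ?xm * c1" unfolding c0_def c1_def by (rule at_zero_quot)
  have f: "?f = ?xs * ?ym + ?xm * (- ?ys)" by (simp add: edge_binomial_def algebra_simps)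
  have f0: "at_zero (Xvar m) ?f = ?xs * ?ym"
    unfolding f by (intro decomposition_unique free_of_mult; use m(3) in simp)+
  have "at_zero (Xvar m) (?xm * p) = at_zero (Xvar m) (a + c * ?f)" using ac(3) by simp
  then have "at_zero (Xvar m) a + c0 * (?xs * ?ym) = 0"
    by (simp only: at_zero_Var_mult) (simp add: part_add at_zero_mult f0 c0_def)
  then have "?ym * (?xs * c0) = - at_zero (Xvar m) a"
    by (simp add: eq_neg_iff_add_eq_0 algebra_simps)
  moreover have "- at_zero (Xvar m) a \<in> ideal_gen n B"
    using ideal_gen_free_of(1)[OF free(1) ac(1)] by (rule ideal_gen_uminus)
  ultimately have "?xs * c0 \<in> ideal_gen n B"
    using ideal_gen_Var_nzd[of B "Yvar m" "?xs * c0" n] free(2) by simp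
  then have ys: "?ys * c0 \<in> ideal_gen n B" and xsc: "?xs * c0 \<in> ideal_gen n B"
    using exch in_pring by auto
  have "?xm * (p - c1 * ?f + ?ys * c0) = a + ?ym * (?xs * c0)"
    using ac(3) unfolding c by (simp add: f algebra_simps)
  also have "\<dots> \<in> ideal_gen n B"
    using m by (intro ideal_gen_add[OF ac(1)] ideal_gen_mult[OF xsc] pring_Var) (auto simp: indets_def)
  finally have "p - c1 * ?f + ?ys * c0 \<in> ideal_gen n B"
    using ideal_gen_Var_nzd[of B "Xvar m"] free(1) by blast
  moreover have "c1 * ?f \<in> ?I"
    using in_pring(2) by (intro ideal_gen_mult ideal_gen_base) auto
  ultimately have "(p - c1 * ?f + ?ys * c0) - ?ys * c0 + c1 * ?f \<in> ?I"
    using ys by (meson ideal_gen_add ideal_gen_diff sub)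
  then show ?thesis by simp
qed

text \<open>Without leaves, \<open>x_s\<close> is a nonzerodivisor modulo the variables in
  \<open>W\<close>, so \<open>b\<close> itself is in the ideal; each leaf preserves the property by
  \<open>colon_exchange_insert\<close>.\<close>

lemma star_colon_exchange:
  assumes "finite S" "S \<subseteq> {1..n}" "s \<in> {1..n}" "s \<notin> S" "W \<subseteq> indets n"
    and "\<And>t. t \<in> insert s S \<Longrightarrow> Xvar t \<notin> W \<and> Yvar t \<notin> W"
    and "b \<in> pring n" "Var (Xvar s) * b \<in> ideal_gen n (Var ` W \<union> edge_binomial s ` S)"
  shows "Var (Yvar s) * b \<in> (ideal_gen n (Var ` W \<union> edge_binomial s ` S) :: 'k::field mpoly set)"
  using assms
proof (induction S arbitrary: b)
  case empty
  then have "Var (Xvar s) * b \<in> ideal_gen n (Var ` W)" "Xvar s \<notin> W" by auto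
  then have "b \<in> ideal_gen n (Var ` W)"
    by - (rule ideal_gen_Var_nzd[of "Var ` W" "Xvar s" b n], auto)
  then have "Var (Yvar s) * b \<in> ideal_gen n (Var ` W)"
    using empty.prems(2) by (intro ideal_gen_mult pring_Var) (auto simp: indets_def)
  then show ?case by simp
next
  case (insert m S)
  have "Var (Yvar s) * b \<in> ideal_gen n (insert (edge_binomial s m) (Var ` W \<union> edge_binomial s ` S))"
  proof (rule colon_exchange_insert)
    show "free_of (Xvar m) g" "free_of (Yvar m) g"
      if "g \<in> Var ` W \<union> edge_binomial s ` S" for g :: "'k mpoly"
      using that insert.prems insert.hyps by (auto intro!: free_of_edge_binomial)
    show "Var (Yvar s) * b \<in> ideal_gen n (Var ` W \<union> edge_binomial s ` S)"
      if "b \<in> pring n" "Var (Xvar s) * b \<in> ideal_gen n (Var ` W \<union> edge_binomial s ` S)"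
      for b :: "'k mpoly"
      by (rule insert.IH) (use insert.prems that in auto)
  qed (use insert.prems in auto)
  then show ?case by simp
qed

text \<open>The colon by \<open>v\<close> and the ideal with \<open>v\<close> added are both
  generated by variables, hence have bound 0; the colon costs one.\<close>

lemma reg_le_variables_times_Var:
  assumes U: "U \<subseteq> indets n" and V: "V \<subseteq> indets n" and v: "v \<in> indets n" "v \<notin> U" "v \<notin> V"
  shows "reg_le n 1 (ideal_gen n (Var ` U \<union> (\<lambda>g. Var v * g) ` Var ` V) :: 'k::field mpoly set)"
proof -
  let ?B = "Var ` U \<union> (\<lambda>g. Var v * g) ` Var ` V :: 'k mpoly set"
  let ?I = "ideal_gen n (Var ` U \<union> Var ` V) :: 'k mpoly set"
  have B: "?B \<subseteq> pring n" using U V v by (auto intro!: pring_mult pring_Var)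
  have "reg_le n (Suc 0) (ideal_gen n ?B)"
  proof (rule reg_le_colon)
    show "\<exists>d. homogeneous d g" if "g \<in> ?B" for g
      using that homogeneous_Var homogeneous_mult[OF homogeneous_Var homogeneous_Var] by blast
    show "Var v * p \<in> ideal_gen n ?B \<longleftrightarrow> p \<in> ?I" if "p \<in> pring n" for p :: "'k mpoly"
    proof
      assume "Var v * p \<in> ideal_gen n ?B"
      then show "p \<in> ?I"
        by (rule ideal_gen_colon_Var[where v = v, rotated]) (use v in auto)
    next
      assume "p \<in> ?I"
      then show "Var v * p \<in> ideal_gen n ?B" by (rule ideal_gen_Var_times[OF v(1)])
    qed
    show "reg_le n 0 ?I"
      using reg_le_variables[of "U \<union> V" n] U V by (simp add: image_Un)
    show "?I \<subseteq> pring n" using U V by (intro ideal_gen_pring) (auto intro: pring_Var)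
    have "ideal_gen n (insert (Var v) ?B) = ideal_gen n (Var ` insert v U)"
    proof (rule ideal_gen_eqI)
      show "insert (Var v) ?B \<subseteq> ideal_gen n (Var ` insert v U)"
        using V by (auto intro: ideal_gen_base ideal_gen_mult pring_Var
          simp: mult.commute[of "Var v"])
      show "Var ` insert v U \<subseteq> ideal_gen n (insert (Var v) ?B)"
        by (auto intro: ideal_gen_base)
    qed
    then show "reg_le n (Suc 0) (ideal_gen n (insert (Var v) ?B))"
      using reg_le_variables[of "insert v U" n] U v by (auto intro: reg_le_mono)
  qed (use B v in auto)
  then show ?thesis by simp
qed

text \<open>\<open>W\<close> is arbitrary because the branch that adds \<open>y_m\<close> returns to
  the smaller star with \<open>x_m\<close> and \<open>y_m\<close> as new variables.\<close>

lemma reg_le_star_variables: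
  assumes "finite S" "S \<subseteq> {1..n}" "s \<in> {1..n}" "s \<notin> S" "W \<subseteq> indets n"
    and "\<And>t. t \<in> insert s S \<Longrightarrow> Xvar t \<notin> W \<and> Yvar t \<notin> W"
  shows "reg_le n 2 (ideal_gen n (Var ` W \<union> edge_binomial s ` S) :: 'k::field mpoly set)"
  using assms
proof (induction S arbitrary: W)
  case empty
  then show ?case using reg_le_variables[of W n] by (auto intro: reg_le_mono)
next
  case (insert m S)
  let ?F = "edge_binomial s ` S :: 'k mpoly set"
  let ?xs = "Var (Xvar s) :: 'k mpoly" and ?ys = "Var (Yvar s) :: 'k mpoly"
  let ?xm = "Var (Xvar m) :: 'k mpoly" and ?ym = "Var (Yvar m) :: 'k mpoly"
  have ms: "m \<in> {1..n}" "s \<in> {1..n}" "m \<noteq> s" "m \<notin> S" "s \<notin> S"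
    using insert by auto
  have vars: "Xvar m \<in> indets n" "Yvar m \<in> indets n" "Xvar s \<in> indets n" "Yvar s \<in> indets n"
    using ms by (auto simp: indets_def)
  have S: "S \<subseteq> {1..n}" "Xvar t \<in> indets n" "Yvar t \<in> indets n" if "t \<in> S" for t
    using insert.prems(1) that by (auto simp: indets_def)
  have F: "?F \<subseteq> pring n"
    using insert.prems by (auto intro!: edge_binomial_pring)
  have W: "Var ` W \<subseteq> (pring n :: 'k mpoly set)"
    using insert.prems by (auto intro: pring_Var)
  let ?B = "Var ` W \<union> ?F"
  have free: "free_of (Xvar m) g \<and> free_of (Yvar m) g" if "g \<in> ?B" for g
    using that insert.prems insert.hyps by (auto intro!: free_of_edge_binomial)
  let ?C = "insert ?xm (insert (?ym * ?xs) ?B)"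
  have C_eq: "?C = insert ?xm ?B \<union> (\<lambda>g. ?ym * g) ` {?xs}" by auto
  have reg_C: "reg_le n (Suc 1) (ideal_gen n ?C)"
  proof (rule reg_le_colon)
    let ?D = "insert ?xm ?B \<union> {?xs}"
    let ?U = "insert (Xvar m) (insert (Xvar s) W)"
    show C: "?C \<subseteq> pring n"
      using F W vars by (auto intro!: pring_mult pring_Var)
    show "\<exists>d. homogeneous d g" if "g \<in> ?C" for g
      using that homogeneous_Var homogeneous_mult[OF homogeneous_Var homogeneous_Var]
        homogeneous_edge_binomial by blast
    show "Yvar m \<in> indets n" by (rule vars)
    show "?ym * p \<in> ideal_gen n ?C \<longleftrightarrow> p \<in> ideal_gen n ?D" if "p \<in> pring n" for p
    proof
      assume "?ym * p \<in> ideal_gen n ?C"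
      then show "p \<in> ideal_gen n ?D"
        unfolding C_eq by (rule ideal_gen_colon_Var[where v = "Yvar m", rotated]) (use free ms in auto)
    next
      assume "p \<in> ideal_gen n ?D"
      then show "?ym * p \<in> ideal_gen n ?C"
        unfolding C_eq by (rule ideal_gen_Var_times[OF vars(2)])
    qed
    have "?D \<subseteq> pring n" using F W vars by (auto intro!: pring_Var)
    then show "ideal_gen n ?D \<subseteq> pring n" by (rule ideal_gen_pring)
    \<comment> \<open>\<open>?E\<close> is \<open>?D\<close> rewritten modulo \<open>x_s\<close>,
      where each binomial reduces to \<open>- y_s x_t\<close>.\<close>
    let ?E = "Var ` ?U \<union> (\<lambda>g. ?ys * g) ` Var ` Xvar ` S"
    have f: "edge_binomial s t = Var (Yvar t) * ?xs - ?ys * Var (Xvar t)" for t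
      by (simp add: edge_binomial_def mult.commute)
    have f': "?ys * Var (Xvar t) = Var (Yvar t) * ?xs - edge_binomial s t" for t
      by (simp add: f)
    have "ideal_gen n ?D = ideal_gen n ?E"
    proof (rule ideal_gen_eqI)
      have "edge_binomial s t \<in> ideal_gen n ?E" if "t \<in> S" for t
        unfolding f
      proof (rule ideal_gen_diff)
        show "Var (Yvar t) * ?xs \<in> ideal_gen n ?E"
          using that S by (intro ideal_gen_mult ideal_gen_base pring_Var) auto
        show "?ys * Var (Xvar t) \<in> ideal_gen n ?E"
          using that by (intro ideal_gen_base) auto
      qed
      then show "?D \<subseteq> ideal_gen n ?E" by (auto intro: ideal_gen_base)
      have "?ys * Var (Xvar t) \<in> ideal_gen n ?D" if "t \<in> S" for t
        unfolding f'
      proof (rule ideal_gen_diff)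
        show "Var (Yvar t) * ?xs \<in> ideal_gen n ?D"
          using that S by (intro ideal_gen_mult ideal_gen_base pring_Var) auto
        show "edge_binomial s t \<in> ideal_gen n ?D"
          using that by (intro ideal_gen_base) auto
      qed
      then show "?E \<subseteq> ideal_gen n ?D" by (auto intro: ideal_gen_base)
    qed
    moreover have "reg_le n 1 (ideal_gen n ?E)"
      using insert.prems vars S by (intro reg_le_variables_times_Var) auto
    ultimately show "reg_le n 1 (ideal_gen n ?D)" by simp
    \<comment> \<open>With \<open>y_m\<close> present, the generator \<open>x_s y_m\<close> is
      redundant, and the induction hypothesis applies.\<close>
    let ?G = "Var ` (insert (Xvar m) (insert (Yvar m) W)) \<union> ?F"
    have "ideal_gen n (insert ?ym ?C) = ideal_gen n ?G"
    proof (rule ideal_gen_eqI)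
      have "?xs * ?ym \<in> ideal_gen n ?G"
        using vars by (intro ideal_gen_mult ideal_gen_base pring_Var) auto
      then show "insert ?ym ?C \<subseteq> ideal_gen n ?G" by (auto intro: ideal_gen_base simp: mult.commute)
      show "?G \<subseteq> ideal_gen n (insert ?ym ?C)" by (auto intro: ideal_gen_base)
    qed
    moreover have "reg_le n 2 (ideal_gen n ?G)"
      by (rule insert.IH) (use insert.prems insert.hyps vars in auto)
    ultimately show "reg_le n (Suc 1) (ideal_gen n (insert ?ym ?C))"
      by (simp add: numeral_2_eq_2)
  qed
  let ?f = "edge_binomial s m :: 'k mpoly"
  have "reg_le n 2 (ideal_gen n (insert ?f ?B))"
  proof (rule reg_le_nonzerodivisor)
    show "Xvar m \<in> indets n" by (rule vars)
    show "p \<in> ideal_gen n (insert ?f ?B)" if "p \<in> pring n" "?xm * p \<in> ideal_gen n (insert ?f ?B)" for p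
    proof (rule leaf_nonzerodivisor)
      show "?ys * b \<in> ideal_gen n ?B" if "b \<in> pring n" "?xs * b \<in> ideal_gen n ?B" for b
        by (rule star_colon_exchange) (use insert.prems insert.hyps that in auto)
    qed (use that F W free ms in auto)
    have "ideal_gen n (insert ?xm (insert ?f ?B)) = ideal_gen n ?C"
    proof (rule ideal_gen_eqI)
      have f: "?f = ?ym * ?xs - ?ys * ?xm" "?ym * ?xs = ?f + ?ys * ?xm"
        by (simp_all add: edge_binomial_def mult.commute)
      have "?f \<in> ideal_gen n ?C"
        unfolding f(1)
      proof (rule ideal_gen_diff)
        show "?ym * ?xs \<in> ideal_gen n ?C" by (intro ideal_gen_base) auto
        show "?ys * ?xm \<in> ideal_gen n ?C"
          using vars by (intro ideal_gen_mult ideal_gen_base pring_Var) auto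
      qed
      then show "insert ?xm (insert ?f ?B) \<subseteq> ideal_gen n ?C" by (auto intro: ideal_gen_base)
      have "?ym * ?xs \<in> ideal_gen n (insert ?xm (insert ?f ?B))"
        unfolding f(2)
      proof (rule ideal_gen_add)
        show "?f \<in> ideal_gen n (insert ?xm (insert ?f ?B))" by (intro ideal_gen_base) auto
        show "?ys * ?xm \<in> ideal_gen n (insert ?xm (insert ?f ?B))"
          using vars by (intro ideal_gen_mult ideal_gen_base pring_Var) auto
      qed
      then show "?C \<subseteq> ideal_gen n (insert ?xm (insert ?f ?B))" by (auto intro: ideal_gen_base)
    qed
    then show "reg_le n 2 (ideal_gen n (insert ?xm (insert ?f ?B)))"
      using reg_C by (simp add: numeral_2_eq_2)
  qed
  then show ?case by simp
qed

theorem reg_le_star: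
  assumes "finite S" "S \<subseteq> {1..n}" "s \<in> {1..n}" "s \<notin> S"
  shows "reg_le n 2 (ideal_gen n (edge_binomial s ` S) :: 'k::field mpoly set)"
  using reg_le_star_variables[OF assms, of "{}"] by simp


section \<open>The intersection starts in degree four\<close>

lemma mdeg_eq_0_iff: "mdeg m = 0 \<longleftrightarrow> m = 0"
  by (auto simp: mdeg_def in_keys_iff intro!: poly_mapping_eqI)

lemma mdeg_eq_1E:
  assumes "mdeg m = 1"
  obtains v where "m = Poly_Mapping.single v 1"
proof -
  from assms have "Poly_Mapping.keys m \<noteq> {}" by (auto simp: mdeg_def)
  then obtain v where v: "v \<in> Poly_Mapping.keys m" by blast
  let ?m = "m - Poly_Mapping.single v 1"
  have "mdeg (?m + Poly_Mapping.single v 1) = 1"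
    using assms monom_factor[OF v] by simp
  then have "?m = 0" by (simp add: mdeg_add mdeg_eq_0_iff)
  then have "m = Poly_Mapping.single v 1" using monom_factor[OF v] by simp
  then show ?thesis by (rule that)
qed

lemma keys_edge_binomial:
  "Poly_Mapping.keys (edge_binomial i j :: 'k::field mpoly) \<subseteq>
    {Poly_Mapping.single (Xvar i) 1 + Poly_Mapping.single (Yvar j) 1,
     Poly_Mapping.single (Xvar j) 1 + Poly_Mapping.single (Yvar i) 1}"
  unfolding edge_binomial_def Var_def
  by (rule order_trans[OF keys_diff]) (auto simp: mult_single)

text \<open>In degree two the ideal consists of linear combinations of its quadratic generators, so
  only their monomials can occur.\<close>

lemma quadratic_monomial_in_edge_ideal:
  fixes q :: "'k::field mpoly"
  assumes "q \<in> ideal_gen n ((\<lambda>(i, j). edge_binomial i j) ` P)" "m \<in> Poly_Mapping.keys q" "mdeg m = 2"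
  shows "\<exists>(i, j)\<in>P. m = Poly_Mapping.single (Xvar i) 1 + Poly_Mapping.single (Yvar j) 1 \<or>
    m = Poly_Mapping.single (Xvar j) 1 + Poly_Mapping.single (Yvar i) 1"
  using assms(1,2)
proof (induction q rule: ideal_gen_induct)
  case zero
  then show ?case by simp
next
  case (add q r g)
  show ?case
  proof (cases "m \<in> Poly_Mapping.keys q")
    case True
    then show ?thesis by (rule add.IH)
  next
    case False
    obtain i j where ij: "(i, j) \<in> P" "g = edge_binomial i j"
      using add.hyps(3) by auto
    have "m \<in> Poly_Mapping.keys (r * g)"
      using False add.prems keys_add[of q "r * g"] by blast
    then obtain a b where ab: "m = a + b" "b \<in> Poly_Mapping.keys g" by (rule mem_keys_multE)
    moreover have "mdeg b = 2"
      using ab(2) homogeneous_edge_binomial[of i j] unfolding ij(2) homogeneous_def by blast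
    ultimately have "a = 0" using assms(3) by (simp add: mdeg_add mdeg_eq_0_iff)
    then show ?thesis using ab ij keys_edge_binomial[of i j, where 'k = 'k] by auto
  qed
qed

text \<open>The sum runs over the index set \<open>N\<close>, so distinct indices may give equal
  generators.\<close>

lemma ideal_gen_image_finiteE:
  fixes f :: "'b \<Rightarrow> 'k::field mpoly"
  assumes "finite N" "p \<in> ideal_gen n (f ` N)"
  obtains c where "p = (\<Sum>t\<in>N. c t * f t)"
proof -
  from assms(2) have "\<exists>c. p = (\<Sum>t\<in>N. c t * f t)"
  proof (induction p rule: ideal_gen_induct)
    case zero
    show ?case by (intro exI[of _ "\<lambda>_. 0"]) simp
  next
    case (add p r g)
    then obtain c t where c: "p = (\<Sum>t\<in>N. c t * f t)" and t: "t \<in> N" "g = f t" by blast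
    have "p + r * g = (\<Sum>u\<in>N. c u * f u) + (\<Sum>u\<in>N. if u = t then r * f u else 0)"
      using assms(1) t c by (simp add: sum.delta)
    also have "\<dots> = (\<Sum>u\<in>N. (c u + (if u = t then r else 0)) * f u)"
      unfolding sum.distrib[symmetric] by (rule sum.cong) (auto simp: algebra_simps)
    finally show ?case by (intro exI[of _ "\<lambda>u. c u + (if u = t then r else 0)"])
  qed
  then show ?thesis using that by blast
qed

text \<open>
  If \<open>p = \<Sum> a\<^sub>t (x\<^sub>s y\<^sub>t - x\<^sub>t y\<^sub>s)\<close> with linear forms \<open>a\<^sub>t\<close>, then \<open>\<Sum> a\<^sub>t y\<^sub>t\<close> (at \<open>y\<^sub>s = 0\<close>) and
  \<open>\<Sum> a\<^sub>t x\<^sub>t\<close> (at \<open>x\<^sub>s = 0\<close>) are elements of degree two of \<open>K\<close>. These only involve monomials \<open>x\<^sub>i y\<^sub>j\<close>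
  for edges \<open>{i, j}\<close>, which forces all coefficients of the \<open>a\<^sub>t\<close> to vanish.
\<close>

lemma star_inter_degree_3:
  fixes p :: "'k::field mpoly"
  assumes N: "finite N" "s \<notin> N"
    and P: "\<And>i j. (i, j) \<in> P \<Longrightarrow> i \<noteq> j \<and> i \<noteq> s \<and> j \<noteq> s \<and> \<not> (i \<in> N \<and> j \<in> N)"
    and J: "p \<in> ideal_gen n (edge_binomial s ` N)"
    and K: "p \<in> ideal_gen n ((\<lambda>(i, j). edge_binomial i j) ` P)"
    and hom: "homogeneous 3 p"
  shows "p = 0"
proof -
  let ?K = "ideal_gen n ((\<lambda>(i, j). edge_binomial i j) ` P) :: 'k mpoly set"
  let ?s = "\<lambda>v :: indet. Poly_Mapping.single v (1 :: nat)"
  obtain c where c: "p = (\<Sum>t\<in>N. c t * edge_binomial s t)"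
    using ideal_gen_image_finiteE[OF N(1) J] by blast
  define a where "a = (\<lambda>t. hcomp 1 (c t))"
  have "p = hcomp 3 p" using hom by (simp add: hcomp_homogeneous)
  also have "\<dots> = (\<Sum>t\<in>N. a t * edge_binomial s t)"
    unfolding c part_sum by (simp add: hcomp_mult[OF homogeneous_edge_binomial] a_def)
  finally have p: "p = (\<Sum>t\<in>N. a t * edge_binomial s t)" .
  have free_K: "free_of (Xvar s) g" "free_of (Yvar s) g"
    if "g \<in> (\<lambda>(i, j). edge_binomial i j) ` P" for g :: "'k mpoly"
    using that P by (auto intro!: free_of_edge_binomial)
  \<comment> \<open>At \<open>y_s = 0\<close> every \<open>edge_binomial s t\<close> becomes
    \<open>x_s y_t\<close>, so division by \<open>x_s\<close> is exact. Both operations preserve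
    \<open>K\<close>, whose generators avoid these two variables.\<close>
  define Q where "Q = quot (Xvar s) (at_zero (Yvar s) p)"
  define Q' where "Q' = quot (Yvar s) (at_zero (Xvar s) p)"
  have QK: "Q \<in> ?K" "Q' \<in> ?K"
    unfolding Q_def Q'_def by (intro ideal_gen_free_of K free_K; assumption)+
  have at_y: "at_zero (Yvar s) (edge_binomial s t) = Var (Xvar s) * (Var (Yvar t) :: 'k mpoly)"
    and at_x: "at_zero (Xvar s) (edge_binomial s t) = Var (Yvar s) * (- Var (Xvar t) :: 'k mpoly)"
    if "t \<in> N" for t
  proof -
    have "free_of (Yvar s) (Var (Xvar s) * (Var (Yvar t) :: 'k mpoly))"
      and "free_of (Xvar s) (Var (Yvar s) * (- Var (Xvar t) :: 'k mpoly))"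
      using that N(2) by (auto simp: free_of_def elim!: mem_keys_multE simp: keys_nat_add)
    from decomposition_unique(1)[OF this(1), of "- Var (Xvar t)"]
      decomposition_unique(1)[OF this(2), of "Var (Yvar t)"]
    show "at_zero (Yvar s) (edge_binomial s t) = Var (Xvar s) * (Var (Yvar t) :: 'k mpoly)"
      "at_zero (Xvar s) (edge_binomial s t) = Var (Yvar s) * (- Var (Xvar t) :: 'k mpoly)"
      by (simp_all add: edge_binomial_def algebra_simps)
  qed
  have "at_zero (Yvar s) p = Var (Xvar s) * (\<Sum>t\<in>N. Var (Yvar t) * at_zero (Yvar s) (a t))"
    unfolding p part_sum sum_distrib_left by (intro sum.cong) (auto simp: at_zero_mult at_y algebra_simps)
  then have Q: "Q = (\<Sum>t\<in>N. Var (Yvar t) * at_zero (Yvar s) (a t))"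
    by (simp add: Q_def)
  have "at_zero (Xvar s) p = Var (Yvar s) * (- (\<Sum>t\<in>N. Var (Xvar t) * at_zero (Xvar s) (a t)))"
    unfolding p part_sum sum_distrib_left sum_negf[symmetric]
    by (intro sum.cong) (auto simp: at_zero_mult at_x algebra_simps)
  then have Q': "Q' = - (\<Sum>t\<in>N. Var (Xvar t) * at_zero (Xvar s) (a t))"
    unfolding Q'_def by (simp only: quot_Var_mult)
  \<comment> \<open>The monomial \<open>v y_t\<close> can come from another index \<open>u\<close>
    only if \<open>v = y_u\<close>, which is excluded. The condition on \<open>y_s\<close> is due to
    the substitution \<open>y_s = 0\<close>.\<close>
  have LQ: "Poly_Mapping.lookup Q (?s v + ?s (Yvar t)) = Poly_Mapping.lookup (a t) (?s v)"
    if "t \<in> N" "\<forall>u\<in>N. v \<noteq> Yvar u" "v \<noteq> Yvar s" for t v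
  proof -
    have "Poly_Mapping.lookup Q (?s v + ?s (Yvar t)) =
      (\<Sum>u\<in>N. if u = t then Poly_Mapping.lookup (a t) (?s v) else 0)"
      unfolding Q lookup_sum
      by (rule sum.cong) (use that in \<open>auto simp: lookup_Var_mult keys_nat_add lookup_part\<close>)
    then show ?thesis using N(1) that(1) by (simp add: sum.delta)
  qed
  have LQ': "Poly_Mapping.lookup Q' (?s v + ?s (Xvar t)) = - Poly_Mapping.lookup (a t) (?s v)"
    if "t \<in> N" "\<forall>u\<in>N. v \<noteq> Xvar u" "v \<noteq> Xvar s" for t v
  proof -
    have "Poly_Mapping.lookup Q' (?s v + ?s (Xvar t)) =
      (\<Sum>u\<in>N. if u = t then - Poly_Mapping.lookup (a t) (?s v) else 0)"
      unfolding Q' lookup_uminus lookup_sum sum_negf[symmetric]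
      by (rule sum.cong) (use that in \<open>auto simp: lookup_Var_mult keys_nat_add lookup_part\<close>)
    then show ?thesis using N(1) that(1) by (simp add: sum.delta)
  qed
  have edge: "\<exists>(i, j)\<in>P. {v, w} = {Xvar i, Yvar j} \<or> {v, w} = {Xvar j, Yvar i}"
    if "q \<in> ?K" "Poly_Mapping.lookup q (?s v + ?s w) \<noteq> 0" for q v w
  proof -
    have keys: "Poly_Mapping.keys (?s u + ?s u') = {u, u'}" for u u'
      by (auto simp: keys_nat_add)
    have "?s v + ?s w \<in> Poly_Mapping.keys q" "mdeg (?s v + ?s w) = 2"
      using that(2) by (simp_all add: in_keys_iff mdeg_add)
    from quadratic_monomial_in_edge_ideal[OF that(1) this]
    obtain i j where ij: "(i, j) \<in> P"
      "?s v + ?s w = ?s (Xvar i) + ?s (Yvar j) \<or> ?s v + ?s w = ?s (Xvar j) + ?s (Yvar i)"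
      by (elim bexE) (auto simp del: One_nat_def)
    from ij(2) have "Poly_Mapping.keys (?s v + ?s w) = Poly_Mapping.keys (?s (Xvar i) + ?s (Yvar j)) \<or>
        Poly_Mapping.keys (?s v + ?s w) = Poly_Mapping.keys (?s (Xvar j) + ?s (Yvar i))"
      by (elim disjE) (simp_all only: simp_thms)
    then show ?thesis unfolding keys using ij(1) by blast
  qed
  have "Poly_Mapping.lookup (a t) (?s v) = 0" if t: "t \<in> N" for t v
  proof (rule ccontr)
    assume ne: "Poly_Mapping.lookup (a t) (?s v) \<noteq> 0"
    show False
    \<comment> \<open>If \<open>u\<close> lies in \<open>insert s N\<close>, the one of
      \<open>Q\<close> and \<open>Q'\<close> giving a mixed monomial is used: it would force a pair
      in \<open>P\<close> that involves \<open>s\<close>, lies inside \<open>N\<close> or repeats a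
      vertex. Otherwise the other one is used, whose monomial has two variables of the same kind and
      so belongs to no edge.\<close>
    proof (cases v)
      case (Xvar u)
      show ?thesis
      proof (cases "u \<in> insert s N")
        case True
        then have "\<forall>u\<in>N. v \<noteq> Yvar u" "v \<noteq> Yvar s" using Xvar by auto
        then have "Poly_Mapping.lookup Q (?s v + ?s (Yvar t)) \<noteq> 0"
          using LQ[OF t, of v] ne by simp
        from edge[OF QK(1) this] show ?thesis
          using P True t Xvar N(2) by (fastforce simp: doubleton_eq_iff)
      next
        case False
        then have "\<forall>u\<in>N. v \<noteq> Xvar u" "v \<noteq> Xvar s" using Xvar by auto
        then have "Poly_Mapping.lookup Q' (?s v + ?s (Xvar t)) \<noteq> 0"
          using LQ'[OF t, of v] ne by simp
        from edge[OF QK(2) this] show ?thesis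
          using Xvar by (auto simp: doubleton_eq_iff)
      qed
    next
      case (Yvar u)
      show ?thesis
      proof (cases "u \<in> insert s N")
        case True
        then have "\<forall>u\<in>N. v \<noteq> Xvar u" "v \<noteq> Xvar s" using Yvar by auto
        then have "Poly_Mapping.lookup Q' (?s v + ?s (Xvar t)) \<noteq> 0"
          using LQ'[OF t, of v] ne by simp
        from edge[OF QK(2) this] show ?thesis
          using P True t Yvar N(2) by (fastforce simp: doubleton_eq_iff)
      next
        case False
        then have "\<forall>u\<in>N. v \<noteq> Yvar u" "v \<noteq> Yvar s" using Yvar by auto
        then have "Poly_Mapping.lookup Q (?s v + ?s (Yvar t)) \<noteq> 0"
          using LQ[OF t, of v] ne by simp
        from edge[OF QK(1) this] show ?thesis
          using Yvar by (auto simp: doubleton_eq_iff)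
      qed
    qed
  qed
  moreover have "homogeneous 1 (a t)" for t
    unfolding a_def by (rule homogeneous_hcomp)
  ultimately have "a t = 0" if "t \<in> N" for t
    using that by (intro poly_mapping_eqI)
      (metis homogeneous_def in_keys_iff lookup_zero mdeg_eq_1E)
  then show ?thesis by (simp add: p)
qed

text \<open>An element of lower degree is raised to degree three by multiplication with a variable,
  which is injective; \<open>0 < n\<close> supplies the variable.\<close>

lemma star_inter_low_degree:
  fixes p :: "'k::field mpoly"
  assumes N: "finite N" "s \<notin> N" and n: "0 < n"
    and P: "\<And>i j. (i, j) \<in> P \<Longrightarrow> i \<noteq> j \<and> i \<noteq> s \<and> j \<noteq> s \<and> \<not> (i \<in> N \<and> j \<in> N)"
    and J: "p \<in> ideal_gen n (edge_binomial s ` N)"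
    and K: "p \<in> ideal_gen n ((\<lambda>(i, j). edge_binomial i j) ` P)"
    and hom: "homogeneous d p" "d \<le> 3"
  shows "p = 0"
proof -
  have v: "Xvar n \<in> indets n" using n by (auto simp: indets_def)
  have "\<forall>p\<in>ideal_gen n (edge_binomial s ` N) \<inter> ideal_gen n ((\<lambda>(i, j). edge_binomial i j) ` P).
      homogeneous d p \<longrightarrow> p = (0 :: 'k mpoly)" using hom(2)
  proof (induction rule: inc_induct)
    case base
    then show ?case using star_inter_degree_3[OF N P] by blast
  next
    case (step d)
    show ?case
    proof (intro ballI impI)
      fix p :: "'k mpoly"
      assume p: "p \<in> ideal_gen n (edge_binomial s ` N) \<inter> ideal_gen n ((\<lambda>(i, j). edge_binomial i j) ` P)"
        "homogeneous d p"
      have "Var (Xvar n) * p \<in> ideal_gen n (edge_binomial s ` N)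
          \<inter> ideal_gen n ((\<lambda>(i, j). edge_binomial i j) ` P)"
        using p(1) ideal_gen_mult[OF _ pring_Var[OF v]] by blast
      moreover have "homogeneous (Suc d) (Var (Xvar n) * p)"
        using homogeneous_mult[OF homogeneous_Var p(2)] by simp
      ultimately have "Var (Xvar n) * p = 0" using step.IH by blast
      then show "p = 0" by (simp only: Var_mult_eq_0_iff)
    qed
  qed
  then show ?thesis using J K hom(1) by blast
qed


section \<open>Vanishing of the maps on Koszul homology\<close>

lemma strand_koszulD:
  assumes "f \<in> strand (koszul n) M i j"
  shows "\<And>T. \<not> (T \<subseteq> indets n \<and> card T = i) \<Longrightarrow> f T = 0"
    and "\<And>T. T \<subseteq> indets n \<Longrightarrow> card T = i \<Longrightarrow> f T \<in> M"
    and "\<And>T. homogeneous (j - i) (f T)"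
proof -
  show 0: "f T = 0" if "\<not> (T \<subseteq> indets n \<and> card T = i)" for T
    using assms that by (auto simp: strand_def chains_def)
  show "f T \<in> M" if "T \<subseteq> indets n" "card T = i" for T
    using assms that by (auto simp: strand_def chains_def)
  show "homogeneous (j - i) (f T)" for T
  proof (cases "T \<subseteq> indets n \<and> card T = i")
    case True
    then have "\<forall>m\<in>Poly_Mapping.keys (f T). mdeg m + i = j"
      using assms by (auto simp: strand_def)
    then show ?thesis unfolding homogeneous_def by fastforce
  qed (simp add: 0)
qed

text \<open>As \<open>f\<close> is supported on sets of size \<open>i\<close>, the total
  differential sees only the boundary map leaving that degree; for \<open>i = 0\<close> there is
  none.\<close>

lemma kdiff_cycle:
  assumes "f \<in> cycles (koszul n) M i"
  shows "kdiff n f = 0"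
proof
  fix T
  have f0: "f S = 0" if "\<not> (S \<subseteq> indets n \<and> card S = i)" for S
    using assms that by (cases i) (auto simp: chains_def)
  show "kdiff n f T = 0 T"
  proof (cases "T \<subseteq> indets n \<and> i = Suc (card T)")
    case True
    then have "bdry (koszul n) (card T) f = 0" using assms by auto
    then have "bdry (koszul n) (card T) f T = 0" by simp
    then show ?thesis using True by (simp add: bdry_koszul_eq)
  next
    case False
    then have "f (insert v T) = 0" if "T \<subseteq> indets n" "v \<notin> T" for v
      using that finite_subset_indets[of T n] by (intro f0) auto
    then show ?thesis by (simp add: kdiff_def)
  qed
qed

text \<open>A bounding chain may have parts in all homological and internal degrees. Since the ideal
  is homogeneous, the part in the degrees dictated by \<open>f\<close> suffices;
  \<open>i < j\<close> leaves room for coefficients of degree \<open>j - i - 1\<close>.\<close>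

lemma boundary_in_strand:
  fixes f g :: "indet set \<Rightarrow> 'k::field mpoly"
  assumes B: "\<And>g. g \<in> B \<Longrightarrow> \<exists>d. homogeneous d g"
    and f: "f \<in> strand (koszul n) M i j" and j: "i < j"
    and g: "\<And>T. g T \<in> ideal_gen n B" and eq: "\<And>T. kdiff n g T = f T"
  shows "f \<in> bdry (koszul n) i ` strand (koszul n) (ideal_gen n B) (Suc i) j"
proof -
  obtain d where d: "j = i + Suc d" using j less_iff_Suc_add by auto
  define h where "h = (\<lambda>T. if T \<subseteq> indets n \<and> card T = Suc i then hcomp d (g T) else 0)"
  have "h \<in> strand (koszul n) (ideal_gen n B) (Suc i) j"
    using ideal_gen_hcomp[OF B g] d by (auto simp: strand_def chains_def h_def keys_part)
  moreover have "f = bdry (koszul n) i h"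
  proof
    fix T
    show "f T = bdry (koszul n) i h T"
    proof (cases "T \<subseteq> indets n \<and> card T = i")
      case True
      then have fT: "finite T" using finite_subset_indets by blast
      have "bdry (koszul n) i h T = kdiff n h T" using True by (simp add: bdry_koszul_eq)
      also have "\<dots> = kdiff n (\<lambda>T. hcomp d (g T)) T"
        using True fT by (auto simp: kdiff_def h_def intro!: sum.cong)
      also have "\<dots> = hcomp (j - i) (f T)" by (simp add: kdiff_hcomp eq d)
      also have "\<dots> = f T" using strand_koszulD(3)[OF f] by (rule hcomp_homogeneous)
      finally show ?thesis ..
    next
      case False
      then show ?thesis using strand_koszulD(1)[OF f] by (auto simp: bdry_def)
    qed
  qed
  ultimately show ?thesis by blast
qed

text \<open>The connecting map from \<open>Tor_{i+1}(k, R/I)\<close> to \<open>Tor_i(k, I)\<close>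
  on chains: a chain over \<open>R\<close> bounding \<open>f\<close> is a cycle modulo
  \<open>I\<close>, and the regularity bound corrects it by a boundary to a chain over
  \<open>I\<close>.\<close>

lemma cycle_bounds_of_reg_le:
  fixes f :: "indet set \<Rightarrow> 'k::field mpoly"
  assumes B: "B \<subseteq> pring n" "\<And>g. g \<in> B \<Longrightarrow> \<exists>d. homogeneous d g"
    and reg: "reg_le n r (ideal_gen n B)" and j: "i + Suc r < j"
    and f: "f \<in> cycles (koszul n) (ideal_gen n B) i" "f \<in> strand (koszul n) (ideal_gen n B) i j"
  shows "f \<in> bdry (koszul n) i ` strand (koszul n) (ideal_gen n B) (Suc i) j"
proof -
  note f0 = strand_koszulD(1)[OF f(2)] and fI = strand_koszulD(2)[OF f(2)]
  have fI': "f T \<in> ideal_gen n B" for T using f0 fI ideal_gen_0 by metis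
  have "f \<in> chains (koszul n) (pring n) i"
    using f(2) ideal_gen_pring[OF B(1)] by (auto simp: strand_def chains_def)
  moreover have "bdry (koszul n) i (hmap f) = f"
  proof (rule koszul_homotopy)
    show "bdry (koszul n) l f = 0" if "i = Suc l" for l using f(1) that by simp
    \<comment> \<open>In homological degree 0 the homotopy needs a vanishing constant term, which
      holds since the coefficient has degree \<open>j > 0\<close>.\<close>
    show "Poly_Mapping.lookup (f {}) 0 = 0" if "i = 0"
    proof -
      have "homogeneous j (f {})" using strand_koszulD(3)[OF f(2), of "{}"] that by simp
      then have "0 \<notin> Poly_Mapping.keys (f {})" using j by (auto simp: homogeneous_def mdeg_def)
      then show ?thesis by (simp add: in_keys_iff)
    qed
  qed fact
  ultimately have h: "hmap f \<in> chains (koszul n) (pring n) (Suc i)" "bdry (koszul n) i (hmap f) = f"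
    using hmap_chains by blast+
  have hf: "kdiff n (hmap f) T = f T" for T
  proof (cases "T \<subseteq> indets n \<and> card T = i")
    case True
    then show ?thesis using bdry_koszul_eq[of T n i "hmap f"] h(2) by simp
  next
    case False
    then have "hmap f (insert v T) = 0" if "T \<subseteq> indets n" "v \<notin> T" for v
      using h(1) that finite_subset_indets[of T n] by (auto simp: chains_def)
    then show ?thesis using f0[OF False] by (simp add: kdiff_def)
  qed
  \<comment> \<open>Coefficients in homological degree \<open>i + 1\<close> and total degree
    \<open>j\<close> have degree \<open>d = j - i - 1\<close>, which exceeds \<open>r\<close> by the
    bound on \<open>j\<close>.\<close>
  obtain d where d: "j = i + Suc d" "r < d" using j less_iff_Suc_add by fastforce
  define g where "g = (\<lambda>T. hcomp d (hmap f T))"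
  have dg: "kdiff n g T = f T" for T
    using strand_koszulD(3)[OF f(2), of T] d by (simp add: g_def kdiff_hcomp hf hcomp_homogeneous)
  have "g \<in> kchains n (pring n)"
  proof -
    have "hmap f T \<in> pring n \<and> (\<not> T \<subseteq> indets n \<longrightarrow> hmap f T = 0)" for T
      using h(1) pring_0 by (cases "T \<subseteq> indets n \<and> card T = Suc i") (auto simp: chains_def)
    then show ?thesis by (auto simp: kchains_def g_def part_pring)
  qed
  moreover have "\<forall>T. homogeneous d (g T)" by (simp add: g_def homogeneous_hcomp)
  ultimately obtain k where k: "k \<in> kchains n (pring n)" "\<And>T. g T - kdiff n k T \<in> ideal_gen n B"
    using reg d(2) dg fI' unfolding reg_le_def by metis
  have "kdiff n (g - kdiff n k) T = f T" for T
    using dg by (simp add: kdiff_diff kdiff_kdiff)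
  then show ?thesis
    using k(2) j by (intro boundary_in_strand[OF B(2) f(2), where g = "g - kdiff n k"]) auto
qed

text \<open>
  Over an ideal whose generators do not involve \<open>x\<close>, every cycle is homologous to the part that involves
  neither \<open>x\<close> nor \<open>e\<^sub>x\<close>. Doing this for \<open>x\<close> and for \<open>y\<close> leaves nothing.
\<close>

lemma cycle_bounds_of_free_variables:
  fixes f :: "indet set \<Rightarrow> 'k::field mpoly"
  assumes x: "x \<in> indets n" "\<And>g. g \<in> B \<Longrightarrow> free_of x g"
    and y: "y \<in> indets n" "\<And>g. g \<in> B \<Longrightarrow> free_of y g"
    and f: "f \<in> kchains n (ideal_gen n B)" "kdiff n f = 0" "\<And>T. at_zero y (at_zero x (f T)) = 0"
  obtains g where "g \<in> kchains n (ideal_gen n B)" "kdiff n g = f"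
proof -
  have step: "\<exists>h\<in>kchains n (ideal_gen n B). \<forall>T. kdiff n h T = f T - (if v \<in> T then 0 else at_zero v (f T))"
    if v: "v \<in> indets n" "\<And>g. g \<in> B \<Longrightarrow> free_of v g"
      and f: "f \<in> kchains n (ideal_gen n B)" "kdiff n f = 0" for v and f :: "indet set \<Rightarrow> 'k mpoly"
  proof
    \<comment> \<open>For a cycle the second term of \<open>cone_quot_homotopy\<close> vanishes, and
      \<open>quot v\<close> keeps the chain over the ideal.\<close>
    let ?h = "cone v (\<lambda>T. quot v (f T))"
    have "(\<lambda>T. quot v (f T)) \<in> kchains n (ideal_gen n B)"
      using f(1) ideal_gen_free_of(2)[OF v(2)] by (auto simp: kchains_def)
    then show "?h \<in> kchains n (ideal_gen n B)"
      by (intro cone_kchains v(1) ideal_gen_0 ideal_gen_sgn_mult)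
    show "\<forall>T. kdiff n ?h T = f T - (if v \<in> T then 0 else at_zero v (f T))"
    proof
      fix T
      show "kdiff n ?h T = f T - (if v \<in> T then 0 else at_zero v (f T))"
        using cone_quot_homotopy[OF v(1), of f T] f by (cases "v \<in> T") (simp_all add: kchains_outside cone_def)
    qed
  qed
  obtain h where h: "h \<in> kchains n (ideal_gen n B)"
    "\<And>T. kdiff n h T = f T - (if x \<in> T then 0 else at_zero x (f T))"
    using step[OF x f(1,2)] by blast
  define f' where "f' = f - kdiff n h"
  have f'_eq: "f' T = (if x \<in> T then 0 else at_zero x (f T))" for T
    by (simp add: f'_def h(2))
  have f': "f' \<in> kchains n (ideal_gen n B)"
    using f(1) ideal_gen_free_of(1)[OF x(2)] ideal_gen_0
    by (auto simp: kchains_def f'_eq)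
  have "kdiff n f' = 0" by (simp add: f'_def kdiff_diff kdiff_kdiff f(2))
  then obtain h' where h': "h' \<in> kchains n (ideal_gen n B)"
    "\<And>T. kdiff n h' T = f' T - (if y \<in> T then 0 else at_zero y (f' T))"
    using step[OF y f'] by blast
  have "kdiff n h' T = f' T" for T
    using f(3)[of T] by (simp add: h'(2) f'_eq)
  then have "kdiff n (h + h') = f"
    by (simp add: fun_eq_iff kdiff_add f'_def)
  moreover have "h + h' \<in> kchains n (ideal_gen n B)"
    using h(1) h'(1) by (auto simp: kchains_def intro: ideal_gen_add)
  ultimately show ?thesis by (rule that[rotated])
qed


section \<open>Dimensions of finitely spanned subspaces\<close>

context vector_space
begin

lemma span_Int_span_trivial:
  assumes "finite D" "finite E" "D \<inter> E = {}" "independent (D \<union> E)"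
    and x: "x \<in> span D" "x \<in> span E"
  shows "x = 0"
proof -
  obtain a where a: "x = (\<Sum>v\<in>D. scale (a v) v)"
    using x(1) assms(1) by (auto simp: span_finite)
  obtain b where b: "x = (\<Sum>v\<in>E. scale (b v) v)"
    using x(2) assms(2) by (auto simp: span_finite)
  let ?c = "\<lambda>v. if v \<in> D then a v else - b v"
  have "(\<Sum>v\<in>D \<union> E. scale (?c v) v) = (\<Sum>v\<in>D. scale (?c v) v) + (\<Sum>v\<in>E. scale (?c v) v)"
    using assms(1-3) by (rule sum.union_disjoint)
  also have "(\<Sum>v\<in>D. scale (?c v) v) = x"
    unfolding a by (rule sum.cong) auto
  also have "(\<Sum>v\<in>E. scale (?c v) v) = - x"
    unfolding b sum_negf[symmetric] using assms(3) by (intro sum.cong) auto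
  finally have "(\<Sum>v\<in>D \<union> E. scale (?c v) v) = 0" by simp
  then have "?c v = 0" if "v \<in> D" for v
    using independentD[OF assms(4), of "D \<union> E" ?c v] assms(1,2) that by blast
  then show ?thesis unfolding a by (intro sum.neutral) auto
qed

lemma independent_Un:
  assumes B: "finite B" "independent B" and E: "finite E" "independent E"
    and triv: "\<And>x. x \<in> span B \<Longrightarrow> x \<in> span E \<Longrightarrow> x = 0" and disj: "B \<inter> E = {}"
  shows "independent (B \<union> E)"
proof (rule independent_if_scalars_zero)
  fix f x assume sum: "(\<Sum>x\<in>B \<union> E. scale (f x) x) = 0" and x: "x \<in> B \<union> E"
  have *: "(\<Sum>x\<in>B. scale (f x) x) + (\<Sum>x\<in>E. scale (f x) x) = 0"
    using sum sum.union_disjoint[OF B(1) E(1) disj, of "\<lambda>x. scale (f x) x"] by simp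
  have "(\<Sum>x\<in>B. scale (f x) x) \<in> span B" "(\<Sum>x\<in>E. scale (f x) x) \<in> span E"
    by (intro span_sum span_scale span_base; assumption)+
  moreover have "(\<Sum>x\<in>B. scale (f x) x) = - (\<Sum>x\<in>E. scale (f x) x)"
    using * by (simp add: eq_neg_iff_add_eq_0)
  ultimately have B0: "(\<Sum>x\<in>B. scale (f x) x) = 0"
    using triv span_neg by metis
  then have E0: "(\<Sum>x\<in>E. scale (f x) x) = 0" using * by simp
  show "f x = 0"
    using x independentD[OF B(2,1) order_refl B0] independentD[OF E(2,1) order_refl E0] by blast
qed (use B E in simp)

lemma obtain_complement_basis:
  assumes S: "subspace S" "S \<subseteq> span F" "finite F" and U: "subspace U" "U \<subseteq> S"
  obtains D E where "finite D" "finite E" "D \<inter> E = {}" "independent (D \<union> E)"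
    "span D = U" "span (D \<union> E) = S"
proof -
  obtain D where D: "D \<subseteq> U" "independent D" "U \<subseteq> span D"
    by (rule maximal_independent_subset)
  obtain C where C: "D \<subseteq> C" "C \<subseteq> S" "independent C" "S \<subseteq> span C"
    using maximal_independent_subset_extend[of D S] D U by blast
  have "finite C"
    using independent_span_bound[OF S(3) C(3)] C(2) S(2) by blast
  moreover have "D \<union> (C - D) = C" using C(1) by blast
  ultimately show ?thesis
    using that[of D "C - D"] C D S(1) U(1) span_subspace[of D U] span_subspace[of C S]
    by (auto intro: finite_subset)
qed

text \<open>Grassmann's formula: a basis of \<open>S\<close> is extended to one of the sum by a
  basis \<open>E\<close> of a complement of \<open>S \<inter> T\<close> in \<open>T\<close>. The
  finite set \<open>F\<close> replaces finite dimension of the ambient space.\<close>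

lemma dim_sum_Int:
  assumes S: "subspace S" "S \<subseteq> span F" and T: "subspace T" "T \<subseteq> span F" and F: "finite F"
  shows "dim {x + y | x y. x \<in> S \<and> y \<in> T} + dim (S \<inter> T) = dim S + dim T"
proof -
  obtain B where B: "B \<subseteq> S" "independent B" "S \<subseteq> span B"
    by (rule maximal_independent_subset)
  have fB: "finite B" using independent_span_bound[OF F B(2)] B(1) S(2) by blast
  have spB: "span B = S" using B S(1) by (intro span_subspace)
  have "subspace (S \<inter> T)" using S T by (intro subspace_inter)
  then obtain D E where DE: "finite D" "finite E" "D \<inter> E = {}" "independent (D \<union> E)"
    "span D = S \<inter> T" "span (D \<union> E) = T"
    using obtain_complement_basis[OF T F, of "S \<inter> T"] by auto
  have indE: "independent E" and indD: "independent D"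
    using independent_mono[OF DE(4)] by auto
  have ET: "E \<subseteq> T" using DE(6) span_superset[of "D \<union> E"] by blast
  have triv: "x = 0" if "x \<in> span B" "x \<in> span E" for x
  proof -
    have "x \<in> T" using that(2) span_minimal[OF ET T(1)] by blast
    then have "x \<in> span D" using that(1) spB DE(5) by blast
    then show ?thesis using span_Int_span_trivial[OF DE(1-4)] that(2) by blast
  qed
  have "0 \<notin> B" using B(2) dependent_zero by blast
  then have disj: "B \<inter> E = {}" using triv span_base by blast
  have ind: "independent (B \<union> E)"
    using fB B(2) DE(2) indE triv disj by (rule independent_Un)
  have "span (B \<union> E) = {x + y | x y. x \<in> S \<and> y \<in> T}"
  proof
    show "span (B \<union> E) \<subseteq> {x + y | x y. x \<in> S \<and> y \<in> T}"
      unfolding span_Un spB using span_minimal[OF ET T(1)] by blast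
    have "T = {x + y | x y. x \<in> span D \<and> y \<in> span E}"
      using DE(6) by (simp add: span_Un)
    moreover have "span D \<subseteq> S" using DE(5) by simp
    ultimately have "x + y \<in> span (B \<union> E)" if xy: "x \<in> S" "y \<in> T" for x y
    proof -
      from xy(2) obtain u w where uw: "y = u + w" "u \<in> span D" "w \<in> span E"
        using \<open>T = _\<close> by blast
      have "x + u \<in> span B" using xy(1) uw(2) \<open>span D \<subseteq> S\<close> spB span_add by blast
      moreover have "x + y = (x + u) + w" using uw(1) by (simp add: add.assoc)
      ultimately show ?thesis unfolding span_Un using uw(3) by blast
    qed
    then show "{x + y | x y. x \<in> S \<and> y \<in> T} \<subseteq> span (B \<union> E)" by blast
  qed
  then have "dim {x + y | x y. x \<in> S \<and> y \<in> T} = card (B \<union> E)"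
    using dim_span_eq_card_independent[OF ind] by simp
  moreover have "card (B \<union> E) = card B + card E"
    using fB DE(2) disj by (rule card_Un_disjoint)
  moreover have "dim S = card B"
    using dim_span_eq_card_independent[OF B(2)] spB by simp
  moreover have "dim (S \<inter> T) = card D"
    using dim_span_eq_card_independent[OF indD] DE(5) by simp
  moreover have "dim T = card D + card E"
    using dim_span_eq_card_independent[OF DE(4)] DE card_Un_disjoint by metis
  ultimately show ?thesis by simp
qed

lemma dim_subset_finite:
  assumes "subspace S" "S \<subseteq> T" "subspace T" "T \<subseteq> span F" "finite F"
  shows "dim S \<le> dim T"
proof -
  obtain D E where DE: "finite D" "finite E" "D \<inter> E = {}" "independent (D \<union> E)"
    "span D = S" "span (D \<union> E) = T"
    using obtain_complement_basis[OF assms(3-5,1,2)] by blast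
  have "independent D" using independent_mono[OF DE(4)] by auto
  then have "dim S = card D" "dim T = card (D \<union> E)"
    using dim_span_eq_card_independent DE(4-6) by metis+
  then show ?thesis using DE(1,2) by (simp add: card_mono)
qed

text \<open>Rank-nullity on a finitely spanned subspace: a basis of a complement of the kernel is
  mapped injectively to a basis of the image.\<close>

lemma dim_kernel_image:
  assumes f: "Vector_Spaces.linear scale scale f"
    and S: "subspace S" "S \<subseteq> span F" "finite F"
  shows "dim S = dim {x \<in> S. f x = 0} + dim (f ` S)"
proof -
  interpret f: Vector_Spaces.linear scale scale f by fact
  let ?U = "{x \<in> S. f x = 0}"
  have U: "subspace ?U"
    using S(1) by (auto simp: subspace_def f.zero f.add f.scale)
  then obtain D E where DE: "finite D" "finite E" "D \<inter> E = {}" "independent (D \<union> E)"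
    "span D = ?U" "span (D \<union> E) = S"
    using obtain_complement_basis[OF S U] by auto
  have indE: "independent E" and indD: "independent D"
    using independent_mono[OF DE(4)] by auto
  have "E \<subseteq> S" using DE(6) span_superset[of "D \<union> E"] by blast
  then have ES: "span E \<subseteq> S" using S(1) by (intro span_minimal)
  have inj: "inj_on f (span E)"
  proof (rule inj_onI)
    fix x y assume xy: "x \<in> span E" "y \<in> span E" "f x = f y"
    then have "x - y \<in> span E" by (intro span_diff)
    moreover from this have "x - y \<in> span D"
      using ES xy(3) by (auto simp: DE(5) f.diff)
    ultimately have "x - y = 0" using span_Int_span_trivial[OF DE(1-4)] by blast
    then show "x = y" by simp
  qed
  have ind: "independent (f ` E)" using indE inj by (rule f.independent_injective_image)
  have "f ` S \<subseteq> f ` span E"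
  proof
    fix w assume "w \<in> f ` S"
    then obtain x y where "x \<in> span D" "y \<in> span E" "w = f (x + y)"
      unfolding DE(6)[symmetric] span_Un by blast
    then have "w = f y" by (simp add: DE(5) f.add)
    then show "w \<in> f ` span E" using \<open>y \<in> span E\<close> by blast
  qed
  then have "f ` S = span (f ` E)"
    using ES by (auto simp: f.span_image)
  then have "dim (f ` S) = card E"
    using dim_span_eq_card_independent[OF ind] card_image[OF inj_on_subset[OF inj span_superset]] by simp
  moreover have "dim ?U = card D"
    using dim_span_eq_card_independent[OF indD] DE(5) by simp
  moreover have "dim S = card D + card E"
    using dim_span_eq_card_independent[OF DE(4)] DE card_Un_disjoint by metis
  ultimately show ?thesis by simp
qed

end


section \<open>Betti splittings from vanishing maps\<close>

lemma strand_koszul_iff: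
  "f \<in> strand (koszul n) M i j \<longleftrightarrow>
    (\<forall>T. T \<subseteq> indets n \<and> card T = i \<longrightarrow> f T \<in> M \<and> (\<forall>m\<in>Poly_Mapping.keys (f T). mdeg m + i = j)) \<and>
    (\<forall>T. \<not> (T \<subseteq> indets n \<and> card T = i) \<longrightarrow> f T = 0)"
  by (auto simp: strand_def chains_def)

lemma linear_bdry: "Vector_Spaces.linear kscale kscale (bdry F i)"
proof -
  have "bdry F i (f + g) = bdry F i f + bdry F i g" for f g
    by (simp add: fun_eq_iff bdry_def distrib_right sum.distrib)
  moreover have "bdry F i (kscale c f) = kscale c (bdry F i f)" for c f
    by (simp add: fun_eq_iff bdry_def kscale_def sum_distrib_left mult.assoc)
  ultimately show ?thesis
    unfolding Vector_Spaces.linear_iff by (intro conjI allI chain_space.vector_space_axioms) auto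
qed

lemma Const_pring: "Const c \<in> pring n"
  by (auto simp: pring_def Const_def)

lemma keys_Const_mult: "Poly_Mapping.keys (Const c * p) \<subseteq> Poly_Mapping.keys p"
  using keys_mult[of "Const c" p] by (cases "c = 0") (auto simp: Const_def)

lemma subspace_strand:
  assumes M: "0 \<in> M" "\<And>p q. p \<in> M \<Longrightarrow> q \<in> M \<Longrightarrow> p + q \<in> M" "\<And>c p. p \<in> M \<Longrightarrow> Const c * p \<in> M"
  shows "chain_space.subspace (strand F M i j)"
proof (rule chain_space.subspaceI)
  show "0 \<in> strand F M i j" using M(1) by (simp add: strand_def chains_def)
  show "f + g \<in> strand F M i j" if "f \<in> strand F M i j" "g \<in> strand F M i j" for f g
  proof -
    have "mdeg m + shift F i b = j" if "b \<in> basis F i" "m \<in> Poly_Mapping.keys (f b + g b)" for b m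
      using that keys_add[of "f b" "g b"] \<open>f \<in> _\<close> \<open>g \<in> _\<close> unfolding strand_def by blast
    then show ?thesis using that M(2) by (simp add: strand_def chains_def)
  qed
  show "kscale c f \<in> strand F M i j" if "f \<in> strand F M i j" for c f
  proof -
    have "mdeg m + shift F i b = j" if "b \<in> basis F i" "m \<in> Poly_Mapping.keys (Const c * f b)" for b m
      using that keys_Const_mult[of c "f b"] \<open>f \<in> _\<close> unfolding strand_def by blast
    then show ?thesis using that M(3) by (simp add: strand_def chains_def kscale_def)
  qed
qed

lemma subspace_strand_ideal_gen: "chain_space.subspace (strand F (ideal_gen n B) i j)"
  by (intro subspace_strand ideal_gen_0 ideal_gen_add ideal_gen_mult Const_pring)

lemma strand_Int: "strand F (J \<inter> K) i j = strand F J i j \<inter> strand F K i j"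
  by (auto simp: strand_def chains_def)

lemma finite_monomials:
  "finite {m. Poly_Mapping.keys m \<subseteq> indets n \<and> mdeg m \<le> j}" (is "finite ?M")
proof -
  have "Poly_Mapping.lookup ` ?M \<subseteq>
      {f. \<forall>v. (v \<in> indets n \<longrightarrow> f v \<in> {..j}) \<and> (v \<notin> indets n \<longrightarrow> f v = 0)}"
  proof (intro subsetI CollectI allI)
    fix f v assume "f \<in> Poly_Mapping.lookup ` ?M"
    then obtain m where f: "f = Poly_Mapping.lookup m"
      and m: "Poly_Mapping.keys m \<subseteq> indets n" "mdeg m \<le> j" by blast
    have "Poly_Mapping.lookup m v \<in> {..j}"
    proof (cases "v \<in> Poly_Mapping.keys m")
      case True
      then have "Poly_Mapping.lookup m v \<le> mdeg m"
        unfolding mdeg_def by (intro member_le_sum) auto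
      then show ?thesis using m by simp
    qed (simp add: in_keys_iff)
    moreover have "Poly_Mapping.lookup m v = 0" if "v \<notin> indets n"
      using that m(1) by (auto simp: in_keys_iff)
    ultimately show "(v \<in> indets n \<longrightarrow> f v \<in> {..j}) \<and> (v \<notin> indets n \<longrightarrow> f v = 0)"
      unfolding f by blast
  qed
  moreover have "finite \<dots>"
    by (intro finite_set_of_finite_funs) auto
  ultimately have "finite (Poly_Mapping.lookup ` ?M)" by (rule finite_subset)
  then show ?thesis
    by (rule finite_imageD) (auto simp: inj_on_def intro: poly_mapping_eqI)
qed

text \<open>Chains with a single monomial at a single \<open>T\<close> span the strand, and the
  degree leaves finitely many of them. This makes \<open>dim\<close> and the differences in
  \<open>homology_dim\<close> meaningful.\<close>

lemma strand_finite_span: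
  obtains F where "finite F" "strand (koszul n) (pring n) i j \<subseteq> chain_space.span F"
proof -
  let ?M = "{m. Poly_Mapping.keys m \<subseteq> indets n \<and> mdeg m \<le> j}"
  let ?B = "{T. T \<subseteq> indets n \<and> card T = i}"
  define u :: "indet set \<Rightarrow> monomial \<Rightarrow> indet set \<Rightarrow> 'a mpoly"
    where "u T m = (\<lambda>S. if S = T then Poly_Mapping.single m 1 else 0)" for T m
  let ?F = "(\<lambda>(T, m). u T m) ` (?B \<times> ?M)"
  have sum_apply: "(sum g A) x = (\<Sum>a\<in>A. g a x)" for g :: "'c \<Rightarrow> indet set \<Rightarrow> 'a mpoly" and A x
    by (induction A rule: infinite_finite_induct) auto
  have monomials: "p = (\<Sum>m\<in>Poly_Mapping.keys p. Const (Poly_Mapping.lookup p m) * Poly_Mapping.single m 1)"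
    for p :: "'a mpoly"
  proof (rule poly_mapping_eqI)
    fix k
    have "Poly_Mapping.lookup (\<Sum>m\<in>Poly_Mapping.keys p. Const (Poly_Mapping.lookup p m) * Poly_Mapping.single m 1) k
        = (\<Sum>m\<in>Poly_Mapping.keys p. if m = k then Poly_Mapping.lookup p k else 0)"
      unfolding lookup_sum by (rule sum.cong) (auto simp: Const_def mult_single lookup_single)
    also have "\<dots> = Poly_Mapping.lookup p k" by (simp add: sum.delta in_keys_iff)
    finally show "Poly_Mapping.lookup p k = Poly_Mapping.lookup
        (\<Sum>m\<in>Poly_Mapping.keys p. Const (Poly_Mapping.lookup p m) * Poly_Mapping.single m 1) k" ..
  qed
  have "f \<in> chain_space.span ?F" if f: "f \<in> strand (koszul n) (pring n) i j" for f
  proof -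
    have "(\<Sum>T\<in>?B. \<Sum>m\<in>Poly_Mapping.keys (f T). kscale (Poly_Mapping.lookup (f T) m) (u T m)) S = f S" for S
    proof -
      have "(\<Sum>T\<in>?B. \<Sum>m\<in>Poly_Mapping.keys (f T). kscale (Poly_Mapping.lookup (f T) m) (u T m)) S
          = (\<Sum>T\<in>?B. if T = S then
              \<Sum>m\<in>Poly_Mapping.keys (f S). Const (Poly_Mapping.lookup (f S) m) * Poly_Mapping.single m 1 else 0)"
        unfolding sum_apply by (rule sum.cong) (auto simp: u_def kscale_def)
      also have "\<dots> = (if S \<in> ?B then f S else 0)"
        unfolding monomials[symmetric] using finite_koszul_basis by (simp add: sum.delta)
      also have "\<dots> = f S" using f by (auto simp: strand_koszul_iff)
      finally show ?thesis .
    qed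
    then have "f = (\<Sum>T\<in>?B. \<Sum>m\<in>Poly_Mapping.keys (f T). kscale (Poly_Mapping.lookup (f T) m) (u T m))"
      by (simp add: fun_eq_iff)
    also have "\<dots> \<in> chain_space.span ?F"
    proof (intro chain_space.span_sum chain_space.span_scale chain_space.span_base)
      fix T m assume T: "T \<in> ?B" and m: "m \<in> Poly_Mapping.keys (f T)"
      then have "mdeg m + i = j" "f T \<in> pring n" using f by (auto simp: strand_koszul_iff)
      then have "m \<in> ?M" using m by (auto simp: pring_def)
      then show "u T m \<in> ?F" using T by auto
    qed
    finally show ?thesis .
  qed
  moreover have "finite ?F"
    by (intro finite_imageI finite_cartesian_product finite_koszul_basis finite_monomials)
  ultimately show ?thesis using that by blast
qed

lemma strand_mono: "M \<subseteq> N \<Longrightarrow> strand F M i j \<subseteq> strand F N i j"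
  by (auto simp: strand_def chains_def)

lemma bdry_strand:
  assumes f: "f \<in> strand (koszul n) (ideal_gen n B) (Suc i) j"
  shows "bdry (koszul n) i f \<in> strand (koszul n) (ideal_gen n B) i j"
proof -
  have I: "f T \<in> ideal_gen n B" for T
    using f ideal_gen_0 by (cases "T \<subseteq> indets n \<and> card T = Suc i") (auto simp: strand_koszul_iff)
  have "bdry (koszul n) i f T \<in> ideal_gen n B" "\<forall>m\<in>Poly_Mapping.keys (bdry (koszul n) i f T). mdeg m + i = j"
    if T: "T \<subseteq> indets n" "card T = i" for T
  proof -
    have eq: "bdry (koszul n) i f T = kdiff n f T" using T by (simp add: bdry_koszul_eq)
    then show "bdry (koszul n) i f T \<in> ideal_gen n B" using kdiff_ideal_gen[of f, OF I] by simp
    show "\<forall>m\<in>Poly_Mapping.keys (bdry (koszul n) i f T). mdeg m + i = j"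
    \<comment> \<open>For \<open>j < Suc i\<close> the strand is zero; the case is separated because
      \<open>j - Suc i\<close> is truncated.\<close>
    proof (cases "Suc i \<le> j")
      case True
      have "homogeneous (1 + (j - Suc i)) (ksgn T v * Var v * f (insert v T))" for v
        unfolding mult.assoc
        by (intro homogeneous_sgn_mult homogeneous_mult homogeneous_Var strand_koszulD(3)[OF f])
      then have "homogeneous (1 + (j - Suc i)) (kdiff n f T)"
        using T(1) by (auto simp: kdiff_def intro: homogeneous_sum)
      then show ?thesis using True unfolding eq homogeneous_def by fastforce
    next
      case False
      have "f S = 0" for S
      proof (cases "S \<subseteq> indets n \<and> card S = Suc i")
        case True
        then have "m \<notin> Poly_Mapping.keys (f S)" for m
          using f False by (auto simp: strand_koszul_iff)
        then show ?thesis by (meson keys_eq_empty equals0I)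
      qed (use f in \<open>auto simp: strand_koszul_iff\<close>)
      then show ?thesis by (simp add: eq kdiff_def)
    qed
  qed
  then show ?thesis by (auto simp: strand_koszul_iff bdry_def)
qed

lemma bdry_strand_cycles:
  assumes f: "f \<in> strand (koszul n) (ideal_gen n B) (Suc i) j"
  shows "bdry (koszul n) i f \<in> cycles (koszul n) (ideal_gen n B) i \<inter> strand (koszul n) (ideal_gen n B) i j"
  using bdry_strand[OF f] koszul_bdry_bdry by (cases i) (auto simp: strand_def)

lemma dim_strand:
  fixes M :: "'k::field mpoly set"
  assumes M: "chain_space.subspace (strand (koszul n) M (Suc l) j)" "M \<subseteq> pring n"
  shows "chain_space.dim (strand (koszul n) M (Suc l) j) =
    chain_space.dim (cycles (koszul n) M (Suc l) \<inter> strand (koszul n) M (Suc l) j) +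
    chain_space.dim (bdry (koszul n) l ` strand (koszul n) M (Suc l) j)"
proof -
  obtain F where "finite F" "strand (koszul n) (pring n :: 'k mpoly set) (Suc l) j \<subseteq> chain_space.span F"
    by (rule strand_finite_span)
  moreover have "cycles (koszul n) M (Suc l) \<inter> strand (koszul n) M (Suc l) j =
      {f \<in> strand (koszul n) M (Suc l) j. bdry (koszul n) l f = 0}"
    by (auto simp: strand_def)
  ultimately show ?thesis
    using chain_space.dim_kernel_image[OF linear_bdry M(1), of F] strand_mono[OF M(2)] by simp blast
qed

lemma subspace_cycles:
  assumes "chain_space.subspace (strand (koszul n) M i j)"
  shows "chain_space.subspace (cycles (koszul n) M i \<inter> strand (koszul n) M i j)"
proof (cases i)
  case 0
  then have "cycles (koszul n) M i \<inter> strand (koszul n) M i j = strand (koszul n) M i j"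
    by (auto simp: strand_def)
  then show ?thesis using assms by simp
next
  case (Suc l)
  interpret b: Vector_Spaces.linear kscale kscale "bdry (koszul n) l" by (rule linear_bdry)
  have "cycles (koszul n) M i \<inter> strand (koszul n) M i j =
      strand (koszul n) M i j \<inter> {f. bdry (koszul n) l f = 0}"
    using Suc by (auto simp: strand_def)
  then show ?thesis
    using chain_space.subspace_inter[OF assms b.subspace_kernel] by (simp only:)
qed

text \<open>Ensures that the subtraction of natural numbers in \<open>homology_dim\<close> does not
  truncate.\<close>

lemma dim_boundaries_le:
  fixes M :: "'k::field mpoly set"
  assumes M: "M \<subseteq> pring n" "chain_space.subspace (strand (koszul n) M i j)"
    "chain_space.subspace (strand (koszul n) M (Suc i) j)"
    and sub: "bdry (koszul n) i ` strand (koszul n) M (Suc i) j \<subseteq>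
      cycles (koszul n) M i \<inter> strand (koszul n) M i j"
  shows "chain_space.dim (bdry (koszul n) i ` strand (koszul n) M (Suc i) j) \<le>
    chain_space.dim (cycles (koszul n) M i \<inter> strand (koszul n) M i j)"
proof -
  obtain F where F: "finite F" "strand (koszul n) (pring n :: 'k mpoly set) i j \<subseteq> chain_space.span F"
    by (rule strand_finite_span)
  interpret b: Vector_Spaces.linear kscale kscale "bdry (koszul n) i" by (rule linear_bdry)
  show ?thesis
    using F strand_mono[OF M(1), of "koszul n" i j]
    by (intro chain_space.dim_subset_finite[OF b.subspace_image[OF M(3)] sub subspace_cycles[OF M(2)], of F]) auto
qed

text \<open>Coefficients are decomposed one by one; as both ideals are homogeneous, the summands can
  be cut down to the right degree.\<close>

lemma strand_ideal_sum:
  assumes A: "\<And>g. g \<in> A \<Longrightarrow> \<exists>d. homogeneous d g" and B: "\<And>g. g \<in> B \<Longrightarrow> \<exists>d. homogeneous d g"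
  shows "strand (koszul n) (ideal_gen n (A \<union> B)) i j =
    {f + g | f g. f \<in> strand (koszul n) (ideal_gen n A) i j \<and> g \<in> strand (koszul n) (ideal_gen n B) i j}"
proof (intro equalityI subsetI)
  fix f assume f: "f \<in> strand (koszul n) (ideal_gen n (A \<union> B)) i j"
  \<comment> \<open>Unlike \<open>mdeg m = j - i\<close>, this condition is also correct for
    \<open>j < i\<close>, where it selects nothing.\<close>
  let ?P = "part (\<lambda>m. mdeg m + i = j)"
  have P: "?P p \<in> ideal_gen n C" if "p \<in> ideal_gen n C" "\<And>g. g \<in> C \<Longrightarrow> \<exists>d. homogeneous d g" for p C
  proof (cases "i \<le> j")
    case True
    then have "(\<lambda>m. mdeg m + i = j) = (\<lambda>m. mdeg m = j - i)" by auto
    then show ?thesis using ideal_gen_hcomp[OF that(2,1)] by simp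
  next
    case False
    then have "?P p = 0" by (intro part_eq_0) auto
    then show ?thesis by (simp add: ideal_gen_0)
  qed
  have "\<exists>a b. a \<in> ideal_gen n A \<and> b \<in> ideal_gen n B \<and> (T \<subseteq> indets n \<and> card T = i \<longrightarrow> f T = a + b)" for T
  proof (cases "T \<subseteq> indets n \<and> card T = i")
    case True
    then have "f T \<in> ideal_gen n (A \<union> B)" using f by (auto simp: strand_koszul_iff)
    then show ?thesis by (elim ideal_gen_UnE) blast
  qed (use ideal_gen_0 in blast)
  then obtain a b where ab: "\<And>T. a T \<in> ideal_gen n A" "\<And>T. b T \<in> ideal_gen n B"
    "\<And>T. T \<subseteq> indets n \<Longrightarrow> card T = i \<Longrightarrow> f T = a T + b T" by metis
  define a' where "a' T = (if T \<subseteq> indets n \<and> card T = i then ?P (a T) else 0)" for T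
  define b' where "b' T = (if T \<subseteq> indets n \<and> card T = i then ?P (b T) else 0)" for T
  have "a' \<in> strand (koszul n) (ideal_gen n A) i j"
    using P[OF ab(1) A] by (auto simp: strand_koszul_iff a'_def keys_part)
  moreover have "b' \<in> strand (koszul n) (ideal_gen n B) i j"
    using P[OF ab(2) B] by (auto simp: strand_koszul_iff b'_def keys_part)
  moreover have "f T = (a' + b') T" for T
  proof (cases "T \<subseteq> indets n \<and> card T = i")
    case True
    then have "f T = ?P (f T)" using f by (intro part_ident[symmetric]) (auto simp: strand_koszul_iff)
    then show ?thesis using True ab(3)[of T] by (simp add: a'_def b'_def part_add)
  next
    case False
    then show ?thesis using f by (auto simp: strand_koszul_iff a'_def b'_def)
  qed
  ultimately show "f \<in> {f + g | f g. f \<in> strand (koszul n) (ideal_gen n A) i j \<and>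
      g \<in> strand (koszul n) (ideal_gen n B) i j}"
    by (auto simp: fun_eq_iff)
next
  fix h assume "h \<in> {f + g | f g. f \<in> strand (koszul n) (ideal_gen n A) i j \<and>
      g \<in> strand (koszul n) (ideal_gen n B) i j}"
  then obtain f g where fg: "h = f + g" "f \<in> strand (koszul n) (ideal_gen n A) i j"
    "g \<in> strand (koszul n) (ideal_gen n B) i j" by blast
  have "f \<in> strand (koszul n) (ideal_gen n (A \<union> B)) i j" "g \<in> strand (koszul n) (ideal_gen n (A \<union> B)) i j"
    using fg(2,3) strand_mono[OF ideal_gen_mono] by (blast, blast)
  then show "h \<in> strand (koszul n) (ideal_gen n (A \<union> B)) i j"
    unfolding fg(1) by (intro chain_space.subspace_add[OF subspace_strand_ideal_gen])
qed

text \<open>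
  The hypothesis says that the maps from \<open>Tor\<^sub>i(k, J \<inter> K)\<close> to \<open>Tor\<^sub>i(k, J)\<close> and \<open>Tor\<^sub>i(k, K)\<close> vanish. Then
  the cycles over \<open>J \<inter> K\<close> are exactly the common boundaries over \<open>J\<close> and over \<open>K\<close>, and the formula
  follows by counting dimensions, without the long exact sequence.
\<close>

lemma tor_dim_splitting:
  fixes A B :: "'k::field mpoly set" and n i j :: nat
  defines "J \<equiv> ideal_gen n A" and "K \<equiv> ideal_gen n B" and "I \<equiv> ideal_gen n (A \<union> B)"
  assumes A: "A \<subseteq> pring n" "\<And>g. g \<in> A \<Longrightarrow> \<exists>d. homogeneous d g"
    and B: "B \<subseteq> pring n" "\<And>g. g \<in> B \<Longrightarrow> \<exists>d. homogeneous d g"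
    and van: "\<And>i j. cycles (koszul n) (J \<inter> K) i \<inter> strand (koszul n) (J \<inter> K) i j \<subseteq>
      bdry (koszul n) i ` strand (koszul n) J (Suc i) j \<inter> bdry (koszul n) i ` strand (koszul n) K (Suc i) j"
  shows "tor_dim n i j I = tor_dim n i j J + tor_dim n i j K
    + (case i of 0 \<Rightarrow> 0 | Suc l \<Rightarrow> tor_dim n l j (J \<inter> K))"
proof -
  let ?C = "\<lambda>M i. strand (koszul n) M i j :: (indet set \<Rightarrow> 'k mpoly) set"
  let ?Z = "\<lambda>M i. cycles (koszul n) M i \<inter> ?C M i"
  let ?B = "\<lambda>M i. bdry (koszul n) i ` ?C M (Suc i)"
  have pr: "I \<subseteq> pring n" "J \<subseteq> pring n" "K \<subseteq> pring n" "J \<inter> K \<subseteq> pring n"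
  proof -
    show I: "I \<subseteq> pring n" unfolding I_def using A(1) B(1) by (intro ideal_gen_pring) auto
    show "J \<subseteq> pring n" "K \<subseteq> pring n" "J \<inter> K \<subseteq> pring n"
      using ideal_gen_pring[OF A(1)] ideal_gen_pring[OF B(1)] unfolding J_def K_def by auto
  qed
  have sub: "chain_space.subspace (?C I i)" "chain_space.subspace (?C J i)"
    "chain_space.subspace (?C K i)" "chain_space.subspace (?C (J \<inter> K) i)" for i
    unfolding I_def J_def K_def strand_Int
    by (intro chain_space.subspace_inter subspace_strand_ideal_gen)+
  have C_sum: "?C I i = {f + g | f g. f \<in> ?C J i \<and> g \<in> ?C K i}" for i
    unfolding I_def J_def K_def by (rule strand_ideal_sum[OF A(2) B(2)])
  have B_sub: "?B I i \<subseteq> ?Z I i" "?B J i \<subseteq> ?Z J i" "?B K i \<subseteq> ?Z K i" for i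
    unfolding I_def J_def K_def using bdry_strand_cycles by blast+
  have Z_Int: "?Z J i \<inter> ?Z K i \<subseteq> ?Z (J \<inter> K) i" for i
    by (cases i) (auto simp: strand_def chains_def)
  have B_sub_Int: "?B (J \<inter> K) i \<subseteq> ?Z (J \<inter> K) i" for i
  proof -
    have "?B (J \<inter> K) i \<subseteq> ?B J i \<inter> ?B K i" by (auto simp: strand_Int)
    then show ?thesis by (rule order_trans[OF _ order_trans[OF Int_mono[OF B_sub(2,3)] Z_Int]])
  qed
  \<comment> \<open>Common boundaries are cycles over the intersection in any case; the converse is
    the vanishing hypothesis \<open>van\<close>.\<close>
  have B_Int: "?B J i \<inter> ?B K i = ?Z (J \<inter> K) i" for i
    by (intro equalityI order_trans[OF Int_mono[OF B_sub(2,3)] Z_Int] van)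
  have le: "chain_space.dim (?B I i) \<le> chain_space.dim (?Z I i)"
    "chain_space.dim (?B J i) \<le> chain_space.dim (?Z J i)"
    "chain_space.dim (?B K i) \<le> chain_space.dim (?Z K i)"
    "chain_space.dim (?B (J \<inter> K) i) \<le> chain_space.dim (?Z (J \<inter> K) i)" for i
    by (intro dim_boundaries_le pr sub B_sub B_sub_Int)+
  have dim_C: "chain_space.dim (?C I i) + chain_space.dim (?C (J \<inter> K) i)
      = chain_space.dim (?C J i) + chain_space.dim (?C K i)" for i
  proof -
    obtain F where F: "finite F" "?C (pring n) i \<subseteq> chain_space.span F"
      by (rule strand_finite_span)
    have "?C J i \<subseteq> chain_space.span F" "?C K i \<subseteq> chain_space.span F"
      using F(2) strand_mono[OF pr(2)] strand_mono[OF pr(3)] by blast+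
    then show ?thesis
      using chain_space.dim_sum_Int[OF sub(2) _ sub(3) _ F(1)] unfolding C_sum strand_Int by blast
  qed
  \<comment> \<open>The boundaries over \<open>I\<close> are the sum of those over \<open>J\<close>
    and over \<open>K\<close>, and by \<open>B_Int\<close> the two summands meet in the cycles over
    \<open>J \<inter> K\<close>.\<close>
  have dim_B: "chain_space.dim (?B I i) + chain_space.dim (?Z (J \<inter> K) i)
      = chain_space.dim (?B J i) + chain_space.dim (?B K i)" for i
  proof -
    obtain F where F: "finite F" "?C (pring n) i \<subseteq> chain_space.span F"
      by (rule strand_finite_span)
    interpret b: Vector_Spaces.linear kscale kscale "bdry (koszul n :: (_, 'k) graded_complex) i"
      by (rule linear_bdry)
    have "?B J i \<subseteq> chain_space.span F" "?B K i \<subseteq> chain_space.span F"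
      using F(2) strand_mono[OF pr(2)] strand_mono[OF pr(3)] B_sub(2,3)[of i] by blast+
    moreover have "?B I i = {f + g | f g. f \<in> ?B J i \<and> g \<in> ?B K i}"
    proof (intro equalityI subsetI)
      fix h assume "h \<in> ?B I i"
      then obtain f g where "f \<in> ?C J (Suc i)" "g \<in> ?C K (Suc i)" "h = bdry (koszul n) i (f + g)"
        unfolding C_sum by blast
      then show "h \<in> {f + g | f g. f \<in> ?B J i \<and> g \<in> ?B K i}" by (auto simp: b.add)
    next
      fix h assume "h \<in> {f + g | f g. f \<in> ?B J i \<and> g \<in> ?B K i}"
      then obtain f g where "f \<in> ?C J (Suc i)" "g \<in> ?C K (Suc i)" "h = bdry (koszul n) i (f + g)"
        by (auto simp: b.add)
      then show "h \<in> ?B I i" unfolding C_sum by blast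
    qed
    ultimately show ?thesis
      using chain_space.dim_sum_Int[OF b.subspace_image[OF sub(2)] _ b.subspace_image[OF sub(3)] _ F(1)]
      unfolding B_Int[symmetric] by simp
  qed
  show ?thesis
  proof (cases i)
    case 0
    have Z0: "?Z M 0 = ?C M 0" for M by (auto simp: strand_def)
    show ?thesis
      using dim_C[of 0] dim_B[of 0] le[of 0]
      unfolding 0 tor_dim_def homology_dim_def nat.case Z0 by linarith
  next
    case (Suc l)
    have rank: "chain_space.dim (?C M (Suc l)) = chain_space.dim (?Z M (Suc l)) + chain_space.dim (?B M l)"
      if "chain_space.subspace (?C M (Suc l))" "M \<subseteq> pring n" for M
      using that by (rule dim_strand)
    \<comment> \<open>After eliminating the chain spaces by \<open>rank\<close>, the cycles over
      \<open>J \<inter> K\<close> in degree \<open>Suc l\<close> cancel, and cycles minus boundaries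
      in degree \<open>l\<close> remain. By \<open>le\<close> no subtraction truncates.\<close>
    show ?thesis
      using dim_C[of "Suc l"] dim_B[of "Suc l"] dim_B[of l] le[of "Suc l"] le[of l]
        rank[OF sub(1) pr(1)] rank[OF sub(2) pr(2)] rank[OF sub(3) pr(3)] rank[OF sub(4) pr(4)]
      unfolding Suc tor_dim_def homology_dim_def nat.case by linarith
  qed
qed


section \<open>Minimal generators of binomial edge ideals\<close>

lemma edge_monomial_eq_iff:
  "Poly_Mapping.single (Xvar i) (1::nat) + Poly_Mapping.single (Yvar j) 1 =
     Poly_Mapping.single (Xvar k) 1 + Poly_Mapping.single (Yvar l) 1 \<longleftrightarrow> i = k \<and> j = l"
  (is "?l = ?r \<longleftrightarrow> _")
proof
  assume "?l = ?r"
  then have "Poly_Mapping.keys ?l = Poly_Mapping.keys ?r" by (rule arg_cong)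
  then show "i = k \<and> j = l" by (auto simp: keys_nat_add)
qed auto

lemma edge_monomial_in_keys:
  assumes "i \<noteq> j"
  shows "Poly_Mapping.single (Xvar i) 1 + Poly_Mapping.single (Yvar j) 1
    \<in> Poly_Mapping.keys (edge_binomial i j :: 'k::field mpoly)"
  using assms edge_monomial_eq_iff[of i j j i]
  unfolding edge_binomial_def Var_def mult_single
  by (auto simp: in_keys_iff lookup_minus lookup_single when_def)

text \<open>The monomial \<open>x_i y_j\<close> of an oriented edge occurs in no other generator,
  because each edge is present in one orientation only. Hence no generator lies in the ideal of the
  others.\<close>

lemma minimal_homogeneous_generators_edges:
  fixes P :: "(nat \<times> nat) set"
  assumes P: "\<And>i j. (i, j) \<in> P \<Longrightarrow> i \<in> {1..n} \<and> j \<in> {1..n} \<and> i \<noteq> j \<and> (j, i) \<notin> P"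
  defines "A \<equiv> (\<lambda>(i, j). edge_binomial i j) ` P :: 'k::field mpoly set"
  shows "minimal_homogeneous_generators n A (ideal_gen n A)"
  unfolding minimal_homogeneous_generators_def
proof (intro conjI ballI allI impI refl)
  show "A \<subseteq> pring n"
    using P unfolding A_def by (auto intro: edge_binomial_pring simp del: atLeastAtMost_iff)
  show "\<exists>d. homogeneous d g" if "g \<in> A" for g
    using that homogeneous_edge_binomial unfolding A_def by auto
  fix A' assume "A' \<subset> A"
  then obtain i j where ij: "(i, j) \<in> P" "edge_binomial i j \<notin> A'" "A' \<subseteq> A"
    unfolding A_def by auto
  obtain P' where P': "P' \<subseteq> P" "A' = (\<lambda>(i, j). edge_binomial i j) ` P'"
    using ij(3) unfolding A_def subset_image_iff by blast
  then have "(i, j) \<notin> P'" using ij(2) by auto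
  let ?m = "Poly_Mapping.single (Xvar i) (1::nat) + Poly_Mapping.single (Yvar j) 1"
  have "edge_binomial i j \<notin> ideal_gen n A'"
  proof
    assume "edge_binomial i j \<in> ideal_gen n A'"
    moreover have "?m \<in> Poly_Mapping.keys (edge_binomial i j :: 'k mpoly)" "mdeg ?m = 2"
      using edge_monomial_in_keys P[OF ij(1)] by (auto simp: mdeg_add)
    ultimately obtain k l where kl: "(k, l) \<in> P'"
      "?m = Poly_Mapping.single (Xvar k) 1 + Poly_Mapping.single (Yvar l) 1 \<or>
       ?m = Poly_Mapping.single (Xvar l) 1 + Poly_Mapping.single (Yvar k) 1"
      using quadratic_monomial_in_edge_ideal[of "edge_binomial i j" n P' ?m] unfolding P'(2) by blast
    from kl(2) have "(i = k \<and> j = l) \<or> (i = l \<and> j = k)"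
      unfolding edge_monomial_eq_iff .
    then show False using kl(1) \<open>(i, j) \<notin> P'\<close> P'(1) P[OF ij(1)] by blast
  qed
  moreover have "edge_binomial i j \<in> ideal_gen n A"
    using ij(1) unfolding A_def by (intro ideal_gen_base) auto
  ultimately show "ideal_gen n A' \<noteq> ideal_gen n A" by blast
qed

section \<open>From graphs to oriented edges\<close>

lemma edge_binomial_swap: "edge_binomial j i = - edge_binomial i j"
  by (simp add: edge_binomial_def)

text \<open>\<open>binomial_edge_ideal\<close> takes both orientations of every edge, whose
  binomials differ by a sign. A minimal generating set has to choose one of them.\<close>

lemma binomial_edge_ideal_oriented:
  assumes "\<And>i j. (i, j) \<in> P \<Longrightarrow> {i, j} \<in> edges H"
    and "\<And>i j. {i, j} \<in> edges H \<Longrightarrow> (i, j) \<in> P \<or> (j, i) \<in> P"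
  shows "binomial_edge_ideal n H = ideal_gen n ((\<lambda>(i, j). edge_binomial i j) ` P)"
proof -
  let ?E = "{edge_binomial i j | i j. {i, j} \<in> edges H}"
  have "binomial_edge_ideal n H = ideal_gen n ?E"
    by (simp add: binomial_edge_ideal_def edge_binomial_def)
  also have "\<dots> = ideal_gen n ((\<lambda>(i, j). edge_binomial i j) ` P)"
  proof (rule ideal_gen_eqI)
    have "edge_binomial i j \<in> ideal_gen n ((\<lambda>(i, j). edge_binomial i j) ` P)"
      if e: "{i, j} \<in> edges H" for i j
    proof (cases "(i, j) \<in> P")
      case True
      then show ?thesis by (intro ideal_gen_base) auto
    next
      case False
      then have "(j, i) \<in> P" using assms(2)[OF e] by blast
      then have "- edge_binomial j i \<in> ideal_gen n ((\<lambda>(i, j). edge_binomial i j) ` P)"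
        by (intro ideal_gen_uminus ideal_gen_base) auto
      then show ?thesis by (simp add: edge_binomial_swap[of j i])
    qed
    then show "?E \<subseteq> ideal_gen n ((\<lambda>(i, j). edge_binomial i j) ` P)" by blast
    show "(\<lambda>(i, j). edge_binomial i j) ` P \<subseteq> ideal_gen n ?E"
      using assms(1) by (auto intro!: ideal_gen_base)
  qed
  finally show ?thesis .
qed

lemma triangle_free_nbrs:
  assumes G: "simple_graph G" "triangle_free G" and t: "t \<in> nbrs G s" "u \<in> nbrs G s"
  shows "{t, u} \<notin> edges G"
proof
  assume tu: "{t, u} \<in> edges G"
  have E: "e \<subseteq> verts G \<and> card e = 2" if "e \<in> edges G" for e
    using G(1) that by (auto simp: simple_graph_def)
  have st: "{s, t} \<in> edges G" "{s, u} \<in> edges G" using t by (auto simp: nbrs_def)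
  have d: "s \<noteq> t" "s \<noteq> u" "t \<noteq> u" using E[OF tu] E[OF st(1)] E[OF st(2)] by auto
  have "{e \<in> edges G. e \<subseteq> {s, t, u}} = {{s, t}, {t, u}, {s, u}}"
  proof (intro equalityI subsetI)
    fix e assume "e \<in> {e \<in> edges G. e \<subseteq> {s, t, u}}"
    then have e: "e \<subseteq> {s, t, u}" "card e = 2" using E by auto
    obtain a b where ab: "e = {a, b}" "a \<noteq> b" using e(2) by (auto simp: card_2_iff)
    then show "e \<in> {{s, t}, {t, u}, {s, u}}" using e(1) by (auto simp: insert_commute)
  next
    fix e assume "e \<in> {{s, t}, {t, u}, {s, u}}"
    then show "e \<in> {e \<in> edges G. e \<subseteq> {s, t, u}}" using st tu by auto
  qed
  then have "edges (induced_subgraph G {s, t, u}) = {{s, t}, {t, u}, {s, u}}"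
    by (simp only: induced_subgraph_def sgraph.simps)
  moreover have "verts (induced_subgraph G {s, t, u}) = {s, t, u}"
    by (simp only: induced_subgraph_def sgraph.simps)
  ultimately have "is_3_cycle (induced_subgraph G {s, t, u})"
    using d unfolding is_3_cycle_def by blast
  moreover have "{s, t, u} \<subseteq> verts G" using E[OF st(1)] E[OF tu] by auto
  ultimately show False using G(2) by (auto simp: triangle_free_def)
qed

text \<open>Each term of \<open>edge_binomial s t\<close> contains \<open>x_s\<close> or
  \<open>y_s\<close>. In this form the containment of \<open>J\<close> in the ideal of these
  variables enters \<open>cycle_bounds_of_free_variables\<close>.\<close>

lemma star_ideal_at_zero:
  fixes p :: "'k::field mpoly"
  assumes "p \<in> ideal_gen n (edge_binomial s ` N)" "s \<notin> N"
  shows "at_zero (Yvar s) (at_zero (Xvar s) p) = 0"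
  using assms(1)
proof (induction p rule: ideal_gen_induct)
  case (add p r g)
  then obtain t where "g = edge_binomial s t" "t \<in> N" by blast
  then have "at_zero (Xvar s) g = at_zero (Xvar s) (Var (Xvar s)) * at_zero (Xvar s) (Var (Yvar t)) -
      at_zero (Xvar s) (Var (Xvar t)) * at_zero (Xvar s) (Var (Yvar s))"
    by (simp only: edge_binomial_def part_diff at_zero_mult)
  moreover have "at_zero (Xvar s) (Var (Xvar s) :: 'k mpoly) = 0"
    by (rule part_eq_0) auto
  moreover have "at_zero (Yvar s) (at_zero (Xvar s) (Var (Yvar s) :: 'k mpoly)) = 0"
    by (rule part_eq_0) (auto simp: keys_part)
  ultimately have "at_zero (Yvar s) (at_zero (Xvar s) g) = 0"
    by (simp only: part_diff part_0 mult_zero_left at_zero_mult mult_zero_right diff_self)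
  then show ?case by (simp add: part_add at_zero_mult add.IH)
qed simp

theorem corollary5p7:
  fixes G :: sgraph and n s :: nat
  assumes "simple_graph G" and "verts G = {1..n}" and "s \<in> {1..n}"
    and "triangle_free G"
  shows "complete_betti_splitting n
    (binomial_edge_ideal n G :: 'k::field mpoly set)
    (binomial_edge_ideal n (star_at G s))
    (binomial_edge_ideal n (delete_vertex G s))"
proof -
  let ?e = "\<lambda>(i, j). edge_binomial i j :: 'k mpoly"
  define N where "N = nbrs G s"
  \<comment> \<open>Star edges are oriented away from \<open>s\<close>, so that \<open>A\<close> has
    the form treated by \<open>reg_le_star\<close>; the remaining edges follow the order of the
    vertices.\<close>
  define P1 where "P1 = {s} \<times> N"
  define P2 where "P2 = {(i, j). i < j \<and> {i, j} \<in> edges G \<and> i \<noteq> s \<and> j \<noteq> s}"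
  define A where "A = (edge_binomial s ` N :: 'k mpoly set)"
  define B where "B = ?e ` P2"
  have edge: "i \<in> {1..n} \<and> j \<in> {1..n} \<and> i \<noteq> j" if "{i, j} \<in> edges G" for i j
    using assms(1,2) that unfolding simple_graph_def by (metis card_2_iff doubleton_eq_iff insert_subset)
  have N: "N \<subseteq> {1..n}" "finite N" "s \<notin> N"
  proof -
    show "N \<subseteq> {1..n}" "s \<notin> N" using edge[of s] edge[of s s] by (auto simp: N_def nbrs_def)
    then show "finite N" using finite_subset by blast
  qed
  have A_eq: "?e ` P1 = A" by (force simp: P1_def A_def)
  have P1: "i \<in> {1..n} \<and> j \<in> {1..n} \<and> i \<noteq> j \<and> (j, i) \<notin> P1" if "(i, j) \<in> P1" for i j
    using that N assms(3) by (auto simp: P1_def)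
  have P2: "i \<in> {1..n} \<and> j \<in> {1..n} \<and> i \<noteq> j \<and> (j, i) \<notin> P2" if "(i, j) \<in> P2" for i j
    using that edge[of i j] by (auto simp: P2_def)
  have P: "i \<in> {1..n} \<and> j \<in> {1..n} \<and> i \<noteq> j \<and> (j, i) \<notin> P1 \<union> P2" if "(i, j) \<in> P1 \<union> P2" for i j
  proof -
    have "\<not> ((i, j) \<in> P1 \<and> (j, i) \<in> P2)" "\<not> ((i, j) \<in> P2 \<and> (j, i) \<in> P1)"
      by (auto simp: P1_def P2_def)
    then show ?thesis using that P1[of i j] P2[of i j] by blast
  qed
  have P2': "i \<noteq> j \<and> i \<noteq> s \<and> j \<noteq> s \<and> \<not> (i \<in> N \<and> j \<in> N)" if "(i, j) \<in> P2" for i j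
    using that triangle_free_nbrs[OF assms(1,4), of i s j] by (auto simp: P2_def N_def)
  have orient: "(i, j) \<in> P1 \<union> P2 \<or> (j, i) \<in> P1 \<union> P2" if "{i, j} \<in> edges G" for i j
  proof -
    have "i \<noteq> j" "{j, i} \<in> edges G" using edge[OF that] that by (auto simp: insert_commute)
    then show ?thesis using that unfolding P1_def P2_def N_def nbrs_def
      by (cases "i = s"; cases "j = s"; cases "i < j") auto
  qed
  have J: "binomial_edge_ideal n (star_at G s) = ideal_gen n A"
    unfolding A_eq[symmetric]
    by (rule binomial_edge_ideal_oriented)
      (auto simp: star_at_def P1_def N_def doubleton_eq_iff)
  have K: "binomial_edge_ideal n (delete_vertex G s) = ideal_gen n B"
    unfolding B_def
  proof (rule binomial_edge_ideal_oriented)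
    show "{i, j} \<in> edges (delete_vertex G s)" if "(i, j) \<in> P2" for i j
      using that by (auto simp: P2_def delete_vertex_def)
    show "(i, j) \<in> P2 \<or> (j, i) \<in> P2" if "{i, j} \<in> edges (delete_vertex G s)" for i j
      using that orient[of i j] by (auto simp: P1_def delete_vertex_def)
  qed
  have AB_eq: "A \<union> B = ?e ` (P1 \<union> P2)" by (simp add: image_Un A_eq B_def)
  have I: "binomial_edge_ideal n G = ideal_gen n (A \<union> B)"
    unfolding AB_eq
    by (rule binomial_edge_ideal_oriented)
      (use orient in \<open>auto simp: P1_def P2_def N_def nbrs_def\<close>)
  have min_A: "minimal_homogeneous_generators n A (ideal_gen n A)"
    unfolding A_eq[symmetric] using P1 by (rule minimal_homogeneous_generators_edges)
  have min_B: "minimal_homogeneous_generators n B (ideal_gen n B)"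
    unfolding B_def using P2 by (rule minimal_homogeneous_generators_edges)
  have min_AB: "minimal_homogeneous_generators n (A \<union> B) (ideal_gen n (A \<union> B))"
    unfolding AB_eq using P by (rule minimal_homogeneous_generators_edges)
  have "A \<inter> B = {}"
  proof (rule ccontr)
    assume "A \<inter> B \<noteq> {}"
    then obtain t i j where t: "t \<in> N" "(i, j) \<in> P2" "edge_binomial s t = (edge_binomial i j :: 'k mpoly)"
      unfolding A_def B_def by auto
    then have "Poly_Mapping.single (Xvar s) 1 + Poly_Mapping.single (Yvar t) 1
        \<in> Poly_Mapping.keys (edge_binomial i j :: 'k mpoly)"
      using edge_monomial_in_keys[of s t, where 'k = 'k] N(3) by auto
    then have "i = s \<or> j = s"
      using keys_edge_binomial[of i j, where 'k = 'k] by (auto simp: edge_monomial_eq_iff[unfolded One_nat_def])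
    then show False using t(2) by (auto simp: P2_def)
  qed
  have A: "A \<subseteq> pring n" "\<And>g. g \<in> A \<Longrightarrow> \<exists>d. homogeneous d g"
    and B: "B \<subseteq> pring n" "\<And>g. g \<in> B \<Longrightarrow> \<exists>d. homogeneous d g"
    using min_A min_B by (auto simp: minimal_homogeneous_generators_def)
  have vars: "Xvar s \<in> indets n" "Yvar s \<in> indets n" using assms(3) by (auto simp: indets_def)
  have free: "free_of (Xvar s) g" "free_of (Yvar s) g" if "g \<in> B" for g
    using that P2' by (auto simp: B_def intro!: free_of_edge_binomial)
  let ?L = "ideal_gen n A \<inter> ideal_gen n B"
  have "f \<in> bdry (koszul n) i ` strand (koszul n) (ideal_gen n A) (Suc i) j \<inter>
      bdry (koszul n) i ` strand (koszul n) (ideal_gen n B) (Suc i) j"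
    if f: "f \<in> cycles (koszul n) ?L i" "f \<in> strand (koszul n) ?L i j" for f i j
  proof (cases "j \<le> i + 3")
    \<comment> \<open>The coefficients of \<open>f\<close> lie in the intersection and have degree
      \<open>j - i \<le> 3\<close>, so \<open>f\<close> is zero.\<close>
    case True
    have "f T = 0" for T
    proof (cases "T \<subseteq> indets n \<and> card T = i")
      case T: True
      show ?thesis
      proof (rule star_inter_low_degree[OF N(2,3) _ P2'])
        show "0 < n" using assms(3) by auto
        show "f T \<in> ideal_gen n (edge_binomial s ` N)" "f T \<in> ideal_gen n (?e ` P2)"
          using strand_koszulD(2)[OF f(2), of T] T unfolding A_def B_def by auto
        show "homogeneous (j - i) (f T)" by (rule strand_koszulD(3)[OF f(2)])
        show "j - i \<le> 3" using True by simp
      qed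
    qed (rule strand_koszulD(1)[OF f(2)])
    then have "f = bdry (koszul n) i 0" by (simp add: fun_eq_iff bdry_def)
    moreover have "0 \<in> strand (koszul n) (ideal_gen n C) (Suc i) j" for C
      by (rule chain_space.subspace_0[OF subspace_strand_ideal_gen])
    ultimately show ?thesis by blast
  next
    case False
    \<comment> \<open>The remaining range \<open>i + 3 < j\<close> is exactly where regularity two
      applies, so the two cases fit together without a gap.\<close>
    have ij: "i + Suc 2 < j" using False by simp
    have fA: "f \<in> cycles (koszul n) (ideal_gen n A) i" "f \<in> strand (koszul n) (ideal_gen n A) i j"
      using f by (cases i; auto simp: strand_def chains_def)+
    have "f \<in> bdry (koszul n) i ` strand (koszul n) (ideal_gen n A) (Suc i) j"
    proof (rule cycle_bounds_of_reg_le[OF A _ _ fA])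
      show "reg_le n 2 (ideal_gen n A)"
        unfolding A_def using N assms(3) by (intro reg_le_star)
    qed (use ij in simp_all)
    moreover have "f \<in> bdry (koszul n) i ` strand (koszul n) (ideal_gen n B) (Suc i) j"
    proof -
      have f_L: "f T \<in> ?L" "\<not> T \<subseteq> indets n \<Longrightarrow> f T = 0" for T
        using strand_koszulD(1,2)[OF f(2), of T] ideal_gen_0
        by (cases "T \<subseteq> indets n \<and> card T = i"; auto)+
      then have "f \<in> kchains n (ideal_gen n B)" by (auto simp: kchains_def)
      moreover have "at_zero (Yvar s) (at_zero (Xvar s) (f T)) = 0" for T
        using star_ideal_at_zero[of "f T" n s N] f_L(1)[of T] N(3) unfolding A_def by blast
      ultimately obtain g where g: "g \<in> kchains n (ideal_gen n B)" "kdiff n g = f"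
        using cycle_bounds_of_free_variables[of "Xvar s" n B "Yvar s" f] vars free kdiff_cycle[OF f(1)]
        by blast
      show ?thesis
        by (rule boundary_in_strand[OF B(2) f(2)]) (use False g kchainsD[OF g(1)] in auto)
    qed
    ultimately show ?thesis by blast
  qed
  then have "cycles (koszul n) ?L i \<inter> strand (koszul n) ?L i j \<subseteq>
      bdry (koszul n) i ` strand (koszul n) (ideal_gen n A) (Suc i) j \<inter>
      bdry (koszul n) i ` strand (koszul n) (ideal_gen n B) (Suc i) j" for i j
    by blast
  note split = tor_dim_splitting[OF A B this]
  have betti: "graded_betti n i j (ideal_gen n (A \<union> B)) = graded_betti n i j (ideal_gen n A)
      + graded_betti n i j (ideal_gen n B) + graded_betti n (i - 1) j ?L" if "0 \<le> i" for i j
  proof (cases "nat i")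
    case 0
    then have "i = 0" using that by simp
    then show ?thesis using split[of 0 j] by (simp add: graded_betti_def)
  next
    case (Suc l)
    then have "\<not> i < 0" "\<not> i - 1 < 0" "nat (i - 1) = l" by auto
    then show ?thesis using split[of "Suc l" j] Suc by (simp add: graded_betti_def)
  qed
  show ?thesis
    unfolding complete_betti_splitting_def I J K
    using ideal_gen_Un[of n A B] min_A min_B min_AB \<open>A \<inter> B = {}\<close> betti by blast
qed

end
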